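(* Let $R=\mathcal{K}[M]$ be the coordinate ring of a projective monomial curve, with homogeneous maximal ideal $\mathfrak{M}$. Let $a$ be a nonzero element of $R$ and put $$\widetilde{R}=a^{-1}C(a)=\left\{\tfrac{x}{a}\in Q(R): x\in C(a)\right\},$$ where $Q(R)$ is the total quotient ring of $R$. Then $$H^1_{\mathfrak{M}}(R)\cong\widetilde{R}/R.$$ Moreover, $\widetilde{R}$ is the Macaulayfication of $R$.
   Context: Let $\mathcal{K}$ be a field, $0<r_1<\dots<r_p<d$ integers with $\gcd(r_1,\dots,r_p,d)=1$, $M=\{s^d,s^{d-r_1}t^{r_1},\dots,s^{d-r_p}t^{r_p},t^d\}\subset\mathcal{K}[s,t]$, $R=\mathcal{K}[M]$ the subring of $\mathcal{K}[s,t]$ generated by $M$ (the coordinate ring of a projective monomial curve), and $\mathfrak{M}=(M)R$ its homogeneous maximal ideal. $H^1_{\mathfrak{M}}(R)$ is the first local cohomology module of $R$ with respect to $\mathfrak{M}$. For a primary decomposition $(a)=\bigcap_i Q_i$ of the ideal $(a)$ of $R$, with each $Q_i$ being $P_i$-primary, $C(a)=\bigcap_{P_i\ne\mathfrak{M}}Q_i$. A ring $\widetilde{R}$ is called the Macaulayfication of $R$ if $R\subseteq\widetilde{R}$, $\widetilde{R}$ is Cohen-Macaulay, and $\widetilde{R}/R$ has finite length (for a monomial curve, $R$ has a unique finite Macaulayfication).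
   Formalization: The nonzero element a is additionally assumed to annihilate H^1_M(R); for arbitrary nonzero a the claim fails (e.g. a=1 with R=K[s^4,s^3t,st^3,t^4]), and the condition is necessary because a·R̃=C(a) lies in R. *)

theory Defs
  imports
    "HOL-Computational_Algebra.Fraction_Field"
    "HOL-Computational_Algebra.Polynomial"
    "HOL-Library.Extended_Nat"
    "HOL-Algebra.Generated_Rings"
    "HOL-Algebra.Ideal_Product"
    "HOL-Algebra.Ring_Divisibility"
    "HOL-Algebra.Module"
begin

section \<open>Modules over a commutative ring\<close>

text \<open>Homomorphisms are only constrained on the carriers.\<close>

definition module_hom ::
  "('a, 'b) ring_scheme \<Rightarrow> ('a, 'm, 'c) module_scheme \<Rightarrow> ('a, 'n, 'e) module_scheme \<Rightarrow> ('m \<Rightarrow> 'n) set"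
  where "module_hom R M N =
    {f \<in> carrier M \<rightarrow> carrier N.
      (\<forall>x\<in>carrier M. \<forall>y\<in>carrier M. f (x \<oplus>\<^bsub>M\<^esub> y) = f x \<oplus>\<^bsub>N\<^esub> f y) \<and>
      (\<forall>c\<in>carrier R. \<forall>x\<in>carrier M. f (c \<odot>\<^bsub>M\<^esub> x) = c \<odot>\<^bsub>N\<^esub> f x)}"

definition module_iso ::
  "('a, 'b) ring_scheme \<Rightarrow> ('a, 'm, 'c) module_scheme \<Rightarrow> ('a, 'n, 'e) module_scheme \<Rightarrow> bool"
  where "module_iso R M N \<longleftrightarrow> (\<exists>f\<in>module_hom R M N. bij_betw f (carrier M) (carrier N))"

text \<open>
  The fields \<open>mult\<close> and \<open>one\<close> of a module record carry no meaning (they are inherited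
  from the ring record), so their values in a quotient module are irrelevant.
\<close>

definition quotient_module ::
  "('a, 'm, 'c) module_scheme \<Rightarrow> 'm set \<Rightarrow> ('a, 'm set) module"
  where "quotient_module M N =
    \<lparr> carrier = a_rcosets\<^bsub>M\<^esub> N,
      monoid.mult = undefined,
      one = undefined,
      zero = N,
      add = set_add M,
      smult = (\<lambda>c X. \<Union>x\<in>X. N +>\<^bsub>M\<^esub> (c \<odot>\<^bsub>M\<^esub> x)) \<rparr>"

text \<open>
  A ring \<open>S\<close> as a module over any ring \<open>R\<close> with \<open>R \<subseteq> S\<close> (in particular over itself).
\<close>

definition ring_module :: "('a, 'b) ring_scheme \<Rightarrow> ('a, 'a) module"
  where "ring_module S =
    \<lparr> carrier = carrier S, monoid.mult = monoid.mult S, one = one S,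
      zero = zero S, add = add S, smult = monoid.mult S \<rparr>"

text \<open>Length of a module: the supremum of the lengths of strictly increasing chains of submodules.\<close>

definition module_length :: "('a, 'b) ring_scheme \<Rightarrow> ('a, 'm, 'c) module_scheme \<Rightarrow> enat"
  where "module_length R M =
    Sup {enat n | n. \<exists>c :: nat \<Rightarrow> 'm set.
           (\<forall>i\<le>n. submodule (c i) R M) \<and> (\<forall>i<n. c i \<subset> c (Suc i))}"


section \<open>Local cohomology\<close>

text \<open>
  Injectivity is the extension property for module homomorphisms along inclusions \<open>L \<subseteq> N\<close>.
  The test modules \<open>N\<close> range over all modules whose elements are taken from the element type of
  the ring \<open>R\<close>.  These include \<open>R\<close> itself with all its ideals, so by Baer's criterion this is
  the same as the extension property with respect to test modules of arbitrary type.
\<close>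

definition injective_module :: "('a, 'b) ring_scheme \<Rightarrow> ('a, 'm, 'c) module_scheme \<Rightarrow> bool"
  where "injective_module R E \<longleftrightarrow> module R E \<and>
    (\<forall>(N :: ('a, 'a) module) L f.
       module R N \<and> submodule L R N \<and> f \<in> module_hom R (N\<lparr>carrier := L\<rparr>) E \<longrightarrow>
       (\<exists>g\<in>module_hom R N E. \<forall>x\<in>L. g x = f x))"

text \<open>Exactness of \<open>0 \<rightarrow> M \<rightarrow> E 0 \<rightarrow> E 1 \<rightarrow> \<dots>\<close> with all \<open>E n\<close> injective.\<close>

definition injective_resolution ::
  "('a, 'b) ring_scheme \<Rightarrow> ('a, 'n, 'c) module_scheme \<Rightarrow>
   ('n \<Rightarrow> 'm) \<Rightarrow> (nat \<Rightarrow> ('a, 'm) module) \<Rightarrow> (nat \<Rightarrow> 'm \<Rightarrow> 'm) \<Rightarrow> bool"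
  where "injective_resolution R M \<epsilon> E \<delta> \<longleftrightarrow>
    module R M \<and>
    (\<forall>n. injective_module R (E n)) \<and>
    \<epsilon> \<in> module_hom R M (E 0) \<and>
    (\<forall>n. \<delta> n \<in> module_hom R (E n) (E (Suc n))) \<and>
    inj_on \<epsilon> (carrier M) \<and>
    \<epsilon> ` carrier M = {x \<in> carrier (E 0). \<delta> 0 x = \<zero>\<^bsub>E 1\<^esub>} \<and>
    (\<forall>n. \<delta> n ` carrier (E n) = {x \<in> carrier (E (Suc n)). \<delta> (Suc n) x = \<zero>\<^bsub>E (Suc (Suc n))\<^esub>})"

text \<open>
  The \<open>I\<close>-torsion functor.  \<open>I [^] n\<close> in the monoid \<open>ideals_set R\<close> is the ideal power \<open>I\<^sup>n\<close>
  (with \<open>I\<^sup>0 = R\<close>).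
\<close>

definition torsion_part ::
  "('a, 'b) ring_scheme \<Rightarrow> 'a set \<Rightarrow> ('a, 'm, 'c) module_scheme \<Rightarrow> 'm set"
  where "torsion_part R I M =
    {x \<in> carrier M. \<exists>n::nat. \<forall>c \<in> I [^]\<^bsub>ideals_set R\<^esub> n. c \<odot>\<^bsub>M\<^esub> x = \<zero>\<^bsub>M\<^esub>}"

text \<open>
  Local cohomology as the right derived functor of the torsion functor:
  the \<open>n\<close>-th cohomology module of the complex \<open>\<Gamma>\<^sub>I(E 0) \<rightarrow> \<Gamma>\<^sub>I(E 1) \<rightarrow> \<dots>\<close>,
  where \<open>(E, \<delta>)\<close> is an injective resolution of the module in question.
\<close>

definition local_cohomology ::
  "('a, 'b) ring_scheme \<Rightarrow> 'a set \<Rightarrow> (nat \<Rightarrow> ('a, 'm) module) \<Rightarrow> (nat \<Rightarrow> 'm \<Rightarrow> 'm) \<Rightarrow> nat \<Rightarrow>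
   ('a, 'm set) module"
  where "local_cohomology R I E \<delta> n =
    quotient_module
      ((E n)\<lparr>carrier := {x \<in> torsion_part R I (E n). \<delta> n x = \<zero>\<^bsub>E (Suc n)\<^esub>}\<rparr>)
      (case n of 0 \<Rightarrow> {\<zero>\<^bsub>E 0\<^esub>} | Suc m \<Rightarrow> \<delta> m ` torsion_part R I (E m))"


section \<open>Primary decomposition\<close>

definition ideal_radical :: "('a, 'b) ring_scheme \<Rightarrow> 'a set \<Rightarrow> 'a set"
  where "ideal_radical R I = {x \<in> carrier R. \<exists>n::nat. x [^]\<^bsub>R\<^esub> n \<in> I}"

definition primary_ideal :: "('a, 'b) ring_scheme \<Rightarrow> 'a set \<Rightarrow> bool"
  where "primary_ideal R Q \<longleftrightarrow> ideal Q R \<and> Q \<noteq> carrier R \<and>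
    (\<forall>x\<in>carrier R. \<forall>y\<in>carrier R. x \<otimes>\<^bsub>R\<^esub> y \<in> Q \<longrightarrow> x \<in> Q \<or> y \<in> ideal_radical R Q)"

text \<open>
  Decompositions need not be irredundant.  An empty intersection of ideals is the whole ring.
\<close>

definition primary_decomposition :: "('a, 'b) ring_scheme \<Rightarrow> 'a set \<Rightarrow> 'a set set \<Rightarrow> bool"
  where "primary_decomposition R I Qs \<longleftrightarrow>
    finite Qs \<and> (\<forall>Q\<in>Qs. primary_ideal R Q) \<and> I = carrier R \<inter> \<Inter>Qs"

text \<open>Intersection of the components \<open>Q\<close> that are \<open>P'\<close>-primary for some \<open>P' \<noteq> P\<close>.\<close>

definition components_away :: "('a, 'b) ring_scheme \<Rightarrow> 'a set \<Rightarrow> 'a set set \<Rightarrow> 'a set"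
  where "components_away R P Qs = carrier R \<inter> \<Inter>{Q \<in> Qs. ideal_radical R Q \<noteq> P}"


section \<open>Cohen-Macaulay rings and Macaulayfications\<close>

definition regular_sequence :: "('a, 'b) ring_scheme \<Rightarrow> 'a list \<Rightarrow> bool"
  where "regular_sequence R xs \<longleftrightarrow>
    set xs \<subseteq> carrier R \<and>
    Idl\<^bsub>R\<^esub> (set xs) \<noteq> carrier R \<and>
    (\<forall>i<length xs. \<forall>y\<in>carrier R.
       (xs ! i) \<otimes>\<^bsub>R\<^esub> y \<in> Idl\<^bsub>R\<^esub> (set (take i xs)) \<longrightarrow> y \<in> Idl\<^bsub>R\<^esub> (set (take i xs)))"

definition ideal_depth :: "('a, 'b) ring_scheme \<Rightarrow> 'a set \<Rightarrow> enat"
  where "ideal_depth R I = Sup {enat (length xs) | xs. regular_sequence R xs \<and> set xs \<subseteq> I}"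

definition prime_height :: "('a, 'b) ring_scheme \<Rightarrow> 'a set \<Rightarrow> enat"
  where "prime_height R P =
    Sup {enat n | n. \<exists>c :: nat \<Rightarrow> 'a set.
           (\<forall>i\<le>n. primeideal (c i) R) \<and> (\<forall>i<n. c i \<subset> c (Suc i)) \<and> c n = P}"

text \<open>
  This is the global form of the definition (as in Eisenbud's \<open>Commutative Algebra\<close>): a Noetherian
  ring all of whose maximal ideals have depth equal to their height.
\<close>

definition cohen_macaulay :: "('a, 'b) ring_scheme \<Rightarrow> bool"
  where "cohen_macaulay R \<longleftrightarrow> cring R \<and> noetherian_ring R \<and>
    (\<forall>P. maximalideal P R \<longrightarrow> ideal_depth R P = prime_height R P)"

text \<open>\<open>id \<in> ring_hom R S\<close> says that \<open>R\<close> is a subring of \<open>S\<close> with the induced operations.\<close>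

definition macaulayfication :: "('a, 'b) ring_scheme \<Rightarrow> ('a, 'c) ring_scheme \<Rightarrow> bool"
  where "macaulayfication R S \<longleftrightarrow>
    id \<in> ring_hom R S \<and>
    cohen_macaulay S \<and>
    module_length R (quotient_module (ring_module S) (carrier R)) \<noteq> \<infinity>"


section \<open>Projective monomial curves\<close>

text \<open>A subset of a type-class ring as a ring structure with the ambient operations.\<close>

definition ring_on :: "'a::comm_ring_1 set \<Rightarrow> 'a ring"
  where "ring_on A = \<lparr> carrier = A, monoid.mult = (*), one = 1, zero = 0, add = (+) \<rparr>"

text \<open>
  \<open>K[s,t]\<close> is \<open>'k poly poly\<close> with \<open>s\<close> the inner and \<open>t\<close> the outer variable,
  and \<open>K(s,t)\<close> is \<open>'k poly poly fract\<close>.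
\<close>

definition var_s :: "'k::field poly poly"
  where "var_s = [:[:0, 1:]:]"

definition var_t :: "'k::field poly poly"
  where "var_t = [:0, 1:]"

definition curve_monomials :: "nat \<Rightarrow> nat \<Rightarrow> (nat \<Rightarrow> nat) \<Rightarrow> 'k::field poly poly set"
  where "curve_monomials d p r =
    {var_s ^ d} \<union> (\<lambda>i. var_s ^ (d - r i) * var_t ^ r i) ` {1..p} \<union> {var_t ^ d}"

definition to_fraction :: "'k::field poly poly \<Rightarrow> 'k poly poly fract"
  where "to_fraction f = Fraction_Field.Fract f 1"

text \<open>
  \<open>R = K[M]\<close>, the subring of \<open>K[s,t]\<close> generated by the constants and the monomials in \<open>M\<close>,
  embedded in \<open>K(s,t)\<close> so that it lies in the same type as its total quotient ring.
\<close>

definition monomial_curve_ring :: "nat \<Rightarrow> nat \<Rightarrow> (nat \<Rightarrow> nat) \<Rightarrow> 'k::field poly poly fract ring"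
  where "monomial_curve_ring d p r =
    ring_on (to_fraction `
      generate_ring (ring_on UNIV) (range (\<lambda>c. [:[:c:]:]) \<union> curve_monomials d p r))"

definition homogeneous_maximal_ideal ::
  "nat \<Rightarrow> nat \<Rightarrow> (nat \<Rightarrow> nat) \<Rightarrow> 'k::field poly poly fract set"
  where "homogeneous_maximal_ideal d p r =
    Idl\<^bsub>monomial_curve_ring d p r\<^esub> (to_fraction ` curve_monomials d p r)"

text \<open>The total quotient ring of a subring \<open>A\<close> of a field, as a subset of that field.\<close>

definition total_quotients :: "'f::field set \<Rightarrow> 'f set"
  where "total_quotients A = {x / y | x y. x \<in> A \<and> y \<in> A \<and> y \<noteq> 0}"

end

theory Submission
  imports Defs
begin

text \<open>Write \<open>u = s\<^sup>d\<close> and \<open>v = t\<^sup>d\<close>, let \<open>M\<close> be the homogeneous maximal ideal (called \<open>irrelevant_ideal\<close> below), let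
\<open>H\<close> be the semigroup of exponents of the monomials in \<open>R\<close>, and let
\<open>S\<close> be the set of all fractions \<open>q\<close> such that \<open>u\<^sup>n q\<close> and \<open>v\<^sup>n q\<close> lie in \<open>R\<close> for some \<open>n\<close>. The proof shows
that \<open>S\<close> is the ring that the theorem is about, in each of its three descriptions.

\<^item> \<open>S/R\<close> is the first local cohomology of \<open>R\<close>. Every monomial of high degree in \<open>R\<close> is divisible by \<open>u\<^sup>n\<close>
  or by \<open>v\<^sup>n\<close> within \<open>R\<close>, hence \<open>S\<close> consists of the \<open>q\<close> for which \<open>M\<^sup>n q \<subseteq> R\<close> for some \<open>n\<close> (lemma
  \<open>ideal_transform_eq\<close>). In an injective resolution \<open>R \<rightarrow> E\<^sub>0 \<rightarrow> E\<^sub>1 \<rightarrow> \<dots>\<close>, a torsion cocycle in \<open>E\<^sub>1\<close> is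
  the image of an \<open>e \<in> E\<^sub>0\<close> that some power of \<open>M\<close> multiplies into \<open>R\<close>. As \<open>R\<close> is a domain, \<open>M\<^sup>n\<close>
  multiplies \<open>e\<close> in the same way as a unique \<open>q \<in> S\<close>, and injectivity of \<open>E\<^sub>0\<close> provides an \<open>e\<close> for every
  \<open>q\<close>. Passing from the cocycle to \<open>q\<close> gives \<open>local_cohomology_1_iso\<close>.

\<^item> \<open>S = a\<^sup>-\<^sup>1 C(a)\<close>. An \<open>M\<close>-primary component contains powers of \<open>u\<close> and \<open>v\<close>, and the radical of any other
  component misses \<open>u\<close> or \<open>v\<close>. Therefore \<open>C(a)\<close> consists of the \<open>x \<in> R\<close> for which \<open>u\<^sup>n x\<close> and \<open>v\<^sup>n x\<close> lie
  in \<open>aR\<close> for some \<open>n\<close>. Since \<open>a\<close> kills the local cohomology, \<open>a S \<subseteq> R\<close>, and so these \<open>x\<close> are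
  exactly the elements of \<open>a S\<close> (lemma \<open>transform_by_components\<close>).

\<^item> \<open>S\<close> is Cohen-Macaulay and \<open>S/R\<close> has finite length. The ring \<open>S\<close> is spanned by the monomials whose exponents
  lie in the saturation of \<open>H\<close>, and it contains \<open>K[u, v]\<close>. All finiteness statements come from a single
  fact, \<open>power_submodule_fg\<close>: every \<open>K[u, v]\<close>-submodule of \<open>K[s, t]\<close> is finitely generated, by Dickson's lemma
  applied to leading exponents. It makes \<open>S\<close> Noetherian, makes \<open>S/R\<close> finite-dimensional, and makes \<open>S\<close>
  integral over \<open>K[u, v]\<close>. From integrality and an elementary form of the Nullstellensatz for \<open>K[X][Y]\<close>,
  each maximal ideal of \<open>S\<close> contains some nonzero \<open>f(u)\<close> and \<open>g(v)\<close>. These form a regular sequence because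
  the saturation contains every exponent that can be moved into it both by a multiple of \<open>(d, 0)\<close> and by
  a multiple of \<open>(0, d)\<close> (lemma \<open>saturated_polys_regular\<close>). So depth and height are at least \<open>2\<close>. They are
  at most \<open>2\<close> because any three polynomials in two variables are algebraically dependent: the relation, written
  around its lexicographically smallest term, excludes regular sequences of length \<open>3\<close> and chains of four
  primes alike (lemma \<open>cancellation_chain_collapses\<close>).\<close>

section \<open>Polynomials in two variables and their exponents\<close>

definition cst :: "'k::field \<Rightarrow> 'k poly poly" where "cst c = [:[:c:]:]"

abbreviation cf :: "'k::field poly poly \<Rightarrow> nat \<Rightarrow> nat \<Rightarrow> 'k" where
  "cf f i j \<equiv> poly.coeff (poly.coeff f j) i"

definition mon :: "nat \<Rightarrow> nat \<Rightarrow> 'k::field poly poly" where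
  "mon i j = Polynomial.monom (Polynomial.monom 1 i) j"

text \<open>An exponent \<open>(i, j)\<close> stands for \<open>s\<^sup>i t\<^sup>j\<close>. In \<open>'k poly poly\<close> the outer variable is \<open>t\<close>, so \<open>j\<close>
  is the index of the outer coefficient.\<close>

definition exponents :: "'k::field poly poly \<Rightarrow> (nat \<times> nat) set" where
  "exponents f = {(i, j). cf f i j \<noteq> 0}"

lemma bivariate_eqI: "(\<And>i j. cf f i j = cf g i j) \<Longrightarrow> f = g"
  by (intro poly_eqI)

lemma cf_cst_mult [simp]: "cf (cst c * f) i j = c * cf f i j"
  by (simp add: cst_def)

lemma cst_0 [simp]: "cst 0 = 0"
  by (simp add: cst_def)

lemma cst_1 [simp]: "cst 1 = 1"
  by (simp add: cst_def one_pCons)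

lemma cst_eq_0_iff [simp]: "cst c = 0 \<longleftrightarrow> c = 0"
  by (simp add: cst_def)

lemma cf_cst: "cf (cst c) i j = (if i = 0 \<and> j = 0 then c else 0)"
  by (cases i; cases j) (simp_all add: cst_def)

lemma cf_mon_mult: "cf (mon a b * f) i j = (if a \<le> i \<and> b \<le> j then cf f (i - a) (j - b) else 0)"
  by (simp add: mon_def coeff_monom_mult not_le)

lemma cf_mon: "cf (mon a b) i j = (if i = a \<and> j = b then 1 else 0)"
  by (auto simp: mon_def coeff_monom)

lemma mon_mult: "mon a b * mon a' b' = mon (a + a') (b + b')"
  by (simp add: mon_def mult_monom)

lemma mon_0_0: "mon 0 0 = 1"
  by (simp add: mon_def)

lemma mon_nonzero [simp]: "mon i j \<noteq> 0"
  by (simp add: mon_def)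

lemma mon_power: "mon i j ^ n = mon (n * i) (n * j)"
  by (induction n) (simp_all add: mon_0_0 mon_mult)

lemma var_s_eq: "var_s = mon 1 0"
  by (rule bivariate_eqI) (simp add: var_s_def cf_mon coeff_pCons split: nat.split)

lemma var_t_eq: "var_t = mon 0 1"
  by (rule bivariate_eqI) (simp add: var_t_def cf_mon coeff_pCons split: nat.split)

lemma cst_add: "cst (a + b) = cst a + cst b"
  by (simp add: cst_def)

lemma cst_mult: "cst (a * b) = cst a * cst b"
  by (simp add: cst_def)

lemma cst_uminus: "cst (- a) = - cst a"
  by (simp add: cst_def)

lemma bivariate_as_sum:
  "f = (\<Sum>j\<le>degree f. \<Sum>i\<le>degree (poly.coeff f j). cst (cf f i j) * mon i j)"
  (is "f = ?g")
proof (rule bivariate_eqI)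
  fix i j
  have "cf ?g i j = (\<Sum>j'\<le>degree f. \<Sum>i'\<le>degree (poly.coeff f j').
      cf (cst (cf f i' j') * mon i' j') i j)"
    by (simp add: Polynomial.coeff_sum)
  also have "\<dots> = (\<Sum>j'\<le>degree f. \<Sum>i'\<le>degree (poly.coeff f j').
      if i = i' then (if j = j' then cf f i j else 0) else 0)"
    by (intro sum.cong refl) (simp only: cf_cst_mult cf_mon, auto)
  also have "\<dots> = (\<Sum>j'\<le>degree f. if j = j' then cf f i j else 0)"
    by (intro sum.cong refl) (auto simp: sum.delta' coeff_eq_0)
  also have "\<dots> = cf f i j"
    by (simp add: coeff_eq_0)
  finally show "cf f i j = cf ?g i j" ..
qed

lemma exponents_induct [consumes 0, case_names zero add monomial]:
  assumes "P 0" and "\<And>f g. P f \<Longrightarrow> P g \<Longrightarrow> P (f + g)"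
    and "\<And>i j c. (i, j) \<in> exponents f \<Longrightarrow> P (cst c * mon i j)"
  shows "P f"
proof -
  have sumP: "P (\<Sum>x\<in>A. h x)" if "finite A" "\<And>x. x \<in> A \<Longrightarrow> P (h x)" for A :: "nat set" and h
    using that by (induction A) (auto intro: assms(1,2))
  have mono: "P (cst (cf f i j) * mon i j)" for i j
  proof (cases "cf f i j = 0")
    case True
    then show ?thesis using assms(1) by simp
  next
    case False
    then show ?thesis by (intro assms(3)) (simp add: exponents_def)
  qed
  show ?thesis
    by (subst bivariate_as_sum) (intro sumP finite_atMost mono)
qed

lemma exponents_0 [simp]: "exponents 0 = {}"
  by (simp add: exponents_def)

lemma exponents_add: "exponents (f + g) \<subseteq> exponents f \<union> exponents g"
  by (auto simp: exponents_def)

lemma exponents_uminus [simp]: "exponents (- f) = exponents f"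
  by (simp add: exponents_def)

lemma exponents_cst_mult: "exponents (cst c * f) \<subseteq> exponents f"
  unfolding exponents_def cf_cst_mult by auto

lemma exponents_cst: "exponents (cst c) \<subseteq> {(0, 0)}"
  by (auto simp: exponents_def cf_cst)

lemma exponents_mon [simp]: "exponents (mon i j) = {(i, j)}"
  by (auto simp: exponents_def cf_mon)

lemma exponents_mon_mult: "exponents (mon a b * f) = (\<lambda>(i, j). (a + i, b + j)) ` exponents f"
proof (intro equalityI subsetI)
  fix x assume "x \<in> exponents (mon a b * f)"
  then obtain i j where x: "x = (i, j)" "a \<le> i" "b \<le> j" "cf f (i - a) (j - b) \<noteq> 0"
    by (auto simp: exponents_def cf_mon_mult split: if_splits)
  then show "x \<in> (\<lambda>(i, j). (a + i, b + j)) ` exponents f"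
    by (intro image_eqI[of _ _ "(i - a, j - b)"]) (auto simp: exponents_def)
qed (auto simp: exponents_def cf_mon_mult)

lemma finite_exponents: "finite (exponents f)"
proof -
  have "exponents f \<subseteq> (\<Union>j\<le>degree f. {..degree (poly.coeff f j)} \<times> {j})"
    by (auto simp: exponents_def intro!: le_degree)
  then show ?thesis by (rule finite_subset) auto
qed

text \<open>Both the coordinate ring of the curve and its Macaulayfication have this form, for a suitable
  semigroup \<open>H\<close>.\<close>

definition span_monomials :: "(nat \<times> nat) set \<Rightarrow> 'k::field poly poly set" where
  "span_monomials H = {f. exponents f \<subseteq> H}"

lemma span_monomials_0 [simp]: "0 \<in> span_monomials H"
  by (simp add: span_monomials_def)

lemma span_monomials_add: "f \<in> span_monomials H \<Longrightarrow> g \<in> span_monomials H \<Longrightarrow> f + g \<in> span_monomials H"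
  using exponents_add[of f g] by (auto simp: span_monomials_def)

lemma span_monomials_uminus: "f \<in> span_monomials H \<Longrightarrow> - f \<in> span_monomials H"
  by (simp add: span_monomials_def)

lemma span_monomials_cst_mult: "f \<in> span_monomials H \<Longrightarrow> cst c * f \<in> span_monomials H"
  using exponents_cst_mult[of c f] unfolding span_monomials_def by blast

lemma span_monomials_mon [simp]: "mon i j \<in> span_monomials H \<longleftrightarrow> (i, j) \<in> H"
  by (simp add: span_monomials_def)

lemma span_monomials_cst: "(0, 0) \<in> H \<Longrightarrow> cst c \<in> span_monomials H"
  using exponents_cst[of c] by (auto simp: span_monomials_def)

text \<open>Statements about \<open>span_monomials H\<close> that are compatible with sums need to be checked on monomials only.\<close>

lemma span_monomials_induct [consumes 1, case_names zero add monomial]: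
  assumes "f \<in> span_monomials H" and "P 0" and "\<And>f g. P f \<Longrightarrow> P g \<Longrightarrow> P (f + g)"
    and "\<And>i j c. (i, j) \<in> H \<Longrightarrow> P (cst c * mon i j)"
  shows "P f"
  using assms by (intro exponents_induct[of P f]) (auto simp: span_monomials_def)

lemma span_monomials_mult:
  assumes f: "f \<in> span_monomials H" and g: "g \<in> span_monomials H'"
    and sum: "\<And>i j i' j'. (i, j) \<in> H \<Longrightarrow> (i', j') \<in> H' \<Longrightarrow> (i + i', j + j') \<in> H''"
  shows "f * g \<in> span_monomials H''"
  using f
proof (induction rule: span_monomials_induct)
  case zero
  show ?case by simp
next
  case (add f1 f2)
  then show ?case by (simp add: distrib_right span_monomials_add)
next
  case (monomial i j c)
  have "mon i j * g \<in> span_monomials H''"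
    using g sum[OF monomial] by (auto simp: span_monomials_def exponents_mon_mult)
  then have "cst c * (mon i j * g) \<in> span_monomials H''"
    by (rule span_monomials_cst_mult)
  then show ?case by (simp only: mult.assoc)
qed

section \<open>Submodules over the algebra of two powers\<close>

text \<open>Fix one element \<open>(a, b)\<close> of \<open>L\<close>. The elements of \<open>L\<close> that are not above it lie in finitely many rows
  and columns, and in each row or column one smallest element suffices.\<close>

lemma dickson:
  fixes L :: "(nat \<times> nat) set"
  shows "\<exists>F\<subseteq>L. finite F \<and> (\<forall>(i, j)\<in>L. \<exists>(a, b)\<in>F. a \<le> i \<and> b \<le> j)"
proof (cases "L = {}")
  case False
  then obtain a b where ab: "(a, b) \<in> L" by auto
  define A where "A = {i. i < a \<and> (\<exists>j. (i, j) \<in> L)}"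
  define B where "B = {j. j < b \<and> (\<exists>i. (i, j) \<in> L)}"
  define F where "F = {(a, b)} \<union> (\<lambda>i. (i, LEAST j. (i, j) \<in> L)) ` A
    \<union> (\<lambda>j. (LEAST i. (i, j) \<in> L, j)) ` B"
  have "finite A" "finite B" by (simp_all add: A_def B_def)
  then have "finite F" by (simp add: F_def)
  moreover have "F \<subseteq> L"
    using ab by (auto simp: F_def A_def B_def intro: LeastI)
  moreover have "\<exists>(a', b')\<in>F. a' \<le> i \<and> b' \<le> j" if ij: "(i, j) \<in> L" for i j
  proof -
    consider "a \<le> i" "b \<le> j" | "i < a" | "j < b" by linarith
    then show ?thesis
    proof cases
      case 1
      then show ?thesis by (auto simp: F_def)
    next
      case 2
      then have "(i, LEAST j. (i, j) \<in> L) \<in> F" using ij by (auto simp: F_def A_def)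
      moreover have "(LEAST j. (i, j) \<in> L) \<le> j" using ij by (rule Least_le)
      ultimately show ?thesis by blast
    next
      case 3
      then have "(LEAST i. (i, j) \<in> L, j) \<in> F" using ij by (auto simp: F_def B_def)
      moreover have "(LEAST i. (i, j) \<in> L) \<le> i" using ij by (rule Least_le)
      ultimately show ?thesis by blast
    qed
  qed
  ultimately show ?thesis by blast
qed auto

text \<open>The refinement needed for \<open>K[s\<^sup>d, t\<^sup>d]\<close>: multiplication by its monomials moves exponents in steps of
  \<open>d\<close>, so Dickson's lemma is applied to each pair of residue classes modulo \<open>d\<close> separately.\<close>

lemma dickson_mod:
  fixes L :: "(nat \<times> nat) set"
  assumes "0 < d"
  obtains F where "finite F" "F \<subseteq> L"
    "\<And>i j. (i, j) \<in> L \<Longrightarrow> \<exists>a b k l. (a, b) \<in> F \<and> i = a + d * k \<and> j = b + d * l"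
proof -
  define C where "C x = {(i, j) \<in> L. i mod d = fst x \<and> j mod d = snd x}" for x
  have "\<forall>x. \<exists>F\<subseteq>C x. finite F \<and> (\<forall>(i, j)\<in>C x. \<exists>(a, b)\<in>F. a \<le> i \<and> b \<le> j)"
    using dickson by blast
  then have "\<exists>F. \<forall>x. F x \<subseteq> C x \<and> finite (F x) \<and> (\<forall>(i, j)\<in>C x. \<exists>(a, b)\<in>F x. a \<le> i \<and> b \<le> j)"
    by (rule choice)
  then obtain F where FC: "\<forall>x. F x \<subseteq> C x \<and> finite (F x) \<and> (\<forall>(i, j)\<in>C x. \<exists>(a, b)\<in>F x. a \<le> i \<and> b \<le> j)"
    by (rule exE)
  have F: "F x \<subseteq> C x" "finite (F x)" for x
    using spec[OF FC, of x] by blast+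
  have F3: "\<exists>(a, b)\<in>F x. a \<le> i \<and> b \<le> j" if "(i, j) \<in> C x" for x i j
    using FC[THEN spec, of x] that by (auto dest!: bspec)
  show ?thesis
  proof (rule that[of "\<Union>x\<in>{..<d} \<times> {..<d}. F x"])
    show "finite (\<Union>x\<in>{..<d} \<times> {..<d}. F x)"
      using F(2) by blast
    show "(\<Union>x\<in>{..<d} \<times> {..<d}. F x) \<subseteq> L"
      using F(1) by (auto simp: C_def)
    fix i j assume ij: "(i, j) \<in> L"
    define x where "x = (i mod d, j mod d)"
    have x: "x \<in> {..<d} \<times> {..<d}" using assms by (simp add: x_def)
    have "(i, j) \<in> C x" using ij by (simp add: C_def x_def)
    then obtain a b where ab: "(a, b) \<in> F x" "a \<le> i" "b \<le> j" using F3 by blast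
    then have "a mod d = i mod d" "b mod d = j mod d"
      using F(1)[of x] by (auto simp: C_def x_def)
    then have "\<exists>k. i = a + d * k" "\<exists>l. j = b + d * l"
      using ab mod_eq_nat1E by metis+
    then show "\<exists>a b k l. (a, b) \<in> (\<Union>x\<in>{..<d} \<times> {..<d}. F x) \<and> i = a + d * k \<and> j = b + d * l"
      using ab(1) x by blast
  qed
qed

text \<open>The submodules of \<open>K[s, t]\<close> over the algebra \<open>K[s\<^sup>d, t\<^sup>d]\<close>.\<close>

definition power_submodule :: "nat \<Rightarrow> 'k::field poly poly set \<Rightarrow> bool" where
  "power_submodule d I \<longleftrightarrow> 0 \<in> I \<and> (\<forall>f\<in>I. \<forall>g\<in>I. f + g \<in> I) \<and> (\<forall>c. \<forall>f\<in>I. cst c * f \<in> I) \<and>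
     (\<forall>f\<in>I. mon d 0 * f \<in> I) \<and> (\<forall>f\<in>I. mon 0 d * f \<in> I)"

lemma power_submoduleD:
  assumes "power_submodule d I"
  shows "0 \<in> I" and "f \<in> I \<Longrightarrow> g \<in> I \<Longrightarrow> f + g \<in> I" and "f \<in> I \<Longrightarrow> cst c * f \<in> I"
    and "f \<in> I \<Longrightarrow> mon d 0 * f \<in> I" and "f \<in> I \<Longrightarrow> mon 0 d * f \<in> I"
  using assms unfolding power_submodule_def by blast+

lemma power_submodule_mon:
  assumes "power_submodule d I" "f \<in> I"
  shows "mon (d * k) (d * l) * f \<in> I"
proof -
  have 1: "mon (d * k) 0 * f \<in> I"
  proof (induction k)
    case (Suc k)
    then have "mon d 0 * (mon (d * k) 0 * f) \<in> I" using power_submoduleD(4)[OF assms(1)] by blast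
    then show ?case by (simp only: mult.assoc[symmetric] mon_mult) simp
  qed (use assms in \<open>simp add: mon_0_0\<close>)
  have "mon 0 (d * l) * (mon (d * k) 0 * f) \<in> I"
  proof (induction l)
    case (Suc l)
    then have "mon 0 d * (mon 0 (d * l) * (mon (d * k) 0 * f)) \<in> I"
      using power_submoduleD(5)[OF assms(1)] by blast
    then show ?case by (simp only: mult.assoc[symmetric] mon_mult) simp
  qed (use 1 in \<open>simp add: mon_0_0\<close>)
  then show ?thesis by (simp only: mult.assoc[symmetric] mon_mult) simp
qed

lemma power_submodule_diff:
  assumes "power_submodule d I" "f \<in> I" "g \<in> I"
  shows "f - g \<in> I"
proof -
  have "cst (-1) * g \<in> I" by (rule power_submoduleD(3)[OF assms(1,3)])
  then have "f + cst (-1) * g \<in> I" by (rule power_submoduleD(2)[OF assms(1,2)])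
  then show ?thesis by (simp add: cst_uminus)
qed

text \<open>The leading exponent for the order that compares powers of \<open>t\<close> first and powers of \<open>s\<close> second.\<close>

definition lead_exp :: "'k::field poly poly \<Rightarrow> nat \<times> nat" where
  "lead_exp f = (degree (lead_coeff f), degree f)"

definition lead_cf :: "'k::field poly poly \<Rightarrow> 'k" where
  "lead_cf f = lead_coeff (lead_coeff f)"

lemma lead_reduction:
  fixes f g :: "'k::field poly poly"
  assumes f: "f \<noteq> 0" and h: "h \<noteq> 0" and "lead_exp h = lead_exp f" "lead_cf h = lead_cf f"
    and "f - h \<noteq> 0"
  shows "degree (f - h) < degree f \<or>
    degree (f - h) = degree f \<and>
    degree (lead_coeff (f - h)) < degree (lead_coeff f)"
proof -
  define n where "n = degree f"
  have n: "degree h = n" using assms by (simp add: lead_exp_def n_def)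
  have le: "degree (f - h) \<le> n"
    using n by (intro degree_diff_le) (simp_all add: n_def)
  define p q where "p = poly.coeff f n" and "q = poly.coeff h n"
  have pq: "degree p = degree q"
    "poly.coeff p (degree p) = poly.coeff q (degree p)"
    using assms(3,4) n by (simp_all add: lead_exp_def lead_cf_def p_def q_def n_def)
  have "p - q = 0 \<or> degree (p - q) < degree p"
  proof (rule ccontr)
    assume *: "\<not> ?thesis"
    then have "degree (p - q) = degree p"
      using degree_diff_le[of p "degree p" q] pq by auto
    then have "lead_coeff (p - q) = 0" using pq(2) by (metis coeff_diff right_minus_eq)
    then show False using * by (metis leading_coeff_0_iff)
  qed
  moreover have "p - q = poly.coeff (f - h) n" by (simp add: p_def q_def)
  ultimately show ?thesis
    using le assms(5) unfolding n_def[symmetric] p_def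
    by (metis le_neq_implies_less leading_coeff_0_iff)
qed

lemma lead_mon_mult:
  fixes g :: "'k::field poly poly"
  assumes g: "g \<noteq> 0" and c: "c \<noteq> 0"
  shows "cst c * (mon k l * g) \<noteq> 0" "lead_exp (cst c * (mon k l * g)) = (fst (lead_exp g) + k, snd (lead_exp g) + l)"
    "lead_cf (cst c * (mon k l * g)) = c * lead_cf g"
proof -
  have nz: "Polynomial.monom (1::'k) k \<noteq> 0" by simp
  have m: "cst c * (mon k l * g) = [:[:c:]:] * (Polynomial.monom (Polynomial.monom 1 k) l * g)"
    by (simp add: mon_def cst_def)
  show "cst c * (mon k l * g) \<noteq> 0" using g c by simp
  have d1: "degree (cst c * (mon k l * g)) = degree g + l"
    using g c by (simp add: degree_mult_eq mon_def cst_def degree_monom_eq)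
  have l1: "lead_coeff (cst c * (mon k l * g)) = [:c:] * (Polynomial.monom 1 k * lead_coeff g)"
    unfolding lead_coeff_mult by (simp add: mon_def cst_def degree_monom_eq)
  show "lead_exp (cst c * (mon k l * g)) = (fst (lead_exp g) + k, snd (lead_exp g) + l)"
    unfolding lead_exp_def l1 using d1 g c by (simp add: degree_mult_eq degree_monom_eq)
  show "lead_cf (cst c * (mon k l * g)) = c * lead_cf g"
    unfolding lead_cf_def l1 unfolding lead_coeff_mult by (simp add: degree_monom_eq)
qed

text \<open>Leading-term reduction: the leading exponents of the elements of \<open>I\<close> are closed under steps of \<open>d\<close> in
  both directions, so finitely many of them generate all others. Elements of \<open>I\<close> with these leading exponents
  allow one to lower the leading exponent of any element of \<open>I\<close>, and this process ends. Generation is expressed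
  by quantifying over the submodules \<open>J\<close> that contain \<open>G\<close>.\<close>

lemma power_submodule_fg:
  fixes I :: "'k::field poly poly set"
  assumes d: "0 < d" and I: "power_submodule d I"
  obtains G where "finite G" "G \<subseteq> I" "\<And>J. power_submodule d J \<Longrightarrow> G \<subseteq> J \<Longrightarrow> I \<subseteq> J"
proof -
  define L where "L = lead_exp ` (I - {0})"
  obtain F where F: "finite F" "F \<subseteq> L"
    "\<And>i j. (i, j) \<in> L \<Longrightarrow> \<exists>a b k l. (a, b) \<in> F \<and> i = a + d * k \<and> j = b + d * l"
    using dickson_mod[OF d] by metis
  have "\<forall>x\<in>F. \<exists>g\<in>I - {0}. lead_exp g = x" using F(2) unfolding L_def by blast
  then obtain g where g: "\<And>x. x \<in> F \<Longrightarrow> g x \<in> I" "\<And>x. x \<in> F \<Longrightarrow> g x \<noteq> 0"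
    "\<And>x. x \<in> F \<Longrightarrow> lead_exp (g x) = x"
    by (metis DiffE singletonI)
  show ?thesis
  proof (rule that[of "g ` F"])
    show "finite (g ` F)" "g ` F \<subseteq> I" using F g by auto
    fix J :: "'k poly poly set" assume J: "power_submodule d J" "g ` F \<subseteq> J"
    have "f \<in> I \<longrightarrow> f \<in> J" for f
    proof (induction f rule: wf_induct[OF wf_measures[of
          "[\<lambda>f. if f = 0 then 0 else 1, degree, \<lambda>f. degree (lead_coeff f)]"]])
      case (1 f)
      show ?case
      proof (intro impI)
        assume fI: "f \<in> I"
        show "f \<in> J"
        proof (cases "f = 0")
          case True
          then show ?thesis using power_submoduleD(1)[OF J(1)] by simp
        next
          case f0: False
          obtain i j where ij: "lead_exp f = (i, j)" by (cases "lead_exp f")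
          then have "(i, j) \<in> L" using f0 fI unfolding L_def by (metis DiffI image_eqI singletonD)
          then obtain a b k l where ab: "(a, b) \<in> F" "i = a + d * k" "j = b + d * l" using F(3) by blast
          define c where "c = lead_cf f / lead_cf (g (a, b))"
          have nz: "lead_cf f \<noteq> 0" "lead_cf (g (a, b)) \<noteq> 0"
            using f0 g(2)[OF ab(1)] by (simp_all add: lead_cf_def)
          define h where "h = cst c * (mon (d * k) (d * l) * g (a, b))"
          have hI: "h \<in> I" and hJ: "h \<in> J"
            unfolding h_def using J ab(1) g(1)[OF ab(1)] I
            by (auto intro!: power_submoduleD(3) power_submodule_mon)
          have h: "h \<noteq> 0" "lead_exp h = lead_exp f" "lead_cf h = lead_cf f"
            unfolding h_def using lead_mon_mult[of "g (a, b)" c "d * k" "d * l"] nz g(2,3)[OF ab(1)] ij ab(2,3)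
            by (simp_all add: c_def)
          have "f - h \<in> J"
          proof (cases "f - h = 0")
            case True
            then show ?thesis using power_submoduleD(1)[OF J(1)] by simp
          next
            case False
            have "f - h \<in> I" using power_submodule_diff[OF I fI hI] .
            moreover have "(f - h, f) \<in> measures [\<lambda>f. if f = 0 then 0 else 1, degree,
                \<lambda>f. degree (lead_coeff f)]"
              using lead_reduction[OF f0 h(1,2,3) False] False f0 by auto
            ultimately show ?thesis using 1 by blast
          qed
          then have "f - h + h \<in> J" using hJ by (rule power_submoduleD(2)[OF J(1)])
          then show ?thesis by simp
        qed
      qed
    qed
    then show "I \<subseteq> J" by blast
  qed
qed

section \<open>Algebraic dependence of three polynomials\<close>

interpretation poly_space: vector_space "\<lambda>c (f :: 'k::field poly poly). cst c * f"
  by unfold_locales (simp_all add: cst_add cst_mult algebra_simps)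

text \<open>The family need not be injective; a repetition is a linear relation, too.\<close>

lemma dependent_family:
  fixes w :: "'i \<Rightarrow> 'k::field poly poly"
  assumes I: "finite I" and B: "finite B" and w: "w ` I \<subseteq> poly_space.span B" and card: "card B < card I"
  shows "\<exists>\<kappa>. (\<exists>i\<in>I. \<kappa> i \<noteq> 0) \<and> (\<Sum>i\<in>I. cst (\<kappa> i) * w i) = 0"
proof (cases "inj_on w I")
  case True
  have "\<not> poly_space.independent (w ` I)"
    using poly_space.independent_span_bound[OF B _ w] card card_image[OF True] by auto
  then obtain u v where "v \<in> w ` I" "u v \<noteq> 0" "(\<Sum>v\<in>w ` I. cst (u v) * v) = 0"
    using poly_space.dependent_finite[of "w ` I"] I by auto
  then show ?thesis
    by (intro exI[of _ "u \<circ> w"]) (auto simp: sum.reindex[OF True])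
next
  case False
  then obtain i j where ij: "i \<in> I" "j \<in> I" "i \<noteq> j" "w i = w j"
    by (auto simp: inj_on_def)
  define \<kappa> where "\<kappa> = (\<lambda>l. if l = i then 1 else if l = j then - 1 else (0::'k))"
  have "(\<Sum>l\<in>I. cst (\<kappa> l) * w l) = (\<Sum>l\<in>{i, j}. cst (\<kappa> l) * w l)"
    using I ij by (intro sum.mono_neutral_right) (auto simp: \<kappa>_def)
  also have "\<dots> = 0" using ij by (simp add: \<kappa>_def cst_uminus)
  finally show ?thesis using ij by (intro exI[of _ \<kappa>]) (auto simp: \<kappa>_def)
qed

definition box :: "nat \<Rightarrow> (nat \<times> nat) set" where "box n = {..n} \<times> {..n}"

lemma span_monomials_box_subset:
  "span_monomials (box n) \<subseteq> poly_space.span ((\<lambda>(i, j). mon i j) ` box n)"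
proof
  fix f :: "'a poly poly" assume "f \<in> span_monomials (box n)"
  then show "f \<in> poly_space.span ((\<lambda>(i, j). mon i j) ` box n)"
    by (induction rule: span_monomials_induct)
      (auto intro: poly_space.span_zero poly_space.span_add poly_space.span_scale poly_space.span_base)
qed

lemma card_box: "card (box n) = (n + 1)\<^sup>2"
  by (simp add: box_def power2_eq_square)

lemma ex_box: "\<exists>n. f \<in> span_monomials (box n)"
proof -
  have "finite (fst ` exponents f \<union> snd ` exponents f)" using finite_exponents by blast
  then obtain n where n: "\<forall>x\<in>fst ` exponents f \<union> snd ` exponents f. x \<le> n"
    using finite_nat_set_iff_bounded_le by blast
  then show ?thesis by (intro exI[of _ n]) (force simp: span_monomials_def box_def)
qed

lemma box_mult: "f \<in> span_monomials (box m) \<Longrightarrow> g \<in> span_monomials (box n) \<Longrightarrow>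
    f * g \<in> span_monomials (box (m + n))"
  by (erule span_monomials_mult, assumption) (auto simp: box_def)

lemma box_power: "f \<in> span_monomials (box m) \<Longrightarrow> f ^ k \<in> span_monomials (box (k * m))"
  by (induction k) (auto simp: box_mult, auto simp: box_def mon_0_0[symmetric])

lemma span_monomials_mono: "H \<subseteq> H' \<Longrightarrow> span_monomials H \<subseteq> span_monomials H'"
  by (auto simp: span_monomials_def)

lemma box_mono: "m \<le> n \<Longrightarrow> box m \<subseteq> box n"
  by (auto simp: box_def)

lemma lowest_term_split:
  fixes w :: "nat \<Rightarrow> 'a::comm_ring_1"
  assumes "a < N" "\<And>i. i < a \<Longrightarrow> w i = 0"
  shows "(\<Sum>i<N. w i * x ^ i) = x ^ a * (w a + x * (\<Sum>i<N - Suc a. w (Suc a + i) * x ^ i))"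
proof -
  have "(\<Sum>i<N. w i * x ^ i) = (\<Sum>i<Suc a. w i * x ^ i) + (\<Sum>i=Suc a..<N. w i * x ^ i)"
    using sum.atLeastLessThan_concat[of 0 "Suc a" N "\<lambda>i. w i * x ^ i"] assms(1)
    by (simp add: atLeast0LessThan)
  then have "(\<Sum>i<N. w i * x ^ i) = (\<Sum>i<a. w i * x ^ i) + w a * x ^ a + (\<Sum>i=Suc a..<N. w i * x ^ i)"
    by simp
  also have "(\<Sum>i<a. w i * x ^ i) = 0" using assms(2) by simp
  also have "(\<Sum>i=Suc a..<N. w i * x ^ i) = (\<Sum>i<N - Suc a. w (Suc a + i) * x ^ (Suc a + i))"
    by (rule sum.reindex_bij_witness[of _ "\<lambda>i. Suc a + i" "\<lambda>i. i - Suc a"]) auto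
  also have "\<dots> = x ^ a * (x * (\<Sum>i<N - Suc a. w (Suc a + i) * x ^ i))"
    by (simp add: sum_distrib_left power_add algebra_simps)
  finally show ?thesis by (simp add: algebra_simps)
qed

text \<open>\<open>K\<close>-subalgebras of \<open>K[s, t]\<close>; closure under negation follows since the constants are included.\<close>

definition subalgebra :: "'k::field poly poly set \<Rightarrow> bool" where
  "subalgebra T \<longleftrightarrow> (\<forall>c. cst c \<in> T) \<and> (\<forall>f\<in>T. \<forall>g\<in>T. f + g \<in> T) \<and> (\<forall>f\<in>T. \<forall>g\<in>T. f * g \<in> T)"

lemma subalgebraD:
  assumes "subalgebra T"
  shows "cst c \<in> T" "f \<in> T \<Longrightarrow> g \<in> T \<Longrightarrow> f + g \<in> T" "f \<in> T \<Longrightarrow> g \<in> T \<Longrightarrow> f * g \<in> T"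
  using assms by (auto simp: subalgebra_def)

lemma subalgebra_0: "subalgebra T \<Longrightarrow> 0 \<in> T" and subalgebra_1: "subalgebra T \<Longrightarrow> 1 \<in> T"
  using subalgebraD(1)[of T 0] subalgebraD(1)[of T 1] by simp_all

lemma subalgebra_uminus: "subalgebra T \<Longrightarrow> f \<in> T \<Longrightarrow> - f \<in> T"
  using subalgebraD(1,3)[of T "-1"] by (metis cst_1 cst_uminus mult_minus1)

lemma subalgebra_power: "subalgebra T \<Longrightarrow> f \<in> T \<Longrightarrow> f ^ n \<in> T"
  by (induction n) (simp_all add: subalgebra_1 subalgebraD)

lemma subalgebra_sum: "subalgebra T \<Longrightarrow> (\<And>i. i \<in> A \<Longrightarrow> h i \<in> T) \<Longrightarrow> sum h A \<in> T"
  by (induction A rule: infinite_finite_induct) (simp_all add: subalgebra_0 subalgebraD)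

text \<open>The \<open>N\<^sup>3\<close> products \<open>x\<^sub>1\<^sup>i x\<^sub>2\<^sup>j x\<^sub>3\<^sup>k\<close> with \<open>i, j, k < N\<close> lie in a space whose dimension grows
  like \<open>N\<^sup>2\<close>, so they are linearly dependent for large \<open>N\<close>. The relation is then written around its
  lexicographically smallest term.\<close>

lemma three_elements_dependent:
  fixes x1 x2 x3 :: "'k::field poly poly"
  assumes T: "subalgebra T" and x: "x1 \<in> T" "x2 \<in> T" "x3 \<in> T"
  obtains a b c \<kappa> g1 g2 g3 where "\<kappa> \<noteq> 0" "g1 \<in> T" "g2 \<in> T" "g3 \<in> T"
    "x1 ^ a * (x2 ^ b * (x3 ^ c * (cst \<kappa> + x3 * g3) + x2 * g2) + x1 * g1) = 0"
proof -
  obtain D1 D2 D3 where D: "x1 \<in> span_monomials (box D1)" "x2 \<in> span_monomials (box D2)"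
    "x3 \<in> span_monomials (box D3)" using ex_box by metis
  define D where "D = D1 + D2 + D3"
  have xD: "x1 \<in> span_monomials (box D)" "x2 \<in> span_monomials (box D)" "x3 \<in> span_monomials (box D)"
    using D span_monomials_mono[OF box_mono] unfolding D_def by (meson le_add1 le_add2 subsetD trans_le_add1)+
  \<comment> \<open>This makes \<open>(3 N D + 1)\<^sup>2 \<le> N\<^sup>2 (3 D + 1)\<^sup>2 < N\<^sup>3\<close>.\<close>
  define N where "N = (3 * D + 1)\<^sup>2 + 1"
  define I where "I = {..<N} \<times> {..<N} \<times> {..<N}"
  define w where "w = (\<lambda>(i, j, k). x1 ^ i * x2 ^ j * x3 ^ k)"
  define B where "B = (\<lambda>(i, j). mon i j :: 'k poly poly) ` box (3 * N * D)"
  have B: "finite B" by (simp add: B_def box_def)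
  have "w ` I \<subseteq> span_monomials (box (3 * N * D))"
  proof (safe)
    fix i j k assume "(i, j, k) \<in> I"
    then have "(i * D + j * D) + k * D \<le> 3 * N * D"
      by (auto simp: I_def distrib_right[symmetric])
    moreover have "w (i, j, k) \<in> span_monomials (box ((i * D + j * D) + k * D))"
      unfolding w_def using xD by (auto intro!: box_mult box_power)
    ultimately show "w (i, j, k) \<in> span_monomials (box (3 * N * D))"
      using span_monomials_mono[OF box_mono] by blast
  qed
  then have span: "w ` I \<subseteq> poly_space.span B"
    using span_monomials_box_subset unfolding B_def by blast
  have N0: "0 < N" by (simp add: N_def)
  have "card B \<le> (3 * N * D + 1)\<^sup>2"
    using card_image_le[of "box (3 * N * D)"] card_box[of "3 * N * D"] unfolding B_def by (simp add: box_def)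
  also have "\<dots> \<le> (N * (3 * D + 1))\<^sup>2"
    using N0 by (intro power_mono) (auto simp: algebra_simps)
  also have "\<dots> = N\<^sup>2 * (N - 1)" unfolding power_mult_distrib by (simp add: N_def)
  also have "\<dots> < N\<^sup>2 * N" using N0 by (intro mult_strict_left_mono) auto
  also have "\<dots> = card I" by (simp add: I_def power2_eq_square)
  finally have "card B < card I" .
  moreover have "finite I" by (simp add: I_def)
  ultimately obtain \<kappa> where \<kappa>: "\<exists>i\<in>I. \<kappa> i \<noteq> 0" "(\<Sum>i\<in>I. cst (\<kappa> i) * w i) = 0"
    using dependent_family[OF _ B span] by blast
  \<comment> \<open>\<open>(a, b, c)\<close> is the lexicographically smallest exponent triple with a nonzero coefficient;
    everything after it is divisible by one more factor \<open>x1\<close>, \<open>x2\<close> or \<open>x3\<close>.\<close>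
  define A1 where "A1 = (\<lambda>i. i < N \<and> (\<exists>j<N. \<exists>k<N. \<kappa> (i, j, k) \<noteq> 0))"
  define a where "a = (LEAST i. A1 i)"
  have "\<exists>i. A1 i" using \<kappa>(1) by (auto simp: A1_def I_def)
  then have a: "A1 a" "\<And>i. i < a \<Longrightarrow> \<not> A1 i" unfolding a_def using LeastI_ex not_less_Least by metis+
  define A2 where "A2 = (\<lambda>j. j < N \<and> (\<exists>k<N. \<kappa> (a, j, k) \<noteq> 0))"
  define b where "b = (LEAST j. A2 j)"
  have "\<exists>j. A2 j" using a(1) by (auto simp: A1_def A2_def)
  then have b: "A2 b" "\<And>i. i < b \<Longrightarrow> \<not> A2 i" unfolding b_def using LeastI_ex not_less_Least by metis+
  define A3 where "A3 = (\<lambda>k. k < N \<and> \<kappa> (a, b, k) \<noteq> 0)"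
  define c where "c = (LEAST k. A3 k)"
  have "\<exists>k. A3 k" using b(1) by (auto simp: A2_def A3_def)
  then have c: "A3 c" "\<And>i. i < c \<Longrightarrow> \<not> A3 i" unfolding c_def using LeastI_ex not_less_Least by metis+
  define W3 where "W3 i j k = cst (\<kappa> (i, j, k))" for i j k
  define W2 where "W2 i j = (\<Sum>k<N. W3 i j k * x3 ^ k)" for i j
  define W1 where "W1 i = (\<Sum>j<N. W2 i j * x2 ^ j)" for i
  have WT: "W3 i j k \<in> T" "W2 i j \<in> T" "W1 i \<in> T" for i j k
  proof -
    show W3: "W3 i j k \<in> T" for i j k using subalgebraD(1)[OF T] by (simp add: W3_def)
    show W2: "W2 i j \<in> T" for i j unfolding W2_def
      by (intro subalgebra_sum[OF T] subalgebraD(3)[OF T] subalgebra_power[OF T] x W3)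
    show "W1 i \<in> T" unfolding W1_def
      by (intro subalgebra_sum[OF T] subalgebraD(3)[OF T] subalgebra_power[OF T] x W2)
  qed
  have "(\<Sum>i\<in>I. cst (\<kappa> i) * w i) = (\<Sum>i<N. W1 i * x1 ^ i)"
    unfolding I_def W1_def W2_def W3_def w_def
    by (simp add: sum.cartesian_product' sum_distrib_left sum_distrib_right mult_ac)
  then have "(\<Sum>i<N. W1 i * x1 ^ i) = 0" using \<kappa>(2) by simp
  moreover
  define g1 where "g1 = (\<Sum>i<N - Suc a. W1 (Suc a + i) * x1 ^ i)"
  define g2 where "g2 = (\<Sum>i<N - Suc b. W2 a (Suc b + i) * x2 ^ i)"
  define g3 where "g3 = (\<Sum>i<N - Suc c. W3 a b (Suc c + i) * x3 ^ i)"
  have "W1 i = 0" if "i < a" for i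
    using a(2)[OF that] a(1) that unfolding W1_def W2_def W3_def
    by (intro sum.neutral ballI) (auto simp: A1_def intro!: sum.neutral)
  then have "(\<Sum>i<N. W1 i * x1 ^ i) = x1 ^ a * (W1 a + x1 * g1)"
    unfolding g1_def using a(1) by (intro lowest_term_split) (auto simp: A1_def)
  moreover have "W2 a i = 0" if "i < b" for i
    using b(2)[OF that] b(1) that unfolding W2_def W3_def
    by (intro sum.neutral ballI) (auto simp: A2_def)
  then have "W1 a = x2 ^ b * (W2 a b + x2 * g2)"
    unfolding g2_def W1_def using b(1) by (intro lowest_term_split) (auto simp: A2_def)
  moreover have "W3 a b i = 0" if "i < c" for i
    using c(2)[OF that] c(1) that unfolding W3_def by (auto simp: A3_def)
  then have "W2 a b = x3 ^ c * (W3 a b c + x3 * g3)"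
    unfolding g3_def W2_def using c(1) by (intro lowest_term_split) (auto simp: A3_def)
  moreover have "W3 a b c = cst (\<kappa> (a, b, c))" by (simp add: W3_def)
  ultimately have "x1 ^ a * (x2 ^ b * (x3 ^ c * (cst (\<kappa> (a, b, c)) + x3 * g3) + x2 * g2) + x1 * g1) = 0"
    by simp
  moreover have "g1 \<in> T" "g2 \<in> T" "g3 \<in> T" unfolding g1_def g2_def g3_def
    by (intro subalgebra_sum[OF T] subalgebraD(3)[OF T] subalgebra_power[OF T] x WT)+
  moreover have "\<kappa> (a, b, c) \<noteq> 0" using c(1) by (simp add: A3_def)
  ultimately show ?thesis using that by blast
qed

section \<open>Maximal ideals contain polynomials in one power\<close>

text \<open>If the leading coefficient of \<open>h\<close> is a unit modulo \<open>\<pi>\<close>, then the topmost coefficient of \<open>q\<close> that is not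
  divisible by \<open>\<pi>\<close> would produce a coefficient of \<open>h * q\<close> that is not divisible by \<open>\<pi>\<close>, and that coefficient has
  index at least the degree of \<open>h\<close>. Ignoring the lower coefficients of \<open>h * q\<close> is essential when the lemma is
  applied to products that are constant modulo \<open>\<pi>\<close>.\<close>

lemma const_dvd_of_const_dvd_mult:
  fixes h q :: "'a::comm_ring_1 poly"
  assumes coprime: "x * \<pi> + y * lead_coeff h = 1"
    and dvd: "\<And>n. degree h \<le> n \<Longrightarrow> \<pi> dvd poly.coeff (h * q) n"
  shows "\<pi> dvd poly.coeff q j"
proof (induction "Suc (degree q) - j" arbitrary: j rule: less_induct)
  case less
  show ?case
  proof (cases "j \<le> degree q")
    case False
    then show ?thesis by (simp add: coeff_eq_0)
  next
    case True
    define m where "m = degree h"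
    have high: "\<pi> dvd poly.coeff q j'" if "j < j'" for j'
      using that True by (intro less) linarith
    have "poly.coeff (h * q) (m + j) =
        (\<Sum>i\<le>m + j. poly.coeff h i * poly.coeff q (m + j - i))"
      by (rule coeff_mult)
    also have "\<dots> = poly.coeff h m * poly.coeff q j +
        (\<Sum>i\<in>{..m + j} - {m}. poly.coeff h i * poly.coeff q (m + j - i))"
      by (subst sum.remove[of _ m]) auto
    finally have eq: "poly.coeff h m * poly.coeff q j = poly.coeff (h * q) (m + j) -
        (\<Sum>i\<in>{..m + j} - {m}. poly.coeff h i * poly.coeff q (m + j - i))"
      by simp
    have "\<pi> dvd (\<Sum>i\<in>{..m + j} - {m}. poly.coeff h i * poly.coeff q (m + j - i))"
    proof (rule dvd_sum)
      fix i assume "i \<in> {..m + j} - {m}"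
      then consider "i < m" | "m < i" by force
      then show "\<pi> dvd poly.coeff h i * poly.coeff q (m + j - i)"
      proof cases
        case 1
        then show ?thesis by (intro dvd_mult high) linarith
      next
        case 2
        then show ?thesis by (simp add: coeff_eq_0 m_def)
      qed
    qed
    then have "\<pi> dvd poly.coeff h m * poly.coeff q j"
      unfolding eq using dvd by (intro dvd_diff) (simp_all add: m_def)
    then have "\<pi> dvd \<pi> * (x * poly.coeff q j) + y * (poly.coeff h m * poly.coeff q j)"
      by (rule dvd_add[OF dvd_triv_left dvd_mult])
    also have "\<dots> = (x * \<pi> + y * lead_coeff h) * poly.coeff q j"
      by (simp add: m_def algebra_simps)
    finally show ?thesis using coprime by simp
  qed
qed

text \<open>The case of the Nullstellensatz that is needed. Suppose that a maximal ideal \<open>p\<close> of \<open>K[X][Y]\<close> meets \<open>K[X]\<close>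
  only in \<open>0\<close>. By pseudo-division, an \<open>h\<close> of least \<open>Y\<close>-degree in \<open>p\<close> with leading coefficient \<open>c\<close>
  divides \<open>c\<^sup>k g\<close> for all \<open>g \<in> p\<close>. But \<open>\<pi> = 1 + X c\<close>, which is no unit, is invertible modulo \<open>p\<close>;
  so modulo \<open>\<pi>\<close> the constant \<open>c\<^sup>k\<close> is a multiple of \<open>h\<close>, whose degree is positive and whose leading
  coefficient is a unit. Hence \<open>\<pi>\<close> divides \<open>c\<^sup>k\<close>, although it is coprime to \<open>c\<close>.\<close>

lemma maximal_ideal_meets_coefficients:
  fixes p :: "'k::field poly poly set"
  assumes add: "\<And>f g. f \<in> p \<Longrightarrow> g \<in> p \<Longrightarrow> f + g \<in> p" and mult: "\<And>f g. f \<in> p \<Longrightarrow> g * f \<in> p"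
    and proper: "1 \<notin> p" and max: "\<And>f. f \<notin> p \<Longrightarrow> \<exists>g. 1 - f * g \<in> p"
  shows "\<exists>f. f \<noteq> 0 \<and> [:f:] \<in> p"
proof (rule ccontr)
  assume none: "\<not> ?thesis"
  define X :: "'k poly" where "X = [:0, 1:]"
  \<comment> \<open>\<open>p\<close> is not zero: \<open>X\<close> is not in \<open>p\<close>, so it has an inverse modulo \<open>p\<close>, but it has none in \<open>K[X][Y]\<close>.\<close>
  obtain b where b: "1 - [:X:] * b \<in> p"
  proof -
    have "X \<noteq> 0" by (simp add: X_def)
    then have "[:X:] \<notin> p" using none by blast
    then show ?thesis using max that by blast
  qed
  have "1 - [:X:] * b \<noteq> 0"
  proof
    assume "1 - [:X:] * b = 0"
    then have "cf 1 0 0 = cf ([:X:] * b) 0 0" by simp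
    then show False by (simp add: X_def)
  qed
  then have ex: "\<exists>n h. h \<in> p \<and> h \<noteq> 0 \<and> degree h = n" using b by blast
  define m where "m = (LEAST n. \<exists>h. h \<in> p \<and> h \<noteq> 0 \<and> degree h = n)"
  obtain h where h: "h \<in> p" "h \<noteq> 0" "degree h = m"
    unfolding m_def using LeastI_ex[OF ex] by blast
  have min: "m \<le> degree g" if "g \<in> p" "g \<noteq> 0" for g
    unfolding m_def using that by (intro Least_le) blast
  have m: "0 < m"
  proof (rule ccontr)
    assume "\<not> 0 < m"
    then obtain f where "h = [:f:]" using h(3) by (metis degree_eq_zeroE gr0I)
    then show False using none h by auto
  qed
  define c where "c = lead_coeff h"
  have c: "c \<noteq> 0" using leading_coeff_0_iff[of h] h(2) unfolding c_def by blast
  define \<pi> where "\<pi> = 1 + X * c"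
  have \<pi>_pCons: "\<pi> = pCons 1 c" by (simp add: \<pi>_def X_def one_pCons)
  then have "\<pi> \<noteq> 0" using c by simp
  then obtain \<alpha> where \<alpha>: "1 - [:\<pi>:] * \<alpha> \<in> p" using max none by blast
  define g where "g = 1 - [:\<pi>:] * \<alpha>"
  obtain q r where qr: "pseudo_divmod g h = (q, r)" by fastforce
  define k where "k = Suc (degree g) - degree h"
  have div: "Polynomial.smult (c ^ k) g = h * q + r" "r = 0 \<or> degree r < m"
    using pseudo_divmod[OF h(2) qr] h(3) by (simp_all add: c_def k_def)
  have "r = [:c ^ k:] * g + - q * h" using div(1) by (simp add: algebra_simps)
  also have "\<dots> \<in> p" using add mult \<alpha> h(1) unfolding g_def by blast
  finally have "r \<in> p" .
  then have "r = 0" using min div(2) by fastforce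
  then have hq: "h * q = [:c ^ k:] - Polynomial.smult \<pi> (Polynomial.smult (c ^ k) \<alpha>)"
    using div(1) by (simp add: g_def smult_diff_right one_pCons algebra_simps)
  have "\<pi> dvd poly.coeff q j" for j
  proof (rule const_dvd_of_const_dvd_mult)
    show "1 * \<pi> + - X * lead_coeff h = 1" by (simp add: \<pi>_def c_def)
    fix n assume "degree h \<le> n"
    then have "poly.coeff [:c ^ k:] n = 0" using h(3) m by (cases n) auto
    then show "\<pi> dvd poly.coeff (h * q) n" unfolding hq by simp
  qed
  then have "\<pi> dvd poly.coeff (h * q) 0" by (simp add: coeff_mult_0)
  then have "\<pi> dvd poly.coeff (h * q) 0 + \<pi> * (c ^ k * poly.coeff \<alpha> 0)" by simp
  also have "\<dots> = c ^ k" by (simp add: hq)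
  finally have "\<pi> dvd c ^ k" .
  moreover have "\<pi> dvd c ^ n \<Longrightarrow> \<pi> dvd 1" for n
  proof (induction n)
    case (Suc n)
    have "c ^ n = \<pi> * c ^ n - X * c ^ Suc n" by (simp add: \<pi>_def algebra_simps)
    then have "\<pi> dvd c ^ n" using Suc.prems by (metis dvd_diff dvd_mult dvd_triv_left)
    then show ?case by (rule Suc.IH)
  qed simp
  ultimately have "\<pi> dvd 1" by blast
  then have "degree \<pi> = 0" using is_unit_iff_degree[OF \<open>\<pi> \<noteq> 0\<close>] by blast
  then show False using c by (simp add: \<pi>_pCons)
qed

text \<open>Evaluation of polynomials through a ring homomorphism on the coefficients; used twice below, for one and for
  two variables.\<close>

lemma poly_map_poly_hom:
  fixes \<phi> :: "'a::comm_ring_1 \<Rightarrow> 'b::comm_ring_1" and y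
  assumes add: "\<And>a b. \<phi> (a + b) = \<phi> a + \<phi> b" and mult: "\<And>a b. \<phi> (a * b) = \<phi> a * \<phi> b"
  defines "e \<equiv> \<lambda>p. poly (map_poly \<phi> p) y"
  shows "e (p + q) = e p + e q" "e (p * q) = e p * e q" "e [:c:] = \<phi> c"
    "\<phi> 1 = 1 \<Longrightarrow> e [:0, 1:] = y"
proof -
  have 0: "\<phi> 0 = 0" using add[of 0 0] by simp
  have sum: "\<phi> (sum h A) = (\<Sum>i\<in>A. \<phi> (h i))" for h and A :: "nat set"
    by (induction A rule: infinite_finite_induct) (simp_all add: 0 add)
  have "map_poly \<phi> (p + q) = map_poly \<phi> p + map_poly \<phi> q"
    by (rule poly_eqI) (simp add: coeff_map_poly 0 add)
  then show "e (p + q) = e p + e q" by (simp add: e_def)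
  have "map_poly \<phi> (p * q) = map_poly \<phi> p * map_poly \<phi> q"
    by (rule poly_eqI) (simp add: coeff_map_poly 0 coeff_mult sum mult)
  then show "e (p * q) = e p * e q" by (simp add: e_def)
  have c: "map_poly \<phi> [:c:] = [:\<phi> c:]" for c
    by (rule poly_eqI) (simp add: coeff_map_poly 0 coeff_pCons split: nat.split)
  then show "e [:c:] = \<phi> c" by (simp add: e_def)
  assume 1: "\<phi> 1 = 1"
  have "map_poly \<phi> [:0, 1:] = [:0, 1:]"
    by (rule poly_eqI) (simp add: coeff_map_poly 0 1 coeff_pCons split: nat.split)
  then show "e [:0, 1:] = y" by (simp add: e_def)
qed

text \<open>Substitution of elements of \<open>K[s, t]\<close> for the variables of a polynomial in one or two variables. In
  \<open>eval2\<close> the inner variable becomes \<open>x\<close> and the outer one \<open>y\<close>, so both orders of \<open>s\<^sup>d\<close> and \<open>t\<^sup>d\<close>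
  are available.\<close>

definition eval1 :: "'k::field poly poly \<Rightarrow> 'k poly \<Rightarrow> 'k poly poly" where
  "eval1 x f = poly (map_poly cst f) x"

definition eval2 :: "'k::field poly poly \<Rightarrow> 'k poly poly \<Rightarrow> 'k poly poly \<Rightarrow> 'k poly poly" where
  "eval2 x y F = poly (map_poly (eval1 x) F) y"

lemmas eval1_hom = poly_map_poly_hom[of cst, OF cst_add cst_mult, folded eval1_def]

lemmas eval2_hom = poly_map_poly_hom[of "eval1 x" for x, OF eval1_hom(1,2), folded eval2_def]

lemma eval1_1: "eval1 x 1 = 1"
  using eval1_hom(3)[of x 1] by (simp add: one_pCons)

lemma eval2_1: "eval2 x y 1 = 1"
  by (metis eval1_1 eval2_hom(3) one_pCons)

lemma eval2_cst: "eval2 x y (cst c) = cst c"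
  by (simp only: cst_def[of c] eval2_hom(3) eval1_hom(3))

lemma eval2_vars: "eval2 x y [:[:0, 1:]:] = x" "eval2 x y [:0, 1:] = y"
  by (simp_all add: eval2_hom(3,4) eval1_hom(4) eval1_1)

lemma eval1_altdef: "eval1 x f = (\<Sum>a\<le>degree f. cst (poly.coeff f a) * x ^ a)"
proof -
  have "degree (map_poly cst f) = degree f"
    by (intro degree_map_poly) auto
  then show ?thesis by (simp add: eval1_def poly_altdef coeff_map_poly)
qed

text \<open>The \<open>A\<close>-module \<open>A[z]\<close> is a submodule of \<open>K[s, t]\<close> over \<open>K[s\<^sup>d, t\<^sup>d]\<close> and hence finitely generated, so
  it is already spanned by finitely many powers of \<open>z\<close>.\<close>

lemma integral_over_power_algebra:
  fixes A :: "'k::field poly poly set"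
  assumes d: "0 < d" and A: "subalgebra A" and uv: "mon d 0 \<in> A" "mon 0 d \<in> A"
  obtains n F where "\<And>i. F i \<in> A" "z ^ Suc n = (\<Sum>i\<le>n. F i * z ^ i)"
proof -
  define J where "J n = {(\<Sum>i\<le>n. F i * z ^ i) | F. \<forall>i. F i \<in> A}" for n :: nat
  have JI: "(\<Sum>i\<le>n. F i * z ^ i) \<in> J n" if "\<And>i. F i \<in> A" for F n
    using that by (auto simp: J_def)
  have mult: "h * f \<in> J n" if h: "h \<in> A" and "f \<in> J n" for h f n
  proof -
    obtain F where F: "f = (\<Sum>i\<le>n. F i * z ^ i)" "\<And>i. F i \<in> A" using \<open>f \<in> J n\<close> by (auto simp: J_def)
    have "h * f = (\<Sum>i\<le>n. (h * F i) * z ^ i)" by (simp add: F sum_distrib_left mult.assoc)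
    then show ?thesis using JI[of "\<lambda>i. h * F i"] F(2) h subalgebraD(3)[OF A] by metis
  qed
  have add: "f + g \<in> J n" if "f \<in> J n" "g \<in> J n" for f g n
  proof -
    obtain F where F: "f = (\<Sum>i\<le>n. F i * z ^ i)" "\<And>i. F i \<in> A" using \<open>f \<in> J n\<close> by (auto simp: J_def)
    obtain G where G: "g = (\<Sum>i\<le>n. G i * z ^ i)" "\<And>i. G i \<in> A" using \<open>g \<in> J n\<close> by (auto simp: J_def)
    have "f + g = (\<Sum>i\<le>n. (F i + G i) * z ^ i)" by (simp add: F G sum.distrib distrib_right)
    then show ?thesis using JI[of "\<lambda>i. F i + G i"] F(2) G(2) subalgebraD(2)[OF A] by metis
  qed
  have zero: "0 \<in> J n" for n using JI[of "\<lambda>_. 0" n] subalgebra_0[OF A] by simp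
  have sub: "power_submodule d (J n)" for n
    unfolding power_submodule_def using add zero mult uv subalgebraD(1)[OF A] by blast
  have suc: "J n \<subseteq> J (Suc n)" for n
  proof
    fix f assume "f \<in> J n"
    then obtain F where F: "f = (\<Sum>i\<le>n. F i * z ^ i)" "\<And>i. F i \<in> A" by (auto simp: J_def)
    have "(\<Sum>i\<le>Suc n. (F(Suc n := 0)) i * z ^ i) \<in> J (Suc n)"
      using F(2) subalgebra_0[OF A] by (intro JI) simp
    then show "f \<in> J (Suc n)" by (simp add: F(1))
  qed
  have mono: "J m \<subseteq> J n" if "m \<le> n" for m n
    by (rule lift_Suc_mono_le[of J, OF suc that])
  have "power_submodule d (\<Union>n. J n)"
  proof -
    have "f + g \<in> (\<Union>n. J n)" if "f \<in> (\<Union>n. J n)" "g \<in> (\<Union>n. J n)" for f g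
    proof -
      from that obtain m n where "f \<in> J m" "g \<in> J n" by blast
      then have "f \<in> J (max m n)" "g \<in> J (max m n)" using mono[of _ "max m n"] by (meson max.cobounded1 max.cobounded2 subsetD)+
      then show ?thesis using add by blast
    qed
    then show ?thesis unfolding power_submodule_def
      by (intro conjI ballI allI) (auto intro: zero mult uv subalgebraD(1)[OF A])
  qed
  then obtain G where G: "finite G" "G \<subseteq> (\<Union>n. J n)" "\<And>I. power_submodule d I \<Longrightarrow> G \<subseteq> I \<Longrightarrow> (\<Union>n. J n) \<subseteq> I"
    using power_submodule_fg[OF d] by metis
  have "\<exists>n. G \<subseteq> J n" using G(1,2)
  proof (induction G)
    case (insert g G)
    then obtain m n where "g \<in> J m" "G \<subseteq> J n" by blast
    then have "insert g G \<subseteq> J (max m n)" using mono[of _ "max m n"] by (meson insert_subset max.cobounded1 max.cobounded2 order_trans subsetD)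
    then show ?case by blast
  qed simp
  then obtain n where "G \<subseteq> J n" by blast
  then have "(\<Union>n. J n) \<subseteq> J n" using G(3) sub by blast
  moreover have "z ^ Suc n \<in> J (Suc n)"
  proof -
    have "(\<Sum>i\<le>Suc n. (if i = Suc n then 1 else 0) * z ^ i) = (\<Sum>i\<le>Suc n. if i = Suc n then z ^ i else 0)"
      by (intro sum.cong) auto
    then have "z ^ Suc n = (\<Sum>i\<le>Suc n. (if i = Suc n then 1 else 0) * z ^ i)" by simp
    then show ?thesis using JI[of "\<lambda>i. if i = Suc n then 1 else 0" "Suc n"] subalgebra_0[OF A] subalgebra_1[OF A] by metis
  qed
  ultimately have "z ^ Suc n \<in> J n" by blast
  then show ?thesis using that by (auto simp: J_def)
qed

text \<open>Maximality in the form in which it is used: every element of \<open>T\<close> outside \<open>P\<close> is invertible modulo \<open>P\<close>.\<close>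

definition max_ideal :: "'k::field poly poly set \<Rightarrow> 'k poly poly set \<Rightarrow> bool" where
  "max_ideal T P \<longleftrightarrow> P \<subseteq> T \<and> (\<forall>f\<in>P. \<forall>g\<in>P. f + g \<in> P) \<and> (\<forall>f\<in>P. \<forall>g\<in>T. g * f \<in> P) \<and>
     1 \<notin> P \<and> (\<forall>f\<in>T - P. \<exists>g\<in>T. 1 - f * g \<in> P)"

text \<open>Maximal ideals contract to maximal ideals along integral extensions. If \<open>z\<close> inverts \<open>a\<close> modulo \<open>P\<close> and
  \<open>z\<^sup>n\<^sup>+\<^sup>1 = \<Sum>\<^sub>i F\<^sub>i z\<^sup>i\<close>, then multiplying by \<open>a\<^sup>n\<close> gives \<open>z \<equiv> \<Sum>\<^sub>i F\<^sub>i a\<^sup>n\<^sup>-\<^sup>i\<close> modulo \<open>P\<close>, which lies in \<open>A\<close>.\<close>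

lemma max_ideal_contraction:
  assumes d: "0 < d" and T: "subalgebra T" and P: "max_ideal T P"
    and A: "subalgebra A" "A \<subseteq> T" "mon d 0 \<in> A" "mon 0 d \<in> A" and a: "a \<in> A" "a \<notin> P"
  shows "\<exists>b\<in>A. 1 - a * b \<in> P"
proof -
  have Padd: "f + g \<in> P" if "f \<in> P" "g \<in> P" for f g using P that by (auto simp: max_ideal_def)
  have Pmult: "g * f \<in> P" if "f \<in> P" "g \<in> T" for f g using P that by (auto simp: max_ideal_def)
  obtain z where z: "z \<in> T" "1 - a * z \<in> P" using P a A(2) unfolding max_ideal_def by blast
  have P0: "0 \<in> P" using Pmult[OF z(2) subalgebra_0[OF T]] by simp
  have aT: "a \<in> T" using a A(2) by blast
  have azT: "(a * z) ^ i \<in> T" for i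
    by (intro subalgebra_power[OF T] subalgebraD(3)[OF T] aT z(1))
  have pow: "1 - (a * z) ^ i \<in> P" for i
  proof (induction i)
    case (Suc i)
    have "1 - (a * z) ^ Suc i = (1 - (a * z) ^ i) + (a * z) ^ i * (1 - a * z)" by (simp add: algebra_simps)
    also have "\<dots> \<in> P" by (intro Padd Suc Pmult z azT)
    finally show ?case .
  qed (use P0 in simp)
  obtain n F where F: "\<And>i. F i \<in> A" "z ^ Suc n = (\<Sum>i\<le>n. F i * z ^ i)"
    using integral_over_power_algebra[OF d A(1,3,4)] by metis
  define b where "b = (\<Sum>i\<le>n. F i * a ^ (n - i))"
  have bA: "b \<in> A" unfolding b_def
    by (intro subalgebra_sum[OF A(1)] subalgebraD(3)[OF A(1)] subalgebra_power[OF A(1)] F a)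
  have sumP: "sum h I \<in> P" if "\<And>i. i \<in> I \<Longrightarrow> h i \<in> P" for h and I :: "nat set"
    using that by (induction I rule: infinite_finite_induct) (auto intro: P0 Padd)
  have "z * (a * z) ^ n = a ^ n * z ^ Suc n" by (simp add: power_mult_distrib algebra_simps)
  also have "\<dots> = (\<Sum>i\<le>n. F i * a ^ (n - i) * (a * z) ^ i)"
    unfolding F(2) sum_distrib_left
  proof (intro sum.cong refl)
    fix i assume "i \<in> {..n}"
    then have "a ^ n = a ^ (n - i) * a ^ i" by (simp flip: power_add)
    then show "a ^ n * (F i * z ^ i) = F i * a ^ (n - i) * (a * z) ^ i"
      by (simp add: power_mult_distrib algebra_simps)
  qed
  finally have "b - z * (a * z) ^ n = (\<Sum>i\<le>n. F i * a ^ (n - i) * (1 - (a * z) ^ i))"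
    by (simp add: b_def sum_subtractf algebra_simps)
  also have "\<dots> \<in> P"
  proof (intro sumP Pmult pow)
    fix i show "F i * a ^ (n - i) \<in> T"
      using A(2) by (intro subalgebraD(3)[OF T] subalgebra_power[OF T] aT) (auto intro: F)
  qed
  finally have bz: "b - z * (a * z) ^ n \<in> P" .
  have "1 - a * b = (1 - a * z) + (a * z) * (1 - (a * z) ^ n) + (- a) * (b - z * (a * z) ^ n)"
    by (simp add: algebra_simps)
  also have "\<dots> \<in> P"
    by (intro Padd Pmult z pow bz subalgebraD(3)[OF T] subalgebra_uminus[OF T] aT)
  finally show ?thesis using bA by blast
qed

text \<open>The preimage of \<open>P\<close> under \<open>K[X][Y] \<rightarrow> T\<close>, \<open>X \<mapsto> x\<close>, \<open>Y \<mapsto> y\<close>, is a maximal ideal and therefore meets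
  \<open>K[X]\<close>.\<close>

lemma max_ideal_contains_eval1:
  fixes P :: "'k::field poly poly set"
  assumes d: "0 < d" and T: "subalgebra T" and P: "max_ideal T P"
    and xy: "x \<in> T" "y \<in> T" "{x, y} = {mon d 0, mon 0 d}"
  shows "\<exists>f. f \<noteq> 0 \<and> eval1 x f \<in> P"
proof -
  define A where "A = range (eval2 x y)"
  have A: "subalgebra A"
    unfolding subalgebra_def A_def
  proof (intro conjI allI ballI)
    fix c show "cst c \<in> range (eval2 x y)" using eval2_cst by (metis rangeI)
  next
    fix f g assume "f \<in> range (eval2 x y)" "g \<in> range (eval2 x y)"
    then show "f + g \<in> range (eval2 x y)" "f * g \<in> range (eval2 x y)"
      by (auto simp flip: eval2_hom(1,2))
  qed
  have e1T: "eval1 x f \<in> T" for f unfolding eval1_altdef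
    by (intro subalgebra_sum[OF T] subalgebraD[OF T] subalgebra_power[OF T] xy)
  have "eval2 x y F \<in> T" for F
    unfolding eval2_def poly_altdef
  proof (intro subalgebra_sum[OF T] subalgebraD(3)[OF T] subalgebra_power[OF T] xy)
    fix i
    have "eval1 x 0 = 0" by (simp add: eval1_def)
    then show "poly.coeff (map_poly (eval1 x) F) i \<in> T" using e1T by (simp add: coeff_map_poly)
  qed
  then have AT: "A \<subseteq> T" by (auto simp: A_def)
  have "x \<in> A" "y \<in> A" unfolding A_def using eval2_vars by (metis rangeI)+
  then have uv: "mon d 0 \<in> A" "mon 0 d \<in> A" using xy(3) by (metis insert_iff singletonD)+
  have "\<exists>f. f \<noteq> 0 \<and> [:f:] \<in> {F. eval2 x y F \<in> P}"
  proof (rule maximal_ideal_meets_coefficients)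
    fix F assume "F \<notin> {F. eval2 x y F \<in> P}"
    then have "eval2 x y F \<in> A" "eval2 x y F \<notin> P" by (auto simp: A_def)
    then obtain G where G: "1 - eval2 x y F * eval2 x y G \<in> P"
      using max_ideal_contraction[OF d T P A AT uv] unfolding A_def by blast
    have "eval2 x y (1 - F * G) + eval2 x y (F * G) = 1"
      unfolding eval2_hom(1)[symmetric] by (simp add: eval2_1)
    then have "eval2 x y (1 - F * G) = 1 - eval2 x y F * eval2 x y G"
      by (simp add: eval2_hom(2) algebra_simps)
    then show "\<exists>G. 1 - F * G \<in> {F. eval2 x y F \<in> P}"
      using G by (intro exI[of _ G]) simp
  next
    have ET: "eval2 x y G \<in> T" for G using AT by (auto simp: A_def)
    fix F G assume "F \<in> {F. eval2 x y F \<in> P}"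
    then show "G * F \<in> {F. eval2 x y F \<in> P}" using P ET by (simp add: max_ideal_def eval2_hom(2))
  qed (use P in \<open>auto simp: max_ideal_def eval2_hom(1) eval2_1\<close>)
  then show ?thesis by (auto simp: eval2_hom(3))
qed

section \<open>Subrings of a field\<close>

definition subring_set :: "'a::comm_ring_1 set \<Rightarrow> bool" where
  "subring_set A \<longleftrightarrow> 1 \<in> A \<and> (\<forall>x\<in>A. - x \<in> A) \<and> (\<forall>x\<in>A. \<forall>y\<in>A. x + y \<in> A) \<and> (\<forall>x\<in>A. \<forall>y\<in>A. x * y \<in> A)"

lemma subring_setD:
  assumes "subring_set A"
  shows "0 \<in> A" "1 \<in> A" "x \<in> A \<Longrightarrow> - x \<in> A" "x \<in> A \<Longrightarrow> y \<in> A \<Longrightarrow> x + y \<in> A"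
    "x \<in> A \<Longrightarrow> y \<in> A \<Longrightarrow> x * y \<in> A" "x \<in> A \<Longrightarrow> y \<in> A \<Longrightarrow> x - y \<in> A" "x \<in> A \<Longrightarrow> x ^ n \<in> A"
proof -
  show *: "1 \<in> A" "x \<in> A \<Longrightarrow> - x \<in> A" "x \<in> A \<Longrightarrow> y \<in> A \<Longrightarrow> x + y \<in> A" "x \<in> A \<Longrightarrow> y \<in> A \<Longrightarrow> x * y \<in> A" for x y
    using assms by (auto simp: subring_set_def)
  show "0 \<in> A" using *(3)[OF *(1) *(2)[OF *(1)]] by simp
  show "x \<in> A \<Longrightarrow> y \<in> A \<Longrightarrow> x - y \<in> A" using *(3)[of x "- y"] *(2) by simp
  show "x \<in> A \<Longrightarrow> x ^ n \<in> A" by (induction n) (simp_all add: *)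
qed

lemma ring_on_simps [simp]:
  "carrier (ring_on A) = A" "monoid.mult (ring_on A) = (*)" "one (ring_on A) = 1"
  "zero (ring_on A) = 0" "add (ring_on A) = (+)"
  by (simp_all add: ring_on_def)

lemma cring_ring_on: "subring_set A \<Longrightarrow> cring (ring_on A)"
  by (intro cringI abelian_groupI comm_monoidI)
    (auto simp: subring_setD algebra_simps intro: bexI[of _ "- x" for x] subring_setD(3))

lemma a_inv_ring_on: "subring_set A \<Longrightarrow> x \<in> A \<Longrightarrow> \<ominus>\<^bsub>ring_on A\<^esub> x = - x"
  using abelian_group.minus_equality[of "ring_on A" "- x" x] cring_ring_on[of A]
  by (simp add: subring_setD cring.axioms(1) ring.axioms(1))

lemma nat_pow_ring_on: "x [^]\<^bsub>ring_on A\<^esub> (n::nat) = x ^ n"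
  by (induction n) (simp_all add: nat_pow_def mult.commute)

lemma ideal_ring_on_iff:
  assumes A: "subring_set A"
  shows "ideal I (ring_on A) \<longleftrightarrow> I \<subseteq> A \<and> 0 \<in> I \<and> (\<forall>x\<in>I. \<forall>y\<in>I. x + y \<in> I) \<and> (\<forall>x\<in>A. \<forall>y\<in>I. x * y \<in> I)"
proof
  assume I: "ideal I (ring_on A)"
  then interpret ideal I "ring_on A" .
  show "I \<subseteq> A \<and> 0 \<in> I \<and> (\<forall>x\<in>I. \<forall>y\<in>I. x + y \<in> I) \<and> (\<forall>x\<in>A. \<forall>y\<in>I. x * y \<in> I)"
    using a_subset additive_subgroup.zero_closed[OF additive_subgroup_axioms]
      additive_subgroup.a_closed[OF additive_subgroup_axioms] I_l_closed by auto
next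
  assume I: "I \<subseteq> A \<and> 0 \<in> I \<and> (\<forall>x\<in>I. \<forall>y\<in>I. x + y \<in> I) \<and> (\<forall>x\<in>A. \<forall>y\<in>I. x * y \<in> I)"
  interpret cring "ring_on A" using A by (rule cring_ring_on)
  show "ideal I (ring_on A)"
  proof (intro idealI subgroup.intro)
    show "ring (ring_on A)" by (rule ring_axioms)
    fix x assume x: "x \<in> I"
    have "(- 1) * x \<in> I" using I x subring_setD(2,3)[OF A] by blast
    moreover have "inv\<^bsub>add_monoid (ring_on A)\<^esub> x = - x"
      using a_inv_ring_on[OF A, of x] I x by (auto simp: a_inv_def)
    ultimately show "inv\<^bsub>add_monoid (ring_on A)\<^esub> x \<in> I" by simp
    fix y assume "y \<in> carrier (ring_on A)"
    then show "y \<otimes>\<^bsub>ring_on A\<^esub> x \<in> I" "x \<otimes>\<^bsub>ring_on A\<^esub> y \<in> I" using I x by (auto simp: mult.commute)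
  qed (use I in auto)
qed

lemma ideal_ring_onD:
  assumes "subring_set A" "ideal I (ring_on A)"
  shows "I \<subseteq> A" "0 \<in> I" "x \<in> I \<Longrightarrow> y \<in> I \<Longrightarrow> x + y \<in> I" "x \<in> A \<Longrightarrow> y \<in> I \<Longrightarrow> x * y \<in> I"
    "x \<in> I \<Longrightarrow> y \<in> I \<Longrightarrow> x - y \<in> I"
proof -
  show *: "I \<subseteq> A" "0 \<in> I" "x \<in> I \<Longrightarrow> y \<in> I \<Longrightarrow> x + y \<in> I" "x \<in> A \<Longrightarrow> y \<in> I \<Longrightarrow> x * y \<in> I" for x y
    using assms by (auto simp: ideal_ring_on_iff)
  show "x - y \<in> I" if "x \<in> I" "y \<in> I"
    using *(3)[OF that(1) *(4)[of "-1" y]] that subring_setD(2,3)[OF assms(1)] by simp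
qed

lemma Idl_ring_on:
  assumes A: "subring_set A" and X: "X \<subseteq> A"
  shows "ideal (Idl\<^bsub>ring_on A\<^esub> X) (ring_on A)" "X \<subseteq> Idl\<^bsub>ring_on A\<^esub> X"
    "ideal I (ring_on A) \<Longrightarrow> X \<subseteq> I \<Longrightarrow> Idl\<^bsub>ring_on A\<^esub> X \<subseteq> I"
proof -
  interpret cring "ring_on A" using A by (rule cring_ring_on)
  show "ideal (Idl\<^bsub>ring_on A\<^esub> X) (ring_on A)" "X \<subseteq> Idl\<^bsub>ring_on A\<^esub> X"
    "ideal I (ring_on A) \<Longrightarrow> X \<subseteq> I \<Longrightarrow> Idl\<^bsub>ring_on A\<^esub> X \<subseteq> I"
    using X genideal_ideal genideal_self genideal_minimal by auto
qed

lemma ideal_insert_ring_on: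
  fixes A :: "'a::comm_ring_1 set"
  assumes A: "subring_set A" and I: "ideal I (ring_on A)" and x: "x \<in> A"
  defines "J \<equiv> {p + x * y | p y. p \<in> I \<and> y \<in> A}"
  shows "ideal J (ring_on A)" "I \<subseteq> J" "x \<in> J"
proof -
  note ID = ideal_ring_onD[OF A I]
  have JI: "p + x * y \<in> J" if "p \<in> I" "y \<in> A" for p y using that by (auto simp: J_def)
  show "I \<subseteq> J" using JI[of _ 0] subring_setD(1)[OF A] by auto
  show "x \<in> J" using JI[of 0 1] ID(2) subring_setD(2)[OF A] by simp
  show "ideal J (ring_on A)"
    unfolding ideal_ring_on_iff[OF A]
  proof (intro conjI ballI)
    show "J \<subseteq> A" using ID(1) x subring_setD(4,5)[OF A] by (auto simp: J_def)
    show "0 \<in> J" using \<open>I \<subseteq> J\<close> ID(2) by blast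
    fix a b assume b: "b \<in> J"
    then obtain p y where py: "b = p + x * y" "p \<in> I" "y \<in> A" by (auto simp: J_def)
    {
      assume "a \<in> J"
      then obtain q z where qz: "a = q + x * z" "q \<in> I" "z \<in> A" by (auto simp: J_def)
      have "(q + p) + x * (z + y) \<in> J"
        using py qz by (intro JI ID(3) subring_setD(4)[OF A])
      then show "a + b \<in> J" by (simp add: py qz algebra_simps)
    next
      assume a: "a \<in> A"
      have "a * p + x * (a * y) \<in> J" using py a by (intro JI ID(4) subring_setD(5)[OF A])
      then show "a * b \<in> J" by (simp add: py algebra_simps)
    }
  qed
qed

lemma PIdl_ring_on: "PIdl\<^bsub>ring_on A\<^esub> x = {y * x | y. y \<in> A}"
  by (simp add: cgenideal_def)

lemma Idl_singleton_ring_on: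
  assumes A: "subring_set A" and x: "x \<in> A"
  shows "Idl\<^bsub>ring_on A\<^esub> {x} = {y * x | y. y \<in> A}"
  using cring.cgenideal_eq_genideal[OF cring_ring_on[OF A], of x] x by (simp add: PIdl_ring_on)

lemma Idl_empty_ring_on:
  assumes A: "subring_set A"
  shows "Idl\<^bsub>ring_on A\<^esub> {} = {0}"
proof -
  have "ideal {0} (ring_on A)" by (simp add: ideal_ring_on_iff[OF A] subring_setD[OF A])
  then show ?thesis using Idl_ring_on[OF A, of "{}"] ideal_ring_onD(2)[OF A] by blast
qed

lemma primeideal_ring_on_iff:
  assumes A: "subring_set A"
  shows "primeideal P (ring_on A) \<longleftrightarrow> ideal P (ring_on A) \<and> 1 \<notin> P \<and>
    (\<forall>x\<in>A. \<forall>y\<in>A. x * y \<in> P \<longrightarrow> x \<in> P \<or> y \<in> P)" (is "?l \<longleftrightarrow> ?r")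
proof
  assume P: ?l
  then interpret primeideal P "ring_on A" .
  have "1 \<notin> P" using I_notcarr one_imp_carrier by auto
  then show ?r using I_prime is_ideal by auto
next
  assume P: ?r
  then have "P \<noteq> A" using subring_setD(2)[OF A] by blast
  then show ?l using P by (intro primeidealI cring_ring_on[OF A]) auto
qed

lemma maximalideal_ring_onD:
  assumes A: "subring_set A" and P: "maximalideal P (ring_on A)"
  shows "ideal P (ring_on A)" "1 \<notin> P" "primeideal P (ring_on A)"
    "x \<in> A \<Longrightarrow> x \<notin> P \<Longrightarrow> \<exists>y\<in>A. 1 - x * y \<in> P"
proof -
  interpret maximalideal P "ring_on A" by (rule P)
  show I: "ideal P (ring_on A)" by (rule is_ideal)
  show "1 \<notin> P" using I_notcarr one_imp_carrier by auto
  show "primeideal P (ring_on A)"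
    by (rule cring.maximalideal_prime[OF cring_ring_on[OF A] P])
  assume x: "x \<in> A" "x \<notin> P"
  define J where "J = {p + x * y | p y. p \<in> P \<and> y \<in> A}"
  have J: "ideal J (ring_on A)" "P \<subseteq> J" "x \<in> J"
    unfolding J_def using ideal_insert_ring_on[OF A I x(1)] by auto
  then have "J \<subseteq> A" using ideal_ring_onD(1)[OF A] by blast
  then have "J = P \<or> J = A" using I_maximal[of J] J by auto
  then have "1 \<in> J" using x J subring_setD(2)[OF A] by auto
  then obtain p y where "p \<in> P" "y \<in> A" "1 = p + x * y" unfolding J_def by blast
  then have "1 - x * y = p" by (simp add: diff_eq_eq)
  then show "\<exists>y\<in>A. 1 - x * y \<in> P" using \<open>p \<in> P\<close> \<open>y \<in> A\<close> by blast
qed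

section \<open>Rings of dimension two\<close>

text \<open>Krull's theorem: an ideal that is maximal among those containing \<open>I\<close> and avoiding the multiplicative set
  \<open>T\<close> is prime.\<close>

lemma ex_primeideal_avoiding:
  fixes A :: "'a::comm_ring_1 set"
  assumes A: "subring_set A" and I: "ideal I (ring_on A)"
    and T: "T \<subseteq> A" "1 \<in> T" "\<And>x y. x \<in> T \<Longrightarrow> y \<in> T \<Longrightarrow> x * y \<in> T" and disj: "I \<inter> T = {}"
  shows "\<exists>Q. primeideal Q (ring_on A) \<and> I \<subseteq> Q \<and> Q \<inter> T = {}"
proof -
  interpret cring "ring_on A" by (rule cring_ring_on[OF A])
  define F where "F = {J. ideal J (ring_on A) \<and> I \<subseteq> J \<and> J \<inter> T = {}}"
  have "\<exists>M\<in>F. \<forall>X\<in>F. M \<subseteq> X \<longrightarrow> X = M"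
  proof (rule subset_Zorn_nonempty)
    show "F \<noteq> {}" using I disj by (auto simp: F_def)
    fix C assume C: "C \<noteq> {}" "subset.chain F C"
    then have "subset.chain {I. ideal I (ring_on A)} C" by (auto simp: F_def subset.chain_def)
    then have "ideal (\<Union>C) (ring_on A)" using chain_Union_is_ideal[of C] C(1) by auto
    moreover have "C \<subseteq> F" using C(2) by (auto simp: subset.chain_def)
    ultimately show "\<Union>C \<in> F" using C(1) by (auto simp: F_def)
  qed
  then obtain Q where Q: "ideal Q (ring_on A)" "I \<subseteq> Q" "Q \<inter> T = {}" and
    max: "\<And>X. ideal X (ring_on A) \<Longrightarrow> Q \<subseteq> X \<Longrightarrow> X \<inter> T = {} \<Longrightarrow> X = Q"
    by (auto simp: F_def)
  note ID = ideal_ring_onD[OF A Q(1)]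
  have meets: "\<exists>q y. q \<in> Q \<and> y \<in> A \<and> q + x * y \<in> T" if x: "x \<in> A" "x \<notin> Q" for x
  proof (rule ccontr)
    assume none: "\<not> ?thesis"
    define J where "J = {p + x * y | p y. p \<in> Q \<and> y \<in> A}"
    have J: "ideal J (ring_on A)" "Q \<subseteq> J" "x \<in> J"
      unfolding J_def using ideal_insert_ring_on[OF A Q(1) x(1)] by auto
    moreover have "J \<inter> T = {}" using none unfolding J_def by blast
    ultimately have "J = Q" using max by blast
    then show False using x J by simp
  qed
  have "primeideal Q (ring_on A)"
    unfolding primeideal_ring_on_iff[OF A]
  proof (intro conjI ballI impI)
    show "ideal Q (ring_on A)" "1 \<notin> Q" using Q T by auto
    fix x y assume xy: "x \<in> A" "y \<in> A" "x * y \<in> Q"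
    show "x \<in> Q \<or> y \<in> Q"
    proof (rule ccontr)
      assume "\<not> ?thesis"
      then obtain q a r b where *: "q \<in> Q" "a \<in> A" "q + x * a \<in> T" "r \<in> Q" "b \<in> A" "r + y * b \<in> T"
        using meets xy by meson
      have "(q + x * a) * (r + y * b) = (r + y * b) * q + (x * a) * r + (a * b) * (x * y)"
        by (simp add: algebra_simps)
      also have "\<dots> \<in> Q"
        using * xy T(1) ID(4) subring_setD(5)[OF A] by (intro ID(3)) blast+
      finally show False using T(3)[OF *(3,6)] Q(3) by blast
    qed
  qed
  then show ?thesis using Q by blast
qed

text \<open>The criterion of Coquand and Lombardi for Krull dimension at most \<open>2\<close>. It speaks about elements only and
  bounds depth as well as height.\<close>

definition krull_dim_le_2 :: "'a::comm_ring_1 set \<Rightarrow> bool" where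
  "krull_dim_le_2 A \<longleftrightarrow> (\<forall>x1\<in>A. \<forall>x2\<in>A. \<forall>x3\<in>A. \<exists>a b c. \<exists>g1\<in>A. \<exists>g2\<in>A. \<exists>g3\<in>A.
     x1 ^ a * (x2 ^ b * (x3 ^ c * (1 + x3 * g3) + x2 * g2) + x1 * g1) = 0)"

lemma power_cancel:
  assumes A: "subring_set A" and x: "x \<in> A" "\<forall>y\<in>A. x * y \<in> I \<longrightarrow> y \<in> I"
    and "y \<in> A" "x ^ n * y \<in> I"
  shows "y \<in> I"
  using assms(5)
proof (induction n)
  case (Suc n)
  have "x * (x ^ n * y) \<in> I" using Suc.prems by (simp add: mult.assoc)
  then have "x ^ n * y \<in> I" using x \<open>y \<in> A\<close> subring_setD(5,7)[OF A] by blast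
  then show ?case by (rule Suc.IH)
qed simp

text \<open>The identity of \<open>krull_dim_le_2\<close> is peeled off from the outside: in each step a power of \<open>x\<^sub>i\<close> is
  cancelled modulo one ideal, and then the summand divisible by \<open>x\<^sub>i\<close> disappears modulo the next one.
  What remains is \<open>1 + x\<^sub>3 g\<^sub>3 \<in> I\<^sub>3\<close>.\<close>

lemma cancellation_chain_collapses:
  assumes A: "subring_set A" and dim: "krull_dim_le_2 A"
    and ideal: "ideal I0 (ring_on A)" "ideal I1 (ring_on A)" "ideal I2 (ring_on A)" "ideal I3 (ring_on A)"
    and ss: "I0 \<subseteq> I1" "I1 \<subseteq> I2" "I2 \<subseteq> I3" and x: "x1 \<in> I1" "x2 \<in> I2" "x3 \<in> I3"
    and r: "\<forall>y\<in>A. x1 * y \<in> I0 \<longrightarrow> y \<in> I0" "\<forall>y\<in>A. x2 * y \<in> I1 \<longrightarrow> y \<in> I1"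
      "\<forall>y\<in>A. x3 * y \<in> I2 \<longrightarrow> y \<in> I2"
  shows "1 \<in> I3"
proof -
  have xA: "x1 \<in> A" "x2 \<in> A" "x3 \<in> A"
    using x ideal ideal_ring_onD(1)[OF A] by blast+
  obtain a b k g1 g2 g3 where g: "g1 \<in> A" "g2 \<in> A" "g3 \<in> A"
    "x1 ^ a * (x2 ^ b * (x3 ^ k * (1 + x3 * g3) + x2 * g2) + x1 * g1) = 0"
    using dim xA unfolding krull_dim_le_2_def by blast
  define z3 where "z3 = 1 + x3 * g3"
  define z2 where "z2 = x3 ^ k * z3 + x2 * g2"
  define z1 where "z1 = x2 ^ b * z2 + x1 * g1"
  have z: "z3 \<in> A" "z2 \<in> A" "z1 \<in> A"
    unfolding z1_def z2_def z3_def by (intro subring_setD[OF A] xA g)+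
  have "x1 ^ a * z1 \<in> I0" using g(4) ideal_ring_onD(2)[OF A ideal(1)] by (simp add: z1_def z2_def z3_def)
  then have "z1 \<in> I0" using power_cancel[OF A _ r(1)] xA z by blast
  then have "z1 - g1 * x1 \<in> I1"
    using ss x g by (intro ideal_ring_onD[OF A ideal(2)]) auto
  then have "x2 ^ b * z2 \<in> I1" by (simp add: z1_def mult.commute)
  then have "z2 \<in> I1" using power_cancel[OF A _ r(2)] xA z by blast
  then have "z2 - g2 * x2 \<in> I2"
    using ss x g by (intro ideal_ring_onD[OF A ideal(3)]) auto
  then have "x3 ^ k * z3 \<in> I2" by (simp add: z2_def mult.commute)
  then have "z3 \<in> I2" using power_cancel[OF A _ r(3)] xA z by blast
  then have "z3 - g3 * x3 \<in> I3"
    using ss x g by (intro ideal_ring_onD[OF A ideal(4)]) auto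
  then show "1 \<in> I3" by (simp add: z3_def mult.commute)
qed

text \<open>In a strict chain of primes, an element of \<open>c (i + 1)\<close> outside \<open>c i\<close> can be cancelled modulo \<open>c i\<close>.\<close>

lemma prime_height_le_2:
  assumes A: "subring_set A" and dim: "krull_dim_le_2 A"
  shows "prime_height (ring_on A) P \<le> 2"
  unfolding prime_height_def
proof (rule Sup_least, clarify)
  fix n and c :: "nat \<Rightarrow> 'a set"
  assume prime: "\<forall>i\<le>n. primeideal (c i) (ring_on A)" and chain: "\<forall>i<n. c i \<subset> c (Suc i)"
  show "enat n \<le> 2"
  proof (rule ccontr)
    assume "\<not> enat n \<le> 2"
    then have n: "2 < n" by (simp add: numeral_eq_enat)
    have ss: "c 0 \<subset> c 1" "c 1 \<subset> c 2" "c 2 \<subset> c 3"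
      using chain n by (auto simp: eval_nat_numeral)
    have pr: "primeideal (c 0) (ring_on A)" "primeideal (c 1) (ring_on A)"
      "primeideal (c 2) (ring_on A)" "primeideal (c 3) (ring_on A)" using prime n by auto
    note iff = primeideal_ring_on_iff[OF A]
    have ideal: "ideal (c 0) (ring_on A)" "ideal (c 1) (ring_on A)" "ideal (c 2) (ring_on A)" "ideal (c 3) (ring_on A)"
      using pr by (simp_all add: iff)
    obtain x1 x2 x3 where x: "x1 \<in> c 1" "x1 \<notin> c 0" "x2 \<in> c 2" "x2 \<notin> c 1" "x3 \<in> c 3" "x3 \<notin> c 2"
      using ss by blast
    have xA: "x1 \<in> A" "x2 \<in> A" "x3 \<in> A"
      using x ideal ideal_ring_onD(1)[OF A] by blast+
    have cancel: "\<forall>y\<in>A. x1 * y \<in> c 0 \<longrightarrow> y \<in> c 0" "\<forall>y\<in>A. x2 * y \<in> c 1 \<longrightarrow> y \<in> c 1"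
      "\<forall>y\<in>A. x3 * y \<in> c 2 \<longrightarrow> y \<in> c 2"
      using pr(1-3) xA x unfolding iff by blast+
    have "1 \<in> c 3"
      using ss x by (intro cancellation_chain_collapses[OF A dim ideal _ _ _ _ _ _ cancel]) auto
    then show False using pr(4) by (simp add: iff)
  qed
qed

text \<open>The members of a regular sequence can be cancelled modulo the ideals generated by the preceding ones.\<close>

lemma ideal_depth_le_2:
  assumes A: "subring_set A" and dim: "krull_dim_le_2 A"
  shows "ideal_depth (ring_on A) P \<le> 2"
  unfolding ideal_depth_def
proof (rule Sup_least, clarify)
  fix xs assume reg: "regular_sequence (ring_on A) xs"
  show "enat (length xs) \<le> 2"
  proof (rule ccontr)
    assume "\<not> enat (length xs) \<le> 2"
    then have n: "2 < length xs" by (simp add: numeral_eq_enat)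
    then have "Suc (Suc (Suc 0)) \<le> length xs" by simp
    then obtain x1 x2 x3 ys where xs: "xs = x1 # x2 # x3 # ys"
      by (auto simp only: Suc_le_length_iff)
    define I0 I1 I2 I3 where "I0 = Idl\<^bsub>ring_on A\<^esub> {}" and "I1 = Idl\<^bsub>ring_on A\<^esub> {x1}"
      and "I2 = Idl\<^bsub>ring_on A\<^esub> {x1, x2}" and "I3 = Idl\<^bsub>ring_on A\<^esub> (set xs)"
    have sub: "{} \<subseteq> A" "{x1} \<subseteq> A" "{x1, x2} \<subseteq> A" "set xs \<subseteq> A"
      using reg by (auto simp: regular_sequence_def xs)
    have ideal: "ideal I0 (ring_on A)" "ideal I1 (ring_on A)" "ideal I2 (ring_on A)" "ideal I3 (ring_on A)"
      unfolding I0_def I1_def I2_def I3_def by (rule Idl_ring_on(1)[OF A], rule sub)+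
    have x: "x1 \<in> I1" "x1 \<in> I2" "x2 \<in> I2" "x1 \<in> I3" "x2 \<in> I3" "x3 \<in> I3"
      using Idl_ring_on(2)[OF A sub(2)] Idl_ring_on(2)[OF A sub(3)] Idl_ring_on(2)[OF A sub(4)]
      by (auto simp: I1_def I2_def I3_def xs)
    have ss: "I0 \<subseteq> I1" "I1 \<subseteq> I2" "I2 \<subseteq> I3"
      using Idl_ring_on(3)[OF A sub(1) ideal(2)] Idl_ring_on(3)[OF A sub(2) ideal(3)]
        Idl_ring_on(3)[OF A sub(3) ideal(4)] x
      by (auto simp: I0_def I1_def I2_def)
    have "\<forall>y\<in>A. (xs ! i) * y \<in> Idl\<^bsub>ring_on A\<^esub> (set (take i xs)) \<longrightarrow> y \<in> Idl\<^bsub>ring_on A\<^esub> (set (take i xs))"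
      if "i < length xs" for i
      using reg that by (auto simp: regular_sequence_def)
    from this[of 0] this[of 1] this[of 2]
    have r: "\<forall>y\<in>A. x1 * y \<in> I0 \<longrightarrow> y \<in> I0" "\<forall>y\<in>A. x2 * y \<in> I1 \<longrightarrow> y \<in> I1"
      "\<forall>y\<in>A. x3 * y \<in> I2 \<longrightarrow> y \<in> I2"
      by (simp_all add: xs I0_def I1_def I2_def)
    have "1 \<in> I3" by (rule cancellation_chain_collapses[OF A dim ideal ss x(1,3,6) r])
    then have "I3 = A" using ideal.one_imp_carrier[OF ideal(4)] by simp
    then show False using reg by (simp add: regular_sequence_def I3_def)
  qed
qed

text \<open>The sequence \<open>f, g\<close> is regular, so the depth is at least \<open>2\<close>. For the height, choose a prime
  containing \<open>f\<close> and avoiding all products \<open>y g\<^sup>n\<close> with \<open>y \<notin> P\<close>; it lies strictly between \<open>0\<close> and \<open>P\<close>. Such a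
  prime exists since \<open>g\<close> can be cancelled modulo \<open>f\<close>.\<close>

lemma depth_and_height_eq_2:
  fixes A :: "'a::idom set"
  assumes A: "subring_set A" and dim: "krull_dim_le_2 A" and P: "primeideal P (ring_on A)"
    and fg: "f \<in> P" "g \<in> P" "f \<noteq> 0"
    and reg: "\<And>y z. y \<in> A \<Longrightarrow> z \<in> A \<Longrightarrow> g * y = z * f \<Longrightarrow> \<exists>w\<in>A. y = w * f"
  shows "ideal_depth (ring_on A) P = 2" "prime_height (ring_on A) P = 2"
proof -
  have I: "ideal P (ring_on A)" and P1: "1 \<notin> P" using P by (simp_all add: primeideal_ring_on_iff[OF A])
  note ID = ideal_ring_onD[OF A I]
  have fgA: "f \<in> A" "g \<in> A" using fg ID(1) by auto
  have "regular_sequence (ring_on A) [f, g]"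
    unfolding regular_sequence_def
  proof (intro conjI allI impI ballI)
    show "set [f, g] \<subseteq> carrier (ring_on A)" using fgA by simp
    have "Idl\<^bsub>ring_on A\<^esub> (set [f, g]) \<subseteq> P" using fg fgA by (intro Idl_ring_on(3)[OF A _ I]) auto
    then show "Idl\<^bsub>ring_on A\<^esub> (set [f, g]) \<noteq> carrier (ring_on A)" using P1 subring_setD(2)[OF A] by auto
    fix i y assume i: "i < length [f, g]" and y: "y \<in> carrier (ring_on A)"
      and prod: "[f, g] ! i \<otimes>\<^bsub>ring_on A\<^esub> y \<in> Idl\<^bsub>ring_on A\<^esub> (set (take i [f, g]))"
    consider "i = 0" | "i = 1" using i by fastforce
    then show "y \<in> Idl\<^bsub>ring_on A\<^esub> (set (take i [f, g]))"
    proof cases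
      case 1
      then show ?thesis using prod fg(3) Idl_empty_ring_on[OF A] by simp
    next
      case 2
      then show ?thesis using prod y reg by (auto simp: Idl_singleton_ring_on[OF A fgA(1)])
    qed
  qed
  then have "enat 2 \<le> ideal_depth (ring_on A) P"
    unfolding ideal_depth_def using fg by (intro Sup_upper CollectI exI[of _ "[f, g]"]) (auto simp: numeral_2_eq_2)
  then show "ideal_depth (ring_on A) P = 2"
    using ideal_depth_le_2[OF A dim, of P] by (simp add: numeral_eq_enat)
  define J where "J = {y * f | y. y \<in> A}"
  have J: "ideal J (ring_on A)" using Idl_ring_on(1)[OF A, of "{f}"] fgA
    by (simp add: Idl_singleton_ring_on[OF A] J_def)
  \<comment> \<open>A prime that avoids \<open>T\<close> lies in \<open>P\<close> (take \<open>n = 0\<close>) and does not contain \<open>g\<close> (take \<open>y = 1\<close>).\<close>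
  define T where "T = {y * g ^ n | y n. y \<in> A \<and> y \<notin> P}"
  have prime: "x \<in> P \<or> y \<in> P" if "x \<in> A" "y \<in> A" "x * y \<in> P" for x y
    using P that by (simp add: primeideal_ring_on_iff[OF A])
  have cancel: "\<exists>w\<in>A. y = w * f" if "y \<in> A" "g ^ n * y \<in> J" for y n
    using that(2)
  proof (induction n)
    case 0
    then show ?case by (auto simp: J_def)
  next
    case (Suc n)
    then obtain z where "z \<in> A" "g * (g ^ n * y) = z * f" by (auto simp: J_def mult.assoc)
    then have "\<exists>w\<in>A. g ^ n * y = w * f"
      using that(1) fgA by (intro reg) (auto intro: subring_setD[OF A])
    then show ?case by (intro Suc.IH) (auto simp: J_def)
  qed
  have "\<exists>Q. primeideal Q (ring_on A) \<and> J \<subseteq> Q \<and> Q \<inter> T = {}"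
  proof (rule ex_primeideal_avoiding[OF A J])
    show "T \<subseteq> A" using fgA by (auto simp: T_def intro!: subring_setD(5,7)[OF A])
    have "1 * g ^ 0 \<in> T" unfolding T_def using P1 subring_setD(2)[OF A] by blast
    then show "1 \<in> T" by simp
    fix x y assume "x \<in> T" "y \<in> T"
    then obtain a b m n where *: "x = a * g ^ m" "y = b * g ^ n" "a \<in> A" "a \<notin> P" "b \<in> A" "b \<notin> P"
      by (auto simp: T_def)
    then have "x * y = (a * b) * g ^ (m + n)" by (simp add: power_add algebra_simps)
    moreover have "a * b \<notin> P" using prime * by blast
    ultimately show "x * y \<in> T" using * subring_setD(5)[OF A] unfolding T_def by blast
  next
    show "J \<inter> T = {}"
    proof (rule ccontr)
      assume "J \<inter> T \<noteq> {}"
      then obtain y n where y: "y \<in> A" "y \<notin> P" "g ^ n * y \<in> J" by (auto simp: T_def mult.commute)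
      then obtain w where "w \<in> A" "y = w * f" using cancel by blast
      then show False using ID(4) fg y by blast
    qed
  qed
  then obtain Q where Q: "primeideal Q (ring_on A)" "J \<subseteq> Q" "Q \<inter> T = {}" by blast
  have QI: "ideal Q (ring_on A)" using Q by (simp add: primeideal_ring_on_iff[OF A])
  have "y * g ^ 0 \<in> T" if "y \<in> A" "y \<notin> P" for y using that unfolding T_def by blast
  then have QP: "Q \<subseteq> P" using Q(3) ideal_ring_onD(1)[OF A QI] by auto
  have "1 * g ^ 1 \<in> T" unfolding T_def using P1 subring_setD(2)[OF A] by blast
  then have "Q \<subset> P" using QP Q(3) fg(2) by auto
  have "1 * f \<in> J" unfolding J_def using subring_setD(2)[OF A] by blast
  then have "f \<in> Q" using Q(2) by auto
  then have "{0} \<subset> Q" using fg(3) ideal_ring_onD(2)[OF A QI] by auto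
  have zero: "primeideal {0} (ring_on A)"
    unfolding primeideal_ring_on_iff[OF A] ideal_ring_on_iff[OF A] by (auto simp: subring_setD[OF A])
  define c where "c = (\<lambda>i::nat. if i = 0 then {0} else if i = 1 then Q else P)"
  have "\<exists>c. (\<forall>i\<le>2. primeideal (c i) (ring_on A)) \<and> (\<forall>i<2. c i \<subset> c (Suc i)) \<and> c 2 = P"
    by (rule exI[of _ c]) (use zero Q P \<open>Q \<subset> P\<close> \<open>{0} \<subset> Q\<close> in \<open>auto simp: c_def less_2_cases_iff\<close>)
  then have "enat 2 \<le> prime_height (ring_on A) P"
    unfolding prime_height_def by (intro Sup_upper) blast
  then show "prime_height (ring_on A) P = 2"
    using prime_height_le_2[OF A dim, of P] by (simp add: numeral_eq_enat)
qed

section \<open>Isomorphisms of quotient modules\<close>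

lemma module_abelian_subgroup:
  assumes "module R M" "submodule N R M"
  shows "abelian_subgroup N M"
proof -
  interpret module R M by fact
  show ?thesis
    using abelian_subgroupI3[of N M] submodule.axioms(1)[OF assms(2)] abelian_group_axioms
    by (simp add: additive_subgroup_def)
qed

lemma quotient_module_simps [simp]:
  "carrier (quotient_module M N) = a_rcosets\<^bsub>M\<^esub> N"
  "zero (quotient_module M N) = N" "add (quotient_module M N) = set_add M"
  by (simp_all add: quotient_module_def)

lemma quotient_module_carrier:
  "X \<in> carrier (quotient_module M N) \<longleftrightarrow> (\<exists>x\<in>carrier M. X = N +>\<^bsub>M\<^esub> x)"
  by (auto simp: A_RCOSETS_def')

lemma
  assumes M: "module R M" and N: "submodule N R M" and x: "x \<in> carrier M"
  shows coset_eq_iff: "y \<in> carrier M \<Longrightarrow> N +>\<^bsub>M\<^esub> x = N +>\<^bsub>M\<^esub> y \<longleftrightarrow> x \<ominus>\<^bsub>M\<^esub> y \<in> N"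
    and coset_eq_zero_iff: "N +>\<^bsub>M\<^esub> x = N \<longleftrightarrow> x \<in> N"
    and quotient_module_add: "y \<in> carrier M \<Longrightarrow>
      (N +>\<^bsub>M\<^esub> x) \<oplus>\<^bsub>quotient_module M N\<^esub> (N +>\<^bsub>M\<^esub> y) = N +>\<^bsub>M\<^esub> (x \<oplus>\<^bsub>M\<^esub> y)"
    and quotient_module_smult: "c \<in> carrier R \<Longrightarrow>
      c \<odot>\<^bsub>quotient_module M N\<^esub> (N +>\<^bsub>M\<^esub> x) = N +>\<^bsub>M\<^esub> (c \<odot>\<^bsub>M\<^esub> x)"
proof -
  interpret module R M by fact
  interpret abelian_subgroup N M by (rule module_abelian_subgroup[OF M N])
  show eq: "N +>\<^bsub>M\<^esub> x = N +>\<^bsub>M\<^esub> y \<longleftrightarrow> x \<ominus>\<^bsub>M\<^esub> y \<in> N" if "y \<in> carrier M" for y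
  proof -
    have "x \<in> N +>\<^bsub>M\<^esub> y \<longleftrightarrow> x \<ominus>\<^bsub>M\<^esub> y \<in> N"
      unfolding a_minus_def using a_rcos_module[OF that x] .
    moreover have "x \<in> N +>\<^bsub>M\<^esub> y \<longleftrightarrow> N +>\<^bsub>M\<^esub> x = N +>\<^bsub>M\<^esub> y"
      using a_repr_independence'[where x = y and y = x] that a_rcos_self[OF x] by blast
    ultimately show ?thesis by blast
  qed
  show "N +>\<^bsub>M\<^esub> x = N \<longleftrightarrow> x \<in> N"
    using a_rcos_const[of x] a_rcos_self[OF x] by blast
  show "y \<in> carrier M \<Longrightarrow>
      (N +>\<^bsub>M\<^esub> x) \<oplus>\<^bsub>quotient_module M N\<^esub> (N +>\<^bsub>M\<^esub> y) = N +>\<^bsub>M\<^esub> (x \<oplus>\<^bsub>M\<^esub> y)"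
    using a_rcos_sum[OF x] by simp
  assume c: "c \<in> carrier R"
  have "N +>\<^bsub>M\<^esub> (c \<odot>\<^bsub>M\<^esub> x') = N +>\<^bsub>M\<^esub> (c \<odot>\<^bsub>M\<^esub> x)" if x': "x' \<in> N +>\<^bsub>M\<^esub> x" for x'
  proof -
    obtain n where n: "n \<in> N" "x' = n \<oplus>\<^bsub>M\<^esub> x" using x' by (auto simp: a_r_coset_def')
    have nM: "n \<in> carrier M" using n a_subset by blast
    have "c \<odot>\<^bsub>M\<^esub> n \<in> N" using submodule.smult_closed[OF N c n(1)] .
    then have "(c \<odot>\<^bsub>M\<^esub> n) \<oplus>\<^bsub>M\<^esub> (c \<odot>\<^bsub>M\<^esub> x) \<in> N +>\<^bsub>M\<^esub> (c \<odot>\<^bsub>M\<^esub> x)"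
      by (auto simp: a_r_coset_def')
    then have "c \<odot>\<^bsub>M\<^esub> x' \<in> N +>\<^bsub>M\<^esub> (c \<odot>\<^bsub>M\<^esub> x)"
      using n nM c x by (simp add: smult_r_distr)
    then show ?thesis using a_repr_independence'[where x = "c \<odot>\<^bsub>M\<^esub> x"] c x by simp
  qed
  then have "(\<lambda>x'. N +>\<^bsub>M\<^esub> (c \<odot>\<^bsub>M\<^esub> x')) ` (N +>\<^bsub>M\<^esub> x) = {N +>\<^bsub>M\<^esub> (c \<odot>\<^bsub>M\<^esub> x)}"
    using a_rcos_self[OF x] by blast
  then show "c \<odot>\<^bsub>quotient_module M N\<^esub> (N +>\<^bsub>M\<^esub> x) = N +>\<^bsub>M\<^esub> (c \<odot>\<^bsub>M\<^esub> x)"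
    by (simp add: quotient_module_def)
qed

text \<open>An additive relation that is total on both sides and matches \<open>N\<close> with \<open>N'\<close> induces an isomorphism of the
  quotients. For local cohomology a relation is the natural object, since neither a cocycle determines an element
  of the ring nor conversely; only their classes determine each other.\<close>

lemma module_iso_of_correspondence:
  fixes \<rho> :: "'m \<Rightarrow> 'n \<Rightarrow> bool" and M :: "('a, 'm, 'c) module_scheme" and M' :: "('a, 'n, 'e) module_scheme"
  assumes M: "module R M" "submodule N R M" and M': "module R M'" "submodule N' R M'"
    and \<rho>: "\<And>x y. \<rho> x y \<Longrightarrow> x \<in> carrier M" "\<And>x y. \<rho> x y \<Longrightarrow> y \<in> carrier M'"
    and add: "\<And>x y x' y'. \<rho> x y \<Longrightarrow> \<rho> x' y' \<Longrightarrow> \<rho> (x \<oplus>\<^bsub>M\<^esub> x') (y \<oplus>\<^bsub>M'\<^esub> y')"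
    and smult: "\<And>c x y. c \<in> carrier R \<Longrightarrow> \<rho> x y \<Longrightarrow> \<rho> (c \<odot>\<^bsub>M\<^esub> x) (c \<odot>\<^bsub>M'\<^esub> y)"
    and total: "\<And>x. x \<in> carrier M \<Longrightarrow> \<exists>y. \<rho> x y" "\<And>y. y \<in> carrier M' \<Longrightarrow> \<exists>x. \<rho> x y"
    and compat: "\<And>x y. \<rho> x y \<Longrightarrow> x \<in> N \<longleftrightarrow> y \<in> N'"
  shows "module_iso R (quotient_module M N) (quotient_module M' N')"
proof -
  interpret M: module R M by fact
  interpret M': module R M' by fact
  have diff: "\<rho> (x \<ominus>\<^bsub>M\<^esub> x') (y \<ominus>\<^bsub>M'\<^esub> y')" if "\<rho> x y" "\<rho> x' y'" for x y x' y'
  proof -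
    have "\<rho> ((\<ominus>\<^bsub>R\<^esub> \<one>\<^bsub>R\<^esub>) \<odot>\<^bsub>M\<^esub> x') ((\<ominus>\<^bsub>R\<^esub> \<one>\<^bsub>R\<^esub>) \<odot>\<^bsub>M'\<^esub> y')"
      using that by (intro smult) auto
    then have "\<rho> (\<ominus>\<^bsub>M\<^esub> x') (\<ominus>\<^bsub>M'\<^esub> y')"
      using \<rho>[OF that(2)] by (simp add: M.smult_l_minus M'.smult_l_minus)
    then show ?thesis using add[OF that(1)] by (simp add: a_minus_def)
  qed
  have same: "N +>\<^bsub>M\<^esub> x = N +>\<^bsub>M\<^esub> x' \<longleftrightarrow> N' +>\<^bsub>M'\<^esub> y = N' +>\<^bsub>M'\<^esub> y'" if "\<rho> x y" "\<rho> x' y'" for x y x' y'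
    using compat[OF diff[OF that]] \<rho>[OF that(1)] \<rho>[OF that(2)]
    by (simp add: coset_eq_iff[OF M] coset_eq_iff[OF M'])
  define f where "f X = (THE Y. \<exists>x y. \<rho> x y \<and> X = N +>\<^bsub>M\<^esub> x \<and> Y = N' +>\<^bsub>M'\<^esub> y)" for X
  have f: "f (N +>\<^bsub>M\<^esub> x) = N' +>\<^bsub>M'\<^esub> y" if "\<rho> x y" for x y
    unfolding f_def using that same by (intro the_equality) metis+
  have rep: "\<exists>x y. \<rho> x y \<and> X = N +>\<^bsub>M\<^esub> x" if "X \<in> carrier (quotient_module M N)" for X
    using that total(1) unfolding quotient_module_carrier by blast
  have rep': "\<exists>x y. \<rho> x y \<and> Y = N' +>\<^bsub>M'\<^esub> y" if "Y \<in> carrier (quotient_module M' N')" for Y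
    using that total(2) unfolding quotient_module_carrier by blast
  have hom: "f \<in> module_hom R (quotient_module M N) (quotient_module M' N')"
    unfolding module_hom_def
  proof (intro CollectI conjI ballI Pi_I)
    fix X assume "X \<in> carrier (quotient_module M N)"
    then obtain x y where xy: "\<rho> x y" "X = N +>\<^bsub>M\<^esub> x" using rep by blast
    show "f X \<in> carrier (quotient_module M' N')"
      unfolding quotient_module_carrier using f[OF xy(1)] xy(2) \<rho>(2)[OF xy(1)] by blast
    {
      fix X' assume "X' \<in> carrier (quotient_module M N)"
      then obtain x' y' where xy': "\<rho> x' y'" "X' = N +>\<^bsub>M\<^esub> x'" using rep by blast
      show "f (X \<oplus>\<^bsub>quotient_module M N\<^esub> X') = f X \<oplus>\<^bsub>quotient_module M' N'\<^esub> f X'"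
        unfolding xy(2) xy'(2) f[OF xy(1)] f[OF xy'(1)]
          quotient_module_add[OF M \<rho>(1)[OF xy(1)] \<rho>(1)[OF xy'(1)]]
          quotient_module_add[OF M' \<rho>(2)[OF xy(1)] \<rho>(2)[OF xy'(1)]]
        by (rule f[OF add[OF xy(1) xy'(1)]])
    }
    fix c assume c: "c \<in> carrier R"
    show "f (c \<odot>\<^bsub>quotient_module M N\<^esub> X) = c \<odot>\<^bsub>quotient_module M' N'\<^esub> f X"
      unfolding xy(2) f[OF xy(1)] quotient_module_smult[OF M \<rho>(1)[OF xy(1)] c]
        quotient_module_smult[OF M' \<rho>(2)[OF xy(1)] c]
      by (rule f[OF smult[OF c xy(1)]])
  qed
  have inj: "inj_on f (carrier (quotient_module M N))"
    by (rule inj_onI) (metis rep f same)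
  have "f ` carrier (quotient_module M N) = carrier (quotient_module M' N')"
  proof (intro equalityI subsetI)
    fix Y assume "Y \<in> carrier (quotient_module M' N')"
    then obtain x y where xy: "\<rho> x y" "Y = N' +>\<^bsub>M'\<^esub> y" using rep' by blast
    have "N +>\<^bsub>M\<^esub> x \<in> carrier (quotient_module M N)"
      unfolding quotient_module_carrier using \<rho>(1)[OF xy(1)] by blast
    then show "Y \<in> f ` carrier (quotient_module M N)" using f[OF xy(1)] xy(2) by blast
  qed (use hom in \<open>auto simp: module_hom_def\<close>)
  then show ?thesis unfolding module_iso_def bij_betw_def using hom inj by blast
qed

section \<open>First local cohomology of a domain\<close>

lemma module_homD:
  assumes "f \<in> module_hom R M N"
  shows "x \<in> carrier M \<Longrightarrow> f x \<in> carrier N"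
    "x \<in> carrier M \<Longrightarrow> y \<in> carrier M \<Longrightarrow> f (x \<oplus>\<^bsub>M\<^esub> y) = f x \<oplus>\<^bsub>N\<^esub> f y"
    "c \<in> carrier R \<Longrightarrow> x \<in> carrier M \<Longrightarrow> f (c \<odot>\<^bsub>M\<^esub> x) = c \<odot>\<^bsub>N\<^esub> f x"
  using assms by (auto simp: module_hom_def)

lemma module_hom_zero:
  assumes "module R M" "module R N" "f \<in> module_hom R M N"
  shows "f \<zero>\<^bsub>M\<^esub> = \<zero>\<^bsub>N\<^esub>"
proof -
  interpret M: module R M by fact
  interpret N: module R N by fact
  have "f (\<zero>\<^bsub>R\<^esub> \<odot>\<^bsub>M\<^esub> \<zero>\<^bsub>M\<^esub>) = \<zero>\<^bsub>R\<^esub> \<odot>\<^bsub>N\<^esub> f \<zero>\<^bsub>M\<^esub>" by (intro module_homD[OF assms(3)]) auto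
  then show ?thesis using module_homD(1)[OF assms(3), of "\<zero>\<^bsub>M\<^esub>"] by simp
qed

lemma ring_module_simps [simp]:
  "carrier (ring_module S) = carrier S" "zero (ring_module S) = zero S" "add (ring_module S) = add S"
  "smult (ring_module S) = monoid.mult S"
  by (simp_all add: ring_module_def)

lemma smult_minus_one:
  assumes A: "subring_set A" and M: "module (ring_on A) M" and x: "x \<in> carrier M"
  shows "(- 1) \<odot>\<^bsub>M\<^esub> x = \<ominus>\<^bsub>M\<^esub> x"
proof -
  interpret module "ring_on A" M by (rule M)
  show ?thesis
    using smult_l_minus[of 1 x] smult_one[OF x] x a_inv_ring_on[OF A, of 1] subring_setD(2)[OF A] by simp
qed

lemma submodule_ring_onI:
  assumes A: "subring_set A" and M: "module (ring_on A) M" and L: "L \<subseteq> carrier M" "\<zero>\<^bsub>M\<^esub> \<in> L"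
    "\<And>x y. x \<in> L \<Longrightarrow> y \<in> L \<Longrightarrow> x \<oplus>\<^bsub>M\<^esub> y \<in> L" "\<And>c x. c \<in> A \<Longrightarrow> x \<in> L \<Longrightarrow> c \<odot>\<^bsub>M\<^esub> x \<in> L"
  shows "submodule L (ring_on A) M"
proof (rule module.submoduleI[OF M])
  fix x assume "x \<in> L"
  then show "\<ominus>\<^bsub>M\<^esub> x \<in> L"
    using L(4)[of "- 1" x] smult_minus_one[OF A M, of x] subring_setD(2,3)[OF A] L(1) by auto
qed (use L in auto)

lemma ring_module_is_module:
  assumes A: "subring_set A" and S: "subring_set S" "A \<subseteq> S"
  shows "module (ring_on A) (ring_module (ring_on S))"
proof (rule moduleI)
  show "cring (ring_on A)" by (rule cring_ring_on[OF A])
  show "abelian_group (ring_module (ring_on S))"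
    by (rule abelian_groupI) (auto intro: subring_setD[OF S(1)] bexI[of _ "- x" for x])
qed (use S in \<open>auto simp: algebra_simps intro: subring_setD[OF S(1)]\<close>)

lemma ring_module_submoduleI:
  assumes A: "subring_set A" and S: "subring_set S" "A \<subseteq> S" and L: "L \<subseteq> S" "0 \<in> L"
    "\<And>x y. x \<in> L \<Longrightarrow> y \<in> L \<Longrightarrow> x + y \<in> L" "\<And>x y. x \<in> A \<Longrightarrow> y \<in> L \<Longrightarrow> x * y \<in> L"
  shows "submodule L (ring_on A) (ring_module (ring_on S))"
  by (rule submodule_ring_onI[OF A ring_module_is_module[OF A S]]) (use L in auto)

definition ideal_pow :: "'a::comm_ring_1 set \<Rightarrow> 'a set \<Rightarrow> nat \<Rightarrow> 'a set" where
  "ideal_pow A I n = I [^]\<^bsub>ideals_set (ring_on A)\<^esub> n"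

lemma torsion_part_eq: "torsion_part (ring_on A) I M =
    {x \<in> carrier M. \<exists>n. \<forall>c\<in>ideal_pow A I n. c \<odot>\<^bsub>M\<^esub> x = \<zero>\<^bsub>M\<^esub>}"
  by (simp add: torsion_part_def ideal_pow_def)

lemma ideal_pow_0: "ideal_pow A I 0 = A"
  by (simp add: ideal_pow_def nat_pow_def ideals_set_def)

lemma ideal_pow_Suc: "ideal_pow A I (Suc n) = ideal_prod (ring_on A) (ideal_pow A I n) I"
  by (simp add: ideal_pow_def nat_pow_def ideals_set_def)

context
  fixes A :: "'a::comm_ring_1 set" and I :: "'a set"
  assumes A: "subring_set A" and I: "ideal I (ring_on A)"
begin

lemma ideal_pow_ideal: "ideal (ideal_pow A I n) (ring_on A)"
proof (induction n)
  case 0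
  then show ?case using ring.oneideal[of "ring_on A"] cring_ring_on[OF A]
    by (simp add: ideal_pow_0 cring_def)
next
  case (Suc n)
  then show ?case using ring.ideal_prod_is_ideal[of "ring_on A"] cring_ring_on[OF A] I
    by (simp add: ideal_pow_Suc cring_def)
qed

lemma ideal_pow_mono: "m \<le> n \<Longrightarrow> ideal_pow A I n \<subseteq> ideal_pow A I m"
proof (rule lift_Suc_antimono_le[of "ideal_pow A I"])
  fix n
  show "ideal_pow A I (Suc n) \<subseteq> ideal_pow A I n"
    using ring.ideal_prod_inter[of "ring_on A", OF _ ideal_pow_ideal I] cring_ring_on[OF A]
    by (auto simp: ideal_pow_Suc cring_def)
qed

lemma power_in_ideal_pow: "u \<in> I \<Longrightarrow> u ^ n \<in> ideal_pow A I n"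
proof (induction n)
  case 0
  then show ?case by (simp add: ideal_pow_0 subring_setD[OF A])
next
  case (Suc n)
  then have "u ^ n \<otimes>\<^bsub>ring_on A\<^esub> u \<in> ideal_pow A I (Suc n)"
    unfolding ideal_pow_Suc by (intro ideal_prod.prod)
  then show ?case by (simp add: mult.commute)
qed

end

text \<open>For a Noetherian domain \<open>A\<close> in a field and a nonzero \<open>I\<close>, these are the sections of the structure sheaf over the
  complement of the closed set defined by \<open>I\<close>.\<close>

definition ideal_transform :: "'a::comm_ring_1 set \<Rightarrow> 'a set \<Rightarrow> 'a set" where
  "ideal_transform A I = {q. \<exists>n. \<forall>m\<in>ideal_pow A I n. m * q \<in> A}"

text \<open>The nonzero element \<open>u\<close> guarantees that all powers of \<open>I\<close> are nonzero, so that multiplication by them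
  determines an element of the field.\<close>

locale ring_resolution =
  fixes A I :: "'a::field set" and \<epsilon> :: "'a \<Rightarrow> 'e" and E :: "nat \<Rightarrow> ('a, 'e) module" and \<delta> :: "nat \<Rightarrow> 'e \<Rightarrow> 'e" and u
  assumes A: "subring_set A" and I: "ideal I (ring_on A)" and u: "u \<in> I" "u \<noteq> 0"
    and S: "subring_set (ideal_transform A I)"
    and res: "injective_resolution (ring_on A) (ring_module (ring_on A)) \<epsilon> E \<delta>"
begin

abbreviation "R \<equiv> ring_on A"
abbreviation "S \<equiv> ideal_transform A I"
abbreviation "J \<equiv> ideal_pow A I"

lemma E_module: "module R (E n)"
  using res by (auto simp: injective_resolution_def injective_module_def)

lemma \<delta>_hom: "\<delta> n \<in> module_hom R (E n) (E (Suc n))"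
  using res by (auto simp: injective_resolution_def)

lemma \<epsilon>_hom: "\<epsilon> \<in> module_hom R (ring_module R) (E 0)"
  using res by (auto simp: injective_resolution_def)

lemma \<epsilon>_add: "a \<in> A \<Longrightarrow> b \<in> A \<Longrightarrow> \<epsilon> (a + b) = \<epsilon> a \<oplus>\<^bsub>E 0\<^esub> \<epsilon> b"
  and \<epsilon>_mult: "a \<in> A \<Longrightarrow> b \<in> A \<Longrightarrow> \<epsilon> (a * b) = a \<odot>\<^bsub>E 0\<^esub> \<epsilon> b"
  and \<epsilon>_closed: "a \<in> A \<Longrightarrow> \<epsilon> a \<in> carrier (E 0)"
  using module_homD[OF \<epsilon>_hom] by auto

lemma \<epsilon>_inj: "a \<in> A \<Longrightarrow> b \<in> A \<Longrightarrow> \<epsilon> a = \<epsilon> b \<Longrightarrow> a = b"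
  using res by (auto simp: injective_resolution_def inj_on_def)

lemma \<epsilon>_zero: "\<epsilon> 0 = \<zero>\<^bsub>E 0\<^esub>"
  using module_hom_zero[OF ring_module_is_module[OF A A] E_module \<epsilon>_hom] by simp

lemma \<delta>_zero: "\<delta> n \<zero>\<^bsub>E n\<^esub> = \<zero>\<^bsub>E (Suc n)\<^esub>"
  by (rule module_hom_zero[OF E_module E_module \<delta>_hom])

lemma exact_0: "x \<in> carrier (E 0) \<Longrightarrow> \<delta> 0 x = \<zero>\<^bsub>E 1\<^esub> \<longleftrightarrow> x \<in> \<epsilon> ` A"
  using res by (auto simp: injective_resolution_def)

lemma exact_1: "x \<in> carrier (E 1) \<Longrightarrow> \<delta> 1 x = \<zero>\<^bsub>E 2\<^esub> \<longleftrightarrow> x \<in> \<delta> 0 ` carrier (E 0)"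
proof -
  have "\<delta> 0 ` carrier (E 0) = {x \<in> carrier (E (Suc 0)). \<delta> (Suc 0) x = \<zero>\<^bsub>E (Suc (Suc 0))\<^esub>}"
    using res unfolding injective_resolution_def by blast
  then show "x \<in> carrier (E 1) \<Longrightarrow> ?thesis" by (simp add: numeral_2_eq_2)
qed

lemmas JD = ideal_ring_onD[OF A ideal_pow_ideal[OF A I]]

lemma J_common: "m \<in> J (max k l) \<Longrightarrow> m \<in> J k \<and> m \<in> J l"
  using ideal_pow_mono[OF A I, of k "max k l"] ideal_pow_mono[OF A I, of l "max k l"] by auto

text \<open>Multiplication by a power of \<open>I\<close> takes \<open>e\<close> into the copy \<open>\<epsilon> A\<close> of \<open>A\<close>, in the same way as it takes \<open>q\<close>
  into \<open>A\<close>.\<close>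

definition represents :: "'e \<Rightarrow> 'a \<Rightarrow> bool" where
  "represents e q \<longleftrightarrow> e \<in> carrier (E 0) \<and> (\<exists>n. \<forall>m\<in>J n. m * q \<in> A \<and> m \<odot>\<^bsub>E 0\<^esub> e = \<epsilon> (m * q))"

lemma represents_in_S: "represents e q \<Longrightarrow> q \<in> S"
  by (auto simp: represents_def ideal_transform_def)

lemma represents_add:
  assumes "represents e q" "represents e' q'"
  shows "represents (e \<oplus>\<^bsub>E 0\<^esub> e') (q + q')"
proof -
  interpret E0: module R "E 0" by (rule E_module)
  obtain k l where k: "\<And>m. m \<in> J k \<Longrightarrow> m * q \<in> A \<and> m \<odot>\<^bsub>E 0\<^esub> e = \<epsilon> (m * q)"
    and l: "\<And>m. m \<in> J l \<Longrightarrow> m * q' \<in> A \<and> m \<odot>\<^bsub>E 0\<^esub> e' = \<epsilon> (m * q')"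
    using assms unfolding represents_def by blast
  have e: "e \<in> carrier (E 0)" "e' \<in> carrier (E 0)" using assms by (auto simp: represents_def)
  have "m * (q + q') \<in> A \<and> m \<odot>\<^bsub>E 0\<^esub> (e \<oplus>\<^bsub>E 0\<^esub> e') = \<epsilon> (m * (q + q'))" if m: "m \<in> J (max k l)" for m
  proof -
    have "m \<in> A" using m JD(1) by blast
    then show ?thesis using J_common[OF m] k[of m] l[of m] e
      by (auto simp: distrib_left E0.smult_r_distr \<epsilon>_add intro: subring_setD[OF A])
  qed
  then show ?thesis using e unfolding represents_def by blast
qed

lemma represents_mult:
  assumes c: "c \<in> A" and "represents e q"
  shows "represents (c \<odot>\<^bsub>E 0\<^esub> e) (c * q)"
proof -
  interpret E0: module R "E 0" by (rule E_module)
  obtain n where n: "\<And>m. m \<in> J n \<Longrightarrow> m * q \<in> A \<and> m \<odot>\<^bsub>E 0\<^esub> e = \<epsilon> (m * q)"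
    using assms unfolding represents_def by blast
  have e: "e \<in> carrier (E 0)" using assms by (auto simp: represents_def)
  have "m * (c * q) \<in> A \<and> m \<odot>\<^bsub>E 0\<^esub> (c \<odot>\<^bsub>E 0\<^esub> e) = \<epsilon> (m * (c * q))" if m: "m \<in> J n" for m
  proof -
    have mA: "m \<in> A" using m JD(1) by blast
    have "c * m \<in> J n" using JD(4) m c by blast
    then have "(c * m) * q \<in> A \<and> (c * m) \<odot>\<^bsub>E 0\<^esub> e = \<epsilon> ((c * m) * q)" by (rule n)
    moreover have "m \<odot>\<^bsub>E 0\<^esub> (c \<odot>\<^bsub>E 0\<^esub> e) = (m * c) \<odot>\<^bsub>E 0\<^esub> e"
      using E0.smult_assoc1[of m c e] mA c e by simp
    ultimately show ?thesis by (simp add: mult_ac)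
  qed
  then show ?thesis using e c unfolding represents_def by auto
qed

lemma represents_\<epsilon>: "q \<in> A \<Longrightarrow> represents (\<epsilon> q) q"
  unfolding represents_def
  by (intro conjI \<epsilon>_closed exI[of _ 0]) (auto simp: ideal_pow_0 \<epsilon>_mult intro: subring_setD[OF A])

lemma represents_zero_iff: "represents e 0 \<longleftrightarrow> e \<in> torsion_part R I (E 0)"
  by (simp add: represents_def torsion_part_eq \<epsilon>_zero subring_setD[OF A])

lemma represents_unique:
  assumes "represents e q" "represents e q'"
  shows "q = q'"
proof -
  obtain k l where k: "\<And>m. m \<in> J k \<Longrightarrow> m * q \<in> A \<and> m \<odot>\<^bsub>E 0\<^esub> e = \<epsilon> (m * q)"
    and l: "\<And>m. m \<in> J l \<Longrightarrow> m * q' \<in> A \<and> m \<odot>\<^bsub>E 0\<^esub> e = \<epsilon> (m * q')"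
    using assms unfolding represents_def by blast
  define m where "m = u ^ max k l"
  have "m \<in> J (max k l)" unfolding m_def by (rule power_in_ideal_pow[OF A I u(1)])
  then have "m * q \<in> A" "m * q' \<in> A" "\<epsilon> (m * q) = \<epsilon> (m * q')"
    using J_common[of m k l] k[of m] l[of m] by auto
  then have "m * q = m * q'" by (rule \<epsilon>_inj)
  then show ?thesis using u(2) by (simp add: m_def)
qed

text \<open>Here injectivity enters: the map \<open>m \<mapsto> \<epsilon> (m q)\<close> on \<open>I\<^sup>n\<close> extends to \<open>A\<close>, and \<open>e\<close> is the image of \<open>1\<close>.\<close>

lemma ex_represents:
  assumes q: "q \<in> S"
  shows "\<exists>e. represents e q"
proof -
  obtain n where n: "\<And>m. m \<in> J n \<Longrightarrow> m * q \<in> A" using q by (auto simp: ideal_transform_def)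
  interpret E0: module R "E 0" by (rule E_module)
  have "injective_module R (E 0)" using res by (simp add: injective_resolution_def)
  moreover have "submodule (J n) R (ring_module R)"
    using JD(1-4) by (intro ring_module_submoduleI[OF A A]) auto
  moreover have "(\<lambda>m. \<epsilon> (m * q)) \<in> module_hom R ((ring_module R)\<lparr>carrier := J n\<rparr>) (E 0)"
    unfolding module_hom_def using n by (auto simp: distrib_right mult.assoc \<epsilon>_add \<epsilon>_mult \<epsilon>_closed)
  ultimately obtain g where g: "g \<in> module_hom R (ring_module R) (E 0)" "\<forall>m\<in>J n. g m = \<epsilon> (m * q)"
    unfolding injective_module_def using ring_module_is_module[OF A A order_refl] by blast
  have 1: "1 \<in> A" by (rule subring_setD[OF A])
  have "m \<odot>\<^bsub>E 0\<^esub> g 1 = \<epsilon> (m * q)" if m: "m \<in> J n" for m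
  proof -
    have "m \<in> A" using m JD(1) by blast
    then show ?thesis using module_homD(3)[OF g(1), of m 1] 1 g(2) m by simp
  qed
  then have "represents (g 1) q"
    unfolding represents_def using module_homD(1)[OF g(1), of 1] n 1 by auto
  then show ?thesis by blast
qed

text \<open>If \<open>I\<^sup>n\<close> kills \<open>\<delta> e\<close>, then by exactness \<open>m e = \<epsilon> (\<phi> m)\<close> for \<open>m \<in> I\<^sup>n\<close>. The map \<open>\<phi>\<close> is linear, hence
  multiplication by the fraction \<open>\<phi> w / w\<close> for any nonzero \<open>w \<in> I\<^sup>n\<close>.\<close>

lemma represents_of_torsion:
  assumes e: "e \<in> carrier (E 0)" and tors: "\<delta> 0 e \<in> torsion_part R I (E 1)"
  shows "\<exists>q. represents e q"
proof -
  interpret E0: module R "E 0" by (rule E_module)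
  obtain n where n: "\<And>m. m \<in> J n \<Longrightarrow> m \<odot>\<^bsub>E 1\<^esub> \<delta> 0 e = \<zero>\<^bsub>E 1\<^esub>"
    using tors by (auto simp: torsion_part_eq)
  have "\<exists>a\<in>A. m \<odot>\<^bsub>E 0\<^esub> e = \<epsilon> a" if m: "m \<in> J n" for m
  proof -
    have mA: "m \<in> carrier R" using m JD(1) by auto
    have "\<delta> 0 (m \<odot>\<^bsub>E 0\<^esub> e) = \<zero>\<^bsub>E 1\<^esub>" using module_homD(3)[OF \<delta>_hom mA e] n[OF m] by simp
    then show ?thesis using exact_0[of "m \<odot>\<^bsub>E 0\<^esub> e"] mA e by auto
  qed
  then obtain \<phi> where \<phi>: "\<And>m. m \<in> J n \<Longrightarrow> \<phi> m \<in> A" "\<And>m. m \<in> J n \<Longrightarrow> m \<odot>\<^bsub>E 0\<^esub> e = \<epsilon> (\<phi> m)" by metis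
  define w where "w = u ^ n"
  have w: "w \<in> J n" "w \<noteq> 0" using power_in_ideal_pow[OF A I u(1)] u(2) by (simp_all add: w_def)
  have wA: "w \<in> A" using w JD(1) by blast
  define q where "q = \<phi> w / w"
  have "m * q = \<phi> m" if m: "m \<in> J n" for m
  proof -
    have mA: "m \<in> A" using m JD(1) by blast
    have "\<epsilon> (m * \<phi> w) = m \<odot>\<^bsub>E 0\<^esub> (w \<odot>\<^bsub>E 0\<^esub> e)" using \<phi> w mA by (simp add: \<epsilon>_mult)
    also have "\<dots> = w \<odot>\<^bsub>E 0\<^esub> (m \<odot>\<^bsub>E 0\<^esub> e)"
      using E0.smult_assoc1[of m w e] E0.smult_assoc1[of w m e] mA wA e by (simp add: mult.commute)
    also have "\<dots> = \<epsilon> (w * \<phi> m)" using \<phi> m wA by (simp add: \<epsilon>_mult)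
    finally have "m * \<phi> w = w * \<phi> m"
      using \<phi> m w mA wA by (intro \<epsilon>_inj) (auto intro: subring_setD[OF A])
    then show ?thesis using w(2) by (simp add: q_def field_simps)
  qed
  then have "represents e q" unfolding represents_def using e \<phi> by (intro conjI exI[of _ n]) auto
  then show ?thesis by blast
qed

lemma torsion_of_represents:
  assumes "represents e q"
  shows "\<delta> 0 e \<in> torsion_part R I (E 1)" "\<delta> 1 (\<delta> 0 e) = \<zero>\<^bsub>E 2\<^esub>"
proof -
  obtain n where e: "e \<in> carrier (E 0)"
    and n: "\<And>m. m \<in> J n \<Longrightarrow> m * q \<in> A \<and> m \<odot>\<^bsub>E 0\<^esub> e = \<epsilon> (m * q)"
    using assms unfolding represents_def by blast
  interpret E0: module R "E 0" by (rule E_module)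
  have de: "\<delta> 0 e \<in> carrier (E 1)" using module_homD(1)[OF \<delta>_hom e] by simp
  have "m \<odot>\<^bsub>E 1\<^esub> \<delta> 0 e = \<zero>\<^bsub>E 1\<^esub>" if m: "m \<in> J n" for m
  proof -
    have mA: "m \<in> carrier R" using m JD(1) by auto
    have "m \<odot>\<^bsub>E 1\<^esub> \<delta> 0 e = \<delta> 0 (m \<odot>\<^bsub>E 0\<^esub> e)" using module_homD(3)[OF \<delta>_hom mA e] by simp
    also have "\<dots> = \<zero>\<^bsub>E 1\<^esub>" using exact_0[of "m \<odot>\<^bsub>E 0\<^esub> e"] n[OF m] \<epsilon>_closed[of "m * q"] by simp
    finally show ?thesis .
  qed
  then show "\<delta> 0 e \<in> torsion_part R I (E 1)" using de by (auto simp: torsion_part_eq)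
  show "\<delta> 1 (\<delta> 0 e) = \<zero>\<^bsub>E 2\<^esub>" using exact_1[OF de] e by blast
qed

definition cocycles :: "'e set" where
  "cocycles = {x \<in> torsion_part R I (E 1). \<delta> 1 x = \<zero>\<^bsub>E 2\<^esub>}"

definition coboundaries :: "'e set" where
  "coboundaries = \<delta> 0 ` torsion_part R I (E 0)"

definition corresponds :: "'e \<Rightarrow> 'a \<Rightarrow> bool" where
  "corresponds x q \<longleftrightarrow> (\<exists>e. \<delta> 0 e = x \<and> represents e q)"

lemma H1_eq: "local_cohomology R I E \<delta> 1 = quotient_module ((E 1)\<lparr>carrier := cocycles\<rparr>) coboundaries"
  by (simp add: local_cohomology_def cocycles_def coboundaries_def numeral_2_eq_2)

lemma corresponds_cocycle: "corresponds x q \<Longrightarrow> x \<in> cocycles"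
  using torsion_of_represents by (auto simp: corresponds_def cocycles_def)

lemma corresponds_total:
  assumes "x \<in> cocycles"
  shows "\<exists>q. corresponds x q"
proof -
  have x: "x \<in> carrier (E 1)" "x \<in> torsion_part R I (E 1)" "\<delta> 1 x = \<zero>\<^bsub>E 2\<^esub>"
    using assms by (auto simp: cocycles_def torsion_part_eq)
  then obtain e where "e \<in> carrier (E 0)" "x = \<delta> 0 e" using exact_1 by blast
  then show ?thesis using represents_of_torsion[of e] x unfolding corresponds_def by blast
qed

lemma corresponds_add:
  assumes "corresponds x q" "corresponds x' q'"
  shows "corresponds (x \<oplus>\<^bsub>E 1\<^esub> x') (q + q')"
proof -
  obtain e e' where e: "\<delta> 0 e = x" "represents e q" "\<delta> 0 e' = x'" "represents e' q'"
    using assms by (auto simp: corresponds_def)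
  then have "\<delta> 0 (e \<oplus>\<^bsub>E 0\<^esub> e') = x \<oplus>\<^bsub>E 1\<^esub> x'"
    using module_homD(2)[OF \<delta>_hom, of e 0 e'] by (simp add: represents_def)
  then show ?thesis using represents_add[OF e(2,4)] by (auto simp: corresponds_def)
qed

lemma corresponds_mult:
  assumes "c \<in> A" "corresponds x q"
  shows "corresponds (c \<odot>\<^bsub>E 1\<^esub> x) (c * q)"
proof -
  obtain e where e: "\<delta> 0 e = x" "represents e q"
    using assms by (auto simp: corresponds_def)
  then have "\<delta> 0 (c \<odot>\<^bsub>E 0\<^esub> e) = c \<odot>\<^bsub>E 1\<^esub> x"
    using module_homD(3)[OF \<delta>_hom, of c e 0] assms(1) by (simp add: represents_def)
  then show ?thesis using represents_mult[OF assms(1) e(2)] by (auto simp: corresponds_def)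
qed

text \<open>Changing \<open>e\<close> by a torsion element does not change \<open>q\<close>, and changing it by \<open>\<epsilon> q\<close> does not change \<open>\<delta> e\<close>. So
  \<open>\<delta> e\<close> comes from a torsion element exactly if \<open>q\<close> comes from \<open>A\<close>.\<close>

lemma corresponds_coboundary_iff:
  assumes "corresponds x q"
  shows "x \<in> coboundaries \<longleftrightarrow> q \<in> A"
proof -
  interpret E0: module R "E 0" by (rule E_module)
  interpret E1: module R "E 1" by (rule E_module)
  obtain e where e: "\<delta> 0 e = x" "represents e q" using assms by (auto simp: corresponds_def)
  have eE: "e \<in> carrier (E 0)" using e by (auto simp: represents_def)
  have m1: "- 1 \<in> A" using subring_setD[OF A] by auto
  have neg: "represents (\<ominus>\<^bsub>E 0\<^esub> f) (- q)" if "represents f q" for f q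
    using represents_mult[OF m1 that] smult_minus_one[OF A E_module] that by (simp add: represents_def)
  have d_neg: "\<delta> 0 (\<ominus>\<^bsub>E 0\<^esub> f) = \<ominus>\<^bsub>E 1\<^esub> \<delta> 0 f" if f: "f \<in> carrier (E 0)" for f
    using module_homD(3)[OF \<delta>_hom, of "- 1" f 0] m1 f smult_minus_one[OF A E_module f]
      smult_minus_one[OF A E_module[of 1], of "\<delta> 0 f"] module_homD(1)[OF \<delta>_hom f] by simp
  show ?thesis
  proof
    assume "x \<in> coboundaries"
    then obtain f where f: "f \<in> torsion_part R I (E 0)" "\<delta> 0 f = x" by (auto simp: coboundaries_def)
    then have f0: "represents f 0" by (simp add: represents_zero_iff)
    have fE: "f \<in> carrier (E 0)" using f by (auto simp: torsion_part_eq)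
    have rep: "represents (e \<oplus>\<^bsub>E 0\<^esub> (\<ominus>\<^bsub>E 0\<^esub> f)) q"
      using represents_add[OF e(2) neg[OF f0]] by simp
    have xE: "x \<in> carrier (E 1)" using module_homD(1)[OF \<delta>_hom eE] e by simp
    have "\<delta> 0 (e \<oplus>\<^bsub>E 0\<^esub> (\<ominus>\<^bsub>E 0\<^esub> f)) = x \<oplus>\<^bsub>E 1\<^esub> (\<ominus>\<^bsub>E 1\<^esub> x)"
      using module_homD(2)[OF \<delta>_hom, of e 0 "\<ominus>\<^bsub>E 0\<^esub> f"] eE fE e f d_neg[OF fE] by simp
    also have "\<dots> = \<zero>\<^bsub>E 1\<^esub>" using xE by (rule E1.M.r_neg)
    finally obtain a where a: "a \<in> A" "e \<oplus>\<^bsub>E 0\<^esub> (\<ominus>\<^bsub>E 0\<^esub> f) = \<epsilon> a"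
      using exact_0[of "e \<oplus>\<^bsub>E 0\<^esub> (\<ominus>\<^bsub>E 0\<^esub> f)"] eE fE by auto
    then show "q \<in> A" using represents_unique[OF rep] represents_\<epsilon>[OF a(1)] by simp
  next
    assume q: "q \<in> A"
    define f where "f = e \<oplus>\<^bsub>E 0\<^esub> (\<ominus>\<^bsub>E 0\<^esub> \<epsilon> q)"
    have "represents f 0" using represents_add[OF e(2) neg[OF represents_\<epsilon>[OF q]]] by (simp add: f_def)
    then have "f \<in> torsion_part R I (E 0)" by (simp add: represents_zero_iff)
    moreover have "\<delta> 0 f = x"
    proof -
      have xE: "x \<in> carrier (E 1)" using module_homD(1)[OF \<delta>_hom eE] e by simp
      have "\<delta> 0 (\<epsilon> q) = \<zero>\<^bsub>E 1\<^esub>" using exact_0[OF \<epsilon>_closed[OF q]] q by blast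
      then show ?thesis
        using module_homD(2)[OF \<delta>_hom, of e 0 "\<ominus>\<^bsub>E 0\<^esub> \<epsilon> q"] eE e d_neg[OF \<epsilon>_closed[OF q]] \<epsilon>_closed[OF q] xE
          E1.M.r_zero[OF xE] E1.M.r_neg[OF E1.M.zero_closed] E1.M.l_zero[OF E1.M.a_inv_closed[OF E1.M.zero_closed]]
        by (simp add: f_def)
    qed
    ultimately show "x \<in> coboundaries" by (auto simp: coboundaries_def)
  qed
qed

lemma submodule_torsion_part:
  assumes "module R M"
  shows "submodule (torsion_part R I M) R M"
proof -
  interpret M: module R M by fact
  show ?thesis
  proof (rule submodule_ring_onI[OF A assms])
    show "torsion_part R I M \<subseteq> carrier M" by (auto simp: torsion_part_eq)
    show "\<zero>\<^bsub>M\<^esub> \<in> torsion_part R I M"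
      by (auto simp: torsion_part_eq ideal_pow_0 intro!: exI[of _ 0])
    fix x y assume "x \<in> torsion_part R I M" "y \<in> torsion_part R I M"
    then obtain k l where xy: "x \<in> carrier M" "y \<in> carrier M"
      and k: "\<And>m. m \<in> J k \<Longrightarrow> m \<odot>\<^bsub>M\<^esub> x = \<zero>\<^bsub>M\<^esub>" and l: "\<And>m. m \<in> J l \<Longrightarrow> m \<odot>\<^bsub>M\<^esub> y = \<zero>\<^bsub>M\<^esub>"
      by (auto simp: torsion_part_eq)
    have "m \<odot>\<^bsub>M\<^esub> (x \<oplus>\<^bsub>M\<^esub> y) = \<zero>\<^bsub>M\<^esub>" if m: "m \<in> J (max k l)" for m
      using M.smult_r_distr[of m x y] J_common[OF m] k[of m] l[of m] JD(1) xy by auto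
    then show "x \<oplus>\<^bsub>M\<^esub> y \<in> torsion_part R I M" using xy by (auto simp: torsion_part_eq)
  next
    fix c x assume c: "c \<in> A" and "x \<in> torsion_part R I M"
    then obtain n where x: "x \<in> carrier M" and n: "\<And>m. m \<in> J n \<Longrightarrow> m \<odot>\<^bsub>M\<^esub> x = \<zero>\<^bsub>M\<^esub>"
      by (auto simp: torsion_part_eq)
    have "m \<odot>\<^bsub>M\<^esub> (c \<odot>\<^bsub>M\<^esub> x) = \<zero>\<^bsub>M\<^esub>" if m: "m \<in> J n" for m
    proof -
      have mA: "m \<in> A" using m JD(1) by blast
      have "m \<odot>\<^bsub>M\<^esub> (c \<odot>\<^bsub>M\<^esub> x) = c \<odot>\<^bsub>M\<^esub> (m \<odot>\<^bsub>M\<^esub> x)"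
        using M.smult_assoc1[of m c x] M.smult_assoc1[of c m x] mA c x by (simp add: mult.commute)
      then show ?thesis using n[OF m] c by simp
    qed
    then show "c \<odot>\<^bsub>M\<^esub> x \<in> torsion_part R I M" using x c by (auto simp: torsion_part_eq)
  qed
qed

lemma submodule_cocycles: "submodule cocycles R (E 1)"
proof -
  interpret E1: module R "E 1" by (rule E_module)
  interpret E2: module R "E 2" by (rule E_module)
  note T = E1.submoduleE[OF submodule_torsion_part[OF E_module]]
  note hom = module_homD[OF \<delta>_hom[of 1], simplified, folded numeral_2_eq_2]
  have sub: "x \<in> carrier (E 1)" if "x \<in> cocycles" for x using that T(1) by (auto simp: cocycles_def)
  have smult: "c \<odot>\<^bsub>E 1\<^esub> x \<in> cocycles" if c: "c \<in> carrier R" and x: "x \<in> cocycles" for c x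
    using T(4)[OF c, of x] hom(3)[of c x] x c sub[OF x] by (auto simp: cocycles_def)
  show ?thesis
  proof (rule submodule_ring_onI[OF A E_module])
    show "cocycles \<subseteq> carrier (E 1)" using sub by blast
    show "\<zero>\<^bsub>E 1\<^esub> \<in> cocycles"
      using represents_\<epsilon>[OF subring_setD(1)[OF A]] torsion_of_represents[of "\<epsilon> 0" 0] \<delta>_zero[of 0]
      by (simp add: cocycles_def \<epsilon>_zero)
    fix x y assume x: "x \<in> cocycles" and y: "y \<in> cocycles"
    then show "x \<oplus>\<^bsub>E 1\<^esub> y \<in> cocycles"
      using T(5)[of x y] hom(2)[of x y] sub[OF x] sub[OF y] by (auto simp: cocycles_def)
  qed (use smult in simp)
qed

lemma cocycle_module: "module R ((E 1)\<lparr>carrier := cocycles\<rparr>)"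
  by (rule submodule.submodule_is_module[OF submodule_cocycles E_module])

lemma submodule_coboundaries: "submodule coboundaries R ((E 1)\<lparr>carrier := cocycles\<rparr>)"
proof -
  interpret C: module R "(E 1)\<lparr>carrier := cocycles\<rparr>" by (rule cocycle_module)
  have iff: "x \<in> coboundaries \<longleftrightarrow> (\<exists>q\<in>A. corresponds x q)" if "x \<in> cocycles" for x
    using corresponds_total[OF that] corresponds_coboundary_iff by blast
  have sub: "coboundaries \<subseteq> cocycles"
    unfolding coboundaries_def cocycles_def using represents_zero_iff torsion_of_represents by blast
  have smult: "c \<odot>\<^bsub>E 1\<^esub> x \<in> coboundaries" if c: "c \<in> A" and x: "x \<in> coboundaries" for c x
  proof -
    obtain q where "corresponds x q" "q \<in> A" using x iff sub by blast
    then show ?thesis using corresponds_mult[OF c, of x q] corresponds_coboundary_iff subring_setD(5)[OF A c] by blast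
  qed
  show ?thesis
  proof (rule submodule_ring_onI[OF A cocycle_module])
    show "coboundaries \<subseteq> carrier ((E 1)\<lparr>carrier := cocycles\<rparr>)" using sub by simp
    have "represents \<zero>\<^bsub>E 0\<^esub> 0" using represents_\<epsilon>[OF subring_setD(1)[OF A]] by (simp add: \<epsilon>_zero)
    then show "\<zero>\<^bsub>(E 1)\<lparr>carrier := cocycles\<rparr>\<^esub> \<in> coboundaries"
      unfolding coboundaries_def using \<delta>_zero[of 0] by (auto simp: represents_zero_iff image_iff intro!: bexI[of _ "\<zero>\<^bsub>E 0\<^esub>"])
    fix x y assume x: "x \<in> coboundaries" and y: "y \<in> coboundaries"
    obtain q q' where q: "corresponds x q" "q \<in> A" "corresponds y q'" "q' \<in> A" using x y iff sub by blast
    then show "x \<oplus>\<^bsub>(E 1)\<lparr>carrier := cocycles\<rparr>\<^esub> y \<in> coboundaries"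
      using corresponds_add[OF q(1,3)] corresponds_coboundary_iff subring_setD(4)[OF A] by auto
  qed (use smult in auto)
qed

lemma A_subset_S: "A \<subseteq> S"
  by (auto simp: ideal_transform_def ideal_pow_0 intro!: exI[of _ 0] subring_setD[OF A])

lemma S_total: "q \<in> S \<Longrightarrow> \<exists>x. corresponds x q"
  using ex_represents unfolding corresponds_def by blast

text \<open>The classes of \<open>x\<close> and \<open>q\<close> are matched if \<open>x = \<delta> e\<close> for an \<open>e\<close> on which a power of \<open>I\<close> acts like on \<open>q\<close>.\<close>

lemma local_cohomology_1_iso:
  "module_iso R (local_cohomology R I E \<delta> 1) (quotient_module (ring_module (ring_on S)) A)"
  unfolding H1_eq
proof (rule module_iso_of_correspondence[where \<rho> = corresponds])
  show "module R ((E 1)\<lparr>carrier := cocycles\<rparr>)" by (rule cocycle_module)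
  show "submodule coboundaries R ((E 1)\<lparr>carrier := cocycles\<rparr>)" by (rule submodule_coboundaries)
  show "module R (ring_module (ring_on S))" by (rule ring_module_is_module[OF A S A_subset_S])
  show "submodule A R (ring_module (ring_on S))"
    by (rule ring_module_submoduleI[OF A S A_subset_S A_subset_S]) (rule subring_setD[OF A]; assumption)+
  show "\<And>x y. corresponds x y \<Longrightarrow> y \<in> carrier (ring_module (ring_on S))"
    using represents_in_S by (auto simp: corresponds_def)
qed (use corresponds_cocycle corresponds_add corresponds_mult corresponds_total S_total corresponds_coboundary_iff in auto)

text \<open>The isomorphism is compatible with multiplication by \<open>a\<close>; this is where the hypothesis on \<open>a\<close> in the theorem
  becomes a statement about fractions.\<close>

lemma annihilator_local_cohomology_1:
  assumes a: "a \<in> A" and "\<forall>h\<in>carrier (local_cohomology R I E \<delta> 1).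
      a \<odot>\<^bsub>local_cohomology R I E \<delta> 1\<^esub> h = \<zero>\<^bsub>local_cohomology R I E \<delta> 1\<^esub>"
    and q: "q \<in> S"
  shows "a * q \<in> A"
proof -
  let ?M = "(E 1)\<lparr>carrier := cocycles\<rparr>"
  interpret C: module R ?M by (rule cocycle_module)
  obtain x where x: "corresponds x q" using S_total[OF q] by blast
  then have xZ: "x \<in> carrier ?M" using corresponds_cocycle by simp
  have "coboundaries +>\<^bsub>?M\<^esub> x \<in> carrier (quotient_module ?M coboundaries)"
    unfolding quotient_module_carrier using xZ by blast
  then have "a \<odot>\<^bsub>quotient_module ?M coboundaries\<^esub> (coboundaries +>\<^bsub>?M\<^esub> x) = coboundaries"
    using assms(2) unfolding H1_eq by auto
  then have "coboundaries +>\<^bsub>?M\<^esub> (a \<odot>\<^bsub>?M\<^esub> x) = coboundaries"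
    using quotient_module_smult[OF cocycle_module submodule_coboundaries xZ, of a] a by simp
  then have "a \<odot>\<^bsub>?M\<^esub> x \<in> coboundaries"
    using coset_eq_zero_iff[OF cocycle_module submodule_coboundaries, of "a \<odot>\<^bsub>?M\<^esub> x"]
      C.smult_closed[of a x] a xZ by simp
  then show ?thesis using corresponds_coboundary_iff[OF corresponds_mult[OF a x]] by simp
qed

end

section \<open>The exponent semigroup and its saturation\<close>

lemma subring_set_UNIV: "subring_set UNIV"
  by (simp add: subring_set_def)

text \<open>On the line through \<open>(i, j)\<close> in direction \<open>(e1, e2)\<close>, the last exponent of \<open>w\<close> and the leading term of
  \<open>f\<close> contribute a term to \<open>f(s\<^sup>e\<^sup>1 t\<^sup>e\<^sup>2) w\<close> that nothing else can cancel.\<close>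

lemma eval1_mult_top_exponent:
  fixes f :: "'k::field poly"
  assumes f: "f \<noteq> 0" and e: "0 < e1 \<or> 0 < e2" and ij: "(i, j) \<in> exponents w"
  shows "\<exists>k. (i + e1 * k, j + e2 * k) \<in> exponents (eval1 (mon e1 e2) f * w)"
proof -
  define K where "K = {k. (i + e1 * k, j + e2 * k) \<in> exponents w}"
  have "inj_on (\<lambda>k. (i + e1 * k, j + e2 * k)) K" using e by (auto simp: inj_on_def)
  moreover have "finite ((\<lambda>k. (i + e1 * k, j + e2 * k)) ` K)"
    by (rule finite_subset[OF _ finite_exponents[of w]]) (auto simp: K_def)
  ultimately have K: "finite K" by (rule finite_imageD[rotated])
  have "0 \<in> K" using ij by (simp add: K_def)
  define k where "k = Max K"
  have k: "k \<in> K" "\<And>l. k < l \<Longrightarrow> l \<notin> K"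
    unfolding k_def using K \<open>0 \<in> K\<close> Max_in Max_ge by (auto simp: not_less[symmetric])
  define n where "n = degree f"
  have "cf (eval1 (mon e1 e2) f * w) (i + e1 * (k + n)) (j + e2 * (k + n)) =
      (\<Sum>a\<le>n. cf (cst (poly.coeff f a) * (mon e1 e2 ^ a * w)) (i + e1 * (k + n)) (j + e2 * (k + n)))"
    by (simp add: eval1_altdef sum_distrib_right Polynomial.coeff_sum n_def mult.assoc del: cf_cst_mult)
  also have "\<dots> = (\<Sum>a\<le>n. if a = n then poly.coeff f n * cf w (i + e1 * k) (j + e2 * k) else 0)"
  proof (intro sum.cong refl)
    fix a assume a: "a \<in> {..n}"
    define l where "l = k + n - a"
    have l: "k + n = a + l" using a by (simp add: l_def)
    have "cf (mon e1 e2 ^ a * w) (i + e1 * (k + n)) (j + e2 * (k + n)) = cf w (i + e1 * l) (j + e2 * l)"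
      unfolding l mon_power cf_mon_mult by (simp add: distrib_left mult.commute[of a])
    moreover have "cf w (i + e1 * l) (j + e2 * l) = 0" if "a \<noteq> n"
      using k(2)[of l] that a l by (auto simp: K_def exponents_def)
    moreover have "l = k" if "a = n" using that by (simp add: l_def)
    ultimately show "cf (cst (poly.coeff f a) * (mon e1 e2 ^ a * w)) (i + e1 * (k + n)) (j + e2 * (k + n)) =
        (if a = n then poly.coeff f n * cf w (i + e1 * k) (j + e2 * k) else 0)" by auto
  qed
  also have "\<dots> = poly.coeff f n * cf w (i + e1 * k) (j + e2 * k)" by simp
  also have "\<dots> \<noteq> 0" using f k(1) by (simp add: n_def K_def exponents_def)
  finally show ?thesis by (intro exI[of _ "k + n"]) (simp add: exponents_def)
qed

lemma eval1_nonzero: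
  assumes "f \<noteq> 0" "0 < e1 \<or> 0 < e2"
  shows "eval1 (mon e1 e2) f \<noteq> 0"
  using eval1_mult_top_exponent[OF assms, of 0 0 1] by (auto simp: mon_0_0[symmetric] simp del: mon_0_0)

text \<open>A polynomial in \<open>s\<^sup>d\<close> is a constant for the outer variable \<open>t\<close>, and a polynomial in \<open>t\<^sup>d\<close> has a constant
  of \<open>K\<close> as leading coefficient, so \<open>f(s\<^sup>d)\<close> divides \<open>y\<close> by lemma \<open>const_dvd_of_const_dvd_mult\<close>.\<close>

lemma eval1_coprime:
  fixes f g :: "'k::field poly"
  assumes d: "0 < d" and f: "f \<noteq> 0" and g: "g \<noteq> 0"
    and eq: "eval1 (mon 0 d) g * y = z * eval1 (mon d 0) f"
  shows "\<exists>w. y = w * eval1 (mon d 0) f"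
proof -
  define F where "F = (\<Sum>a\<le>degree f. Polynomial.monom (poly.coeff f a) (d * a))"
  have F: "eval1 (mon d 0) f = [:F:]"
  proof (rule bivariate_eqI)
    fix i j
    show "cf (eval1 (mon d 0) f) i j = cf [:F:] i j"
      by (cases j) (auto simp: eval1_altdef Polynomial.coeff_sum F_def mon_power cf_mon coeff_monom mult.commute
        intro!: sum.cong)
  qed
  define h where "h = eval1 (mon 0 d) g"
  define n where "n = degree g"
  have co: "poly.coeff h j = (\<Sum>a\<le>n. if j = a * d then [:poly.coeff g a:] else 0)" for j
  proof (rule poly_eqI)
    fix i
    show "cf h i j = poly.coeff (\<Sum>a\<le>n. if j = a * d then [:poly.coeff g a:] else 0) i"
      by (cases i) (auto simp: h_def eval1_altdef Polynomial.coeff_sum mon_power cf_mon n_def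
        intro!: sum.cong sum.neutral)
  qed
  have "degree h \<le> n * d"
    by (rule degree_le) (auto simp: co intro!: sum.neutral)
  moreover have lead: "poly.coeff h (n * d) = [:lead_coeff g:]"
    using d by (simp add: co n_def)
  moreover have "[:lead_coeff g:] \<noteq> 0" using g by simp
  ultimately have deg: "degree h = n * d" using le_degree[of h "n * d"] by simp
  have "F dvd poly.coeff y j" for j
  proof (rule const_dvd_of_const_dvd_mult)
    show "0 * F + [:inverse (lead_coeff g):] * lead_coeff h = 1"
      using g by (simp add: deg lead one_pCons)
    fix l
    have "h * y = [:F:] * z" using eq by (simp add: F h_def mult.commute)
    then show "F dvd poly.coeff (h * y) l" by simp
  qed
  then have "[:F:] dvd y" by (simp add: const_poly_dvd_iff)
  then show ?thesis unfolding F by (auto simp: dvd_def mult.commute)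
qed

locale monomial_curve =
  fixes d p :: nat and r :: "nat \<Rightarrow> nat"
  assumes d_pos: "0 < d" and r_range: "\<And>i. i \<in> {1..p} \<Longrightarrow> 0 < r i \<and> r i < d"
begin

definition generators :: "(nat \<times> nat) set" where
  "generators = {(d, 0), (0, d)} \<union> (\<lambda>i. (d - r i, r i)) ` {1..p}"

inductive_set semigroup :: "(nat \<times> nat) set" where
  zero: "(0, 0) \<in> semigroup"
| add: "(i, j) \<in> semigroup \<Longrightarrow> (a, b) \<in> generators \<Longrightarrow> (a + i, b + j) \<in> semigroup"

lemma semigroup_generators: "(a, b) \<in> generators \<Longrightarrow> (a, b) \<in> semigroup"
  using semigroup.add[OF semigroup.zero] by simp

lemma semigroup_add: "(i, j) \<in> semigroup \<Longrightarrow> (i', j') \<in> semigroup \<Longrightarrow> (i + i', j + j') \<in> semigroup"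
proof (induction rule: semigroup.induct)
  case (add i j a b)
  then show ?case using semigroup.add[of "i + i'" "j + j'" a b] by (simp add: add.assoc)
qed simp

lemma semigroup_shift: "(i, j) \<in> semigroup \<Longrightarrow> (i + d * k, j + d * l) \<in> semigroup"
proof -
  have "(d * k, 0) \<in> semigroup"
    by (induction k) (use semigroup.zero semigroup.add[of _ 0 d 0] in \<open>auto simp: generators_def\<close>)
  moreover have "(0, d * l) \<in> semigroup"
    by (induction l) (use semigroup.zero semigroup.add[of 0 _ 0 d] in \<open>auto simp: generators_def\<close>)
  moreover assume "(i, j) \<in> semigroup"
  ultimately show ?thesis using semigroup_add[OF semigroup_add, of i j "d * k" 0 0 "d * l"] by simp
qed

text \<open>The exponents of the ideal transform. The same \<open>n\<close> may be used in both directions because the semigroup is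
  closed under steps of \<open>d\<close>.\<close>

definition saturation :: "(nat \<times> nat) set" where
  "saturation = {(i, j). \<exists>n. (i + d * n, j) \<in> semigroup \<and> (i, j + d * n) \<in> semigroup}"

lemma semigroup_le_saturation: "semigroup \<subseteq> saturation"
  by (auto simp: saturation_def intro!: exI[of _ 0])

lemma saturationI:
  assumes "(i + d * m, j) \<in> semigroup" "(i, j + d * n) \<in> semigroup"
  shows "(i, j) \<in> saturation"
proof -
  have "(i + d * m + d * n, j + d * 0) \<in> semigroup" "(i + d * 0, j + d * n + d * m) \<in> semigroup"
    by (rule semigroup_shift[OF assms(1)], rule semigroup_shift[OF assms(2)])
  then show ?thesis unfolding saturation_def by (auto simp: algebra_simps intro!: exI[of _ "m + n"])
qed

lemma saturation_saturated:
  assumes "(i + d * k, j) \<in> saturation" "(i, j + d * l) \<in> saturation"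
  shows "(i, j) \<in> saturation"
proof -
  obtain m n where "(i + d * k + d * m, j) \<in> semigroup" "(i, j + d * l + d * n) \<in> semigroup"
    using assms by (auto simp: saturation_def)
  then show ?thesis by (intro saturationI[of i "k + m" j "l + n"]) (simp_all add: algebra_simps)
qed

lemma saturation_add:
  assumes "(i, j) \<in> saturation" "(i', j') \<in> saturation"
  shows "(i + i', j + j') \<in> saturation"
proof -
  obtain m n where "(i + d * m, j) \<in> semigroup" "(i, j + d * m) \<in> semigroup"
    "(i' + d * n, j') \<in> semigroup" "(i', j' + d * n) \<in> semigroup"
    using assms by (auto simp: saturation_def)
  then have "(i + d * m + (i' + d * n), j + j') \<in> semigroup" "(i + i', j + d * m + (j' + d * n)) \<in> semigroup"
    by (blast intro: semigroup_add)+
  then show ?thesis by (intro saturationI[of _ "m + n" _ "m + n"]) (simp_all add: algebra_simps)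
qed

abbreviation curve_polys :: "'k::field poly poly set" where
  "curve_polys \<equiv> span_monomials semigroup"

abbreviation saturated_polys :: "'k::field poly poly set" where
  "saturated_polys \<equiv> span_monomials saturation"

lemma subalgebra_curve_polys: "subalgebra curve_polys"
  unfolding subalgebra_def
  by (auto intro: span_monomials_cst span_monomials_add span_monomials_mult semigroup.zero semigroup_add)

lemma subalgebra_saturated_polys: "subalgebra saturated_polys"
  unfolding subalgebra_def
  using semigroup.zero semigroup_le_saturation
  by (auto intro: span_monomials_cst span_monomials_add span_monomials_mult saturation_add)

lemma curve_polys_subset: "curve_polys \<subseteq> saturated_polys"
  by (rule span_monomials_mono[OF semigroup_le_saturation])

lemma mon_in_curve_polys: "mon (d * k) (d * l) \<in> curve_polys"
  using semigroup_shift[OF semigroup.zero, of k l] by simp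

lemma power_submodule_of_subalgebra_overring:
  assumes T: "subalgebra T" "curve_polys \<subseteq> T"
  shows "power_submodule d T"
proof -
  have "mon d 0 \<in> T" "mon 0 d \<in> T"
    using mon_in_curve_polys[of 1 0] mon_in_curve_polys[of 0 1] T(2) by auto
  then show ?thesis unfolding power_submodule_def using subalgebraD[OF T(1)] subalgebra_0[OF T(1)] by blast
qed

lemma multiples_in_curve_polys_mono:
  assumes "mon (d * n) 0 * h \<in> curve_polys \<and> mon 0 (d * n) * h \<in> curve_polys"
  shows "mon (d * (n + k)) 0 * h \<in> curve_polys \<and> mon 0 (d * (n + k)) * h \<in> curve_polys"
proof -
  have "mon (d * k) 0 * (mon (d * n) 0 * h) \<in> curve_polys" "mon 0 (d * k) * (mon 0 (d * n) * h) \<in> curve_polys"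
    using assms mon_in_curve_polys[of k 0] mon_in_curve_polys[of 0 k]
    by (auto intro!: subalgebraD(3)[OF subalgebra_curve_polys])
  then show ?thesis by (simp add: mult.assoc[symmetric] mon_mult distrib_left add.commute)
qed

lemma power_mult_in_curve_polys:
  assumes "f \<in> saturated_polys"
  obtains n where "mon (d * n) 0 * f \<in> curve_polys" "mon 0 (d * n) * f \<in> curve_polys"
proof -
  have "\<exists>n. mon (d * n) 0 * f \<in> curve_polys \<and> mon 0 (d * n) * f \<in> curve_polys"
    using assms
  proof (induction rule: span_monomials_induct)
    case (add f g)
    from add obtain m n where "mon (d * m) 0 * f \<in> curve_polys \<and> mon 0 (d * m) * f \<in> curve_polys"
      "mon (d * n) 0 * g \<in> curve_polys \<and> mon 0 (d * n) * g \<in> curve_polys" by blast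
    from multiples_in_curve_polys_mono[OF this(1), of n] multiples_in_curve_polys_mono[OF this(2), of m]
    show ?case by (intro exI[of _ "m + n"]) (auto simp: distrib_left add.commute intro: span_monomials_add)
  next
    case (monomial i j c)
    then obtain n where n: "(i + d * n, j) \<in> semigroup" "(i, j + d * n) \<in> semigroup"
      by (auto simp: saturation_def)
    then have "cst c * mon (d * n + i) j \<in> curve_polys" "cst c * mon i (d * n + j) \<in> curve_polys"
      by (auto intro!: span_monomials_cst_mult simp: add.commute)
    then show ?case by (intro exI[of _ n]) (simp add: mult.left_commute[of _ "cst c"] mon_mult)
  qed simp
  then show ?thesis using that by blast
qed

text \<open>Cancellation in \<open>K[s, t]\<close> gives \<open>y = w f(s\<^sup>d)\<close>, and then \<open>w f(s\<^sup>d)\<close> and \<open>w g(t\<^sup>d)\<close> both have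
  exponents in the saturation only. By lemma \<open>eval1_mult_top_exponent\<close> every exponent of \<open>w\<close> can thus be moved
  into the saturation horizontally as well as vertically, and so belongs to it.\<close>

lemma saturated_polys_regular:
  assumes f: "f \<noteq> 0" and g: "g \<noteq> 0" and y: "y \<in> saturated_polys" and z: "z \<in> saturated_polys"
    and eq: "eval1 (mon 0 d) g * y = z * eval1 (mon d 0) f"
  shows "\<exists>w\<in>saturated_polys. y = w * eval1 (mon d 0) f"
proof -
  obtain w where w: "y = w * eval1 (mon d 0) f" using eval1_coprime[OF d_pos f g eq] by blast
  have "eval1 (mon 0 d) g * w * eval1 (mon d 0) f = z * eval1 (mon d 0) f"
    using eq by (simp add: w mult.assoc)
  then have gw: "eval1 (mon 0 d) g * w = z" using eval1_nonzero[OF f, of d 0] d_pos by simp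
  have "(i, j) \<in> saturation" if ij: "(i, j) \<in> exponents w" for i j
  proof -
    obtain k where "(i + d * k, j + 0 * k) \<in> exponents (eval1 (mon d 0) f * w)"
      using eval1_mult_top_exponent[OF f _ ij, of d 0] d_pos by auto
    moreover obtain l where "(i + 0 * l, j + d * l) \<in> exponents (eval1 (mon 0 d) g * w)"
      using eval1_mult_top_exponent[OF g _ ij, of 0 d] d_pos by auto
    moreover have "eval1 (mon d 0) f * w = y" by (simp add: w mult.commute)
    ultimately show ?thesis
      using y z saturation_saturated[of i k j l] by (auto simp: gw span_monomials_def)
  qed
  then have "w \<in> saturated_polys" by (auto simp: span_monomials_def)
  then show ?thesis using w by blast
qed

text \<open>Let \<open>G\<close> generate the saturated ring over \<open>K[s\<^sup>d, t\<^sup>d]\<close>. A common power \<open>n\<close> of \<open>s\<^sup>d\<close> and \<open>t\<^sup>d\<close>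
  moves all of \<open>G\<close> into the coordinate ring, so modulo the latter only the finitely many products
  \<open>s\<^sup>d\<^sup>i t\<^sup>d\<^sup>j g\<close> with \<open>i, j < n\<close> are needed.\<close>

lemma saturated_polys_mod_curve_polys:
  obtains B :: "'k::field poly poly set" where "finite B"
    "\<And>f. f \<in> saturated_polys \<Longrightarrow> \<exists>h\<in>curve_polys. \<exists>v\<in>poly_space.span B. f = h + v"
proof -
  obtain G :: "'k poly poly set" where G: "finite G" "G \<subseteq> saturated_polys"
    "\<And>J. power_submodule d J \<Longrightarrow> G \<subseteq> J \<Longrightarrow> saturated_polys \<subseteq> J"
    using power_submodule_fg[OF d_pos power_submodule_of_subalgebra_overring[OF subalgebra_saturated_polys curve_polys_subset]]
    by metis
  have "\<exists>n. \<forall>g\<in>G. mon (d * n) 0 * g \<in> curve_polys \<and> mon 0 (d * n) * g \<in> curve_polys"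
    using G(1,2)
  proof (induction G)
    case (insert g G)
    then obtain m where m: "\<forall>g\<in>G. mon (d * m) 0 * g \<in> curve_polys \<and> mon 0 (d * m) * g \<in> curve_polys" by blast
    obtain n where n: "mon (d * n) 0 * g \<in> curve_polys" "mon 0 (d * n) * g \<in> curve_polys"
      using power_mult_in_curve_polys insert.prems by blast
    show ?case using multiples_in_curve_polys_mono[of m _ n] multiples_in_curve_polys_mono[of n g m] m n by (intro exI[of _ "m + n"]) (auto simp: add.commute)
  qed simp
  then obtain n where n: "\<And>g. g \<in> G \<Longrightarrow> mon (d * n) 0 * g \<in> curve_polys"
    "\<And>g. g \<in> G \<Longrightarrow> mon 0 (d * n) * g \<in> curve_polys" by blast
  define B where "B = (\<lambda>(i, j, g). mon (d * i) (d * j) * g) ` ({..<n} \<times> {..<n} \<times> G)"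
  define J where "J = {h + v | h v. h \<in> curve_polys \<and> v \<in> poly_space.span B}"
  have JI: "h + v \<in> J" if "h \<in> curve_polys" "v \<in> poly_space.span B" for h v using that by (auto simp: J_def)
  have J0: "h \<in> J" if "h \<in> curve_polys" for h using JI[OF that poly_space.span_zero] by simp
  have Jadd: "f + g \<in> J" if "f \<in> J" "g \<in> J" for f g
  proof -
    obtain h v h' v' where *: "f = h + v" "g = h' + v'" "h \<in> curve_polys" "h' \<in> curve_polys"
      "v \<in> poly_space.span B" "v' \<in> poly_space.span B" using \<open>f \<in> J\<close> \<open>g \<in> J\<close> by (auto simp: J_def)
    then have "(h + h') + (v + v') \<in> J" by (intro JI span_monomials_add poly_space.span_add)
    then show ?thesis by (simp add: * algebra_simps)
  qed
  have Jmon: "mon (d * i) (d * j) * g \<in> J" if g: "g \<in> G" for i j g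
  proof -
    consider "i < n" "j < n" | "n \<le> i" | "n \<le> j" by linarith
    then show ?thesis
    proof cases
      case 1
      then have "mon (d * i) (d * j) * g \<in> B" using g by (force simp: B_def)
      then have "0 + mon (d * i) (d * j) * g \<in> J" by (intro JI poly_space.span_base) auto
      then show ?thesis by simp
    next
      case 2
      then have "mon (d * i) (d * j) * g = mon (d * (i - n)) (d * j) * (mon (d * n) 0 * g)"
        by (simp add: mult.assoc[symmetric] mon_mult distrib_left[symmetric])
      then show ?thesis using n(1)[OF g] mon_in_curve_polys
        by (metis J0 subalgebraD(3)[OF subalgebra_curve_polys])
    next
      case 3
      then have "mon (d * i) (d * j) * g = mon (d * i) (d * (j - n)) * (mon 0 (d * n) * g)"
        by (simp add: mult.assoc[symmetric] mon_mult distrib_left[symmetric])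
      then show ?thesis using n(2)[OF g] mon_in_curve_polys
        by (metis J0 subalgebraD(3)[OF subalgebra_curve_polys])
    qed
  qed
  have Jcst: "cst c * f \<in> J" if "f \<in> J" for c f
  proof -
    from that obtain h v where *: "f = h + v" "h \<in> curve_polys" "v \<in> poly_space.span B"
      by (auto simp: J_def)
    then have "cst c * h + cst c * v \<in> J" by (intro JI span_monomials_cst_mult poly_space.span_scale)
    then show ?thesis by (simp add: * algebra_simps)
  qed
  have Jmult: "mon (d * k) (d * l) * f \<in> J" if "f \<in> J" for k l f
  proof -
    from that obtain h v where *: "f = h + v" "h \<in> curve_polys" "v \<in> poly_space.span B"
      by (auto simp: J_def)
    have "mon (d * k) (d * l) * h \<in> J"
      by (intro J0 subalgebraD(3)[OF subalgebra_curve_polys] mon_in_curve_polys *(2))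
    moreover have "mon (d * k) (d * l) * v \<in> J" using *(3)
    proof (induction rule: poly_space.span_induct_alt)
      case (step c b v)
      obtain i j g where b: "b = mon (d * i) (d * j) * g" "g \<in> G" using step(1) by (auto simp: B_def)
      have "mon (d * k) (d * l) * b = mon (d * (k + i)) (d * (l + j)) * g"
        by (simp add: b(1) mult.assoc[symmetric] mon_mult distrib_left)
      then have "mon (d * k) (d * l) * (cst c * b + v) =
          cst c * (mon (d * (k + i)) (d * (l + j)) * g) + mon (d * k) (d * l) * v"
        by (simp add: distrib_left mult.left_commute[of _ "cst c"])
      also have "\<dots> \<in> J" by (intro Jadd Jcst Jmon b(2) step)
      finally show ?case .
    qed (use J0 in simp)
    ultimately show ?thesis unfolding *(1) distrib_left by (rule Jadd)
  qed
  have "power_submodule d J"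
    unfolding power_submodule_def
    using J0[of 0] Jadd Jcst Jmult[of _ 1 0] Jmult[of _ 0 1] by auto
  moreover have "G \<subseteq> J" using Jmon[of _ 0 0] by (auto simp: mon_0_0)
  ultimately have "saturated_polys \<subseteq> J" by (rule G(3))
  moreover have "finite B" using G(1) by (simp add: B_def)
  ultimately show ?thesis unfolding J_def by (intro that[of B]) blast+
qed

lemma curve_monomials_eq: "curve_monomials d p r = (\<lambda>(i, j). mon i j :: 'k::field poly poly) ` generators"
  by (auto simp: curve_monomials_def generators_def var_s_eq var_t_eq mon_power mon_mult image_Un image_image)

lemma generate_curve_polys:
  "generate_ring (ring_on UNIV) (range (\<lambda>c. [:[:c:]:]) \<union> curve_monomials d p r) = (curve_polys :: 'k::field poly poly set)"
  (is "generate_ring ?R ?X = _")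
proof -
  note cm = curve_monomials_eq
  show ?thesis
  proof (intro equalityI subsetI)
    fix f assume "f \<in> generate_ring ?R ?X"
    then show "f \<in> curve_polys"
    proof (induction rule: generate_ring.induct)
      case one
      then show ?case by (simp add: subalgebra_1[OF subalgebra_curve_polys])
    next
      case (incl h)
      then show ?case
        by (auto simp: cm cst_def[symmetric] subalgebraD(1)[OF subalgebra_curve_polys] semigroup_generators)
    next
      case (a_inv h)
      then show ?case by (simp add: a_inv_ring_on[OF subring_set_UNIV] span_monomials_uminus)
    qed (auto intro: subalgebraD[OF subalgebra_curve_polys])
  next
    have mult: "f * g \<in> generate_ring ?R ?X" if "f \<in> generate_ring ?R ?X" "g \<in> generate_ring ?R ?X" for f g
      using generate_ring.eng_mult[OF that] by simp
    have c: "cst c \<in> generate_ring ?R ?X" for c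
      by (rule generate_ring.incl) (simp add: cst_def)
    have m: "mon i j \<in> generate_ring ?R ?X" if "(i, j) \<in> semigroup" for i j
      using that
    proof (induction rule: semigroup.induct)
      case zero
      then show ?case using c[of 1] by (simp add: mon_0_0)
    next
      case (add i j a b)
      have "mon a b \<in> generate_ring ?R ?X"
        using add(2) by (intro generate_ring.incl) (auto simp: cm)
      then show ?case using mult[of "mon a b" "mon i j"] add by (simp add: mon_mult)
    qed
    fix f :: "'k poly poly" assume "f \<in> curve_polys"
    then show "f \<in> generate_ring ?R ?X"
    proof (induction rule: span_monomials_induct)
      case zero
      then show ?case using c[of 0] by simp
    next
      case (add f g)
      then show ?case using generate_ring.eng_add[of f ?R ?X g] by simp
    next
      case (monomial i j k)
      then show ?case by (intro mult c m)
    qed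
  qed
qed

end

section \<open>Passage to the field of fractions\<close>

lemma to_fraction_hom [simp]:
  "to_fraction (f + g) = to_fraction f + to_fraction g" "to_fraction (f * g) = to_fraction f * to_fraction g"
  "to_fraction (- f) = - to_fraction f" "to_fraction 0 = 0" "to_fraction 1 = 1"
  "to_fraction f = to_fraction g \<longleftrightarrow> f = g"
  by (simp_all add: to_fraction_def Zero_fract_def One_fract_def eq_fract)

lemma to_fraction_power [simp]: "to_fraction (f ^ n) = to_fraction f ^ n"
  by (induction n) simp_all

lemma to_fraction_eq_0_iff [simp]: "to_fraction f = 0 \<longleftrightarrow> f = 0"
  using to_fraction_hom(6)[of f 0] by (simp del: to_fraction_hom(6))

lemma to_fraction_mem_image [simp]: "to_fraction f \<in> to_fraction ` T \<longleftrightarrow> f \<in> T"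
  by auto

lemma subring_set_to_fraction:
  assumes "subalgebra T"
  shows "subring_set (to_fraction ` T)"
  unfolding subring_set_def
proof (intro conjI ballI)
  show "1 \<in> to_fraction ` T" using subalgebra_1[OF assms] by (metis imageI to_fraction_hom(5))
next
  fix x assume "x \<in> to_fraction ` T"
  then show "- x \<in> to_fraction ` T" using subalgebra_uminus[OF assms] by (auto simp flip: to_fraction_hom(3))
next
  fix x y assume "x \<in> to_fraction ` T" "y \<in> to_fraction ` T"
  then show "x + y \<in> to_fraction ` T" "x * y \<in> to_fraction ` T"
    using subalgebraD(2,3)[OF assms] by (auto simp flip: to_fraction_hom(1,2))
qed

text \<open>Dividing the relation of lemma \<open>three_elements_dependent\<close> by its constant \<open>\<kappa>\<close>.\<close>

lemma krull_dim_to_fraction: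
  assumes T: "subalgebra T"
  shows "krull_dim_le_2 (to_fraction ` T)"
  unfolding krull_dim_le_2_def
proof (intro ballI)
  fix y1 y2 y3 assume "y1 \<in> to_fraction ` T" "y2 \<in> to_fraction ` T" "y3 \<in> to_fraction ` T"
  then obtain x1 x2 x3 where x: "x1 \<in> T" "x2 \<in> T" "x3 \<in> T"
    and y: "y1 = to_fraction x1" "y2 = to_fraction x2" "y3 = to_fraction x3" by blast
  obtain a b c \<kappa> g1 g2 g3 where g: "\<kappa> \<noteq> 0" "g1 \<in> T" "g2 \<in> T" "g3 \<in> T"
    "x1 ^ a * (x2 ^ b * (x3 ^ c * (cst \<kappa> + x3 * g3) + x2 * g2) + x1 * g1) = 0"
    using three_elements_dependent[OF T x] by metis
  define e where "e = cst (inverse \<kappa>)"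
  have e: "e * cst \<kappa> = 1" unfolding e_def cst_mult[symmetric] using g(1) by simp
  have eT: "e \<in> T" unfolding e_def by (rule subalgebraD(1)[OF T])
  have "x1 ^ a * (x2 ^ b * (x3 ^ c * (1 + x3 * (e * g3)) + x2 * (e * g2)) + x1 * (e * g1)) =
      e * (x1 ^ a * (x2 ^ b * (x3 ^ c * (cst \<kappa> + x3 * g3) + x2 * g2) + x1 * g1))"
    unfolding e[symmetric] by (simp add: algebra_simps)
  then have "x1 ^ a * (x2 ^ b * (x3 ^ c * (1 + x3 * (e * g3)) + x2 * (e * g2)) + x1 * (e * g1)) = 0"
    unfolding g(5) by simp
  then have "to_fraction (x1 ^ a * (x2 ^ b * (x3 ^ c * (1 + x3 * (e * g3)) + x2 * (e * g2)) + x1 * (e * g1))) = to_fraction 0"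
    by (rule arg_cong)
  then have "y1 ^ a * (y2 ^ b * (y3 ^ c * (1 + y3 * to_fraction (e * g3)) + y2 * to_fraction (e * g2)) +
      y1 * to_fraction (e * g1)) = 0"
    by (simp add: y del: to_fraction_eq_0_iff)
  moreover have "to_fraction (e * g) \<in> to_fraction ` T" if "g \<in> T" for g
    using subalgebraD(3)[OF T eT that] by blast
  moreover note g(2-4)
  ultimately show "\<exists>a b c. \<exists>g1\<in>to_fraction ` T. \<exists>g2\<in>to_fraction ` T. \<exists>g3\<in>to_fraction ` T.
      y1 ^ a * (y2 ^ b * (y3 ^ c * (1 + y3 * g3) + y2 * g2) + y1 * g1) = 0"
    by (intro exI bexI) auto
qed

section \<open>Radicals\<close>

lemma ideal_radical_ring_on: "ideal_radical (ring_on A) Q = {x \<in> A. \<exists>n. x ^ n \<in> Q}"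
  by (simp add: ideal_radical_def nat_pow_ring_on)

text \<open>The factor \<open>z\<close> makes the induction work without binomial coefficients: one factor \<open>x + y\<close> is split off and
  \<open>x\<close> or \<open>y\<close> is moved into \<open>z\<close>.\<close>

lemma power_sum_in_ideal:
  assumes A: "subring_set A" and Q: "ideal Q (ring_on A)" and xy: "x \<in> A" "y \<in> A"
  shows "z \<in> A \<Longrightarrow> x ^ m * z \<in> Q \<Longrightarrow> y ^ n * z \<in> Q \<Longrightarrow> (x + y) ^ (m + n) * z \<in> Q"
proof (induction "m + n" arbitrary: m n z)
  case 0
  then show ?case by simp
next
  case (Suc l)
  note QD = ideal_ring_onD[OF A Q]
  show ?case
  proof (cases "m = 0 \<or> n = 0")
    case True
    then have "z \<in> Q" using Suc.prems by auto
    then show ?thesis using QD(4) subring_setD(4,7)[OF A] xy by blast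
  next
    case False
    then obtain m' n' where mn: "m = Suc m'" "n = Suc n'" by (metis not0_implies_Suc)
    have zA: "x * z \<in> A" "y * z \<in> A" using Suc.prems xy subring_setD(5)[OF A] by auto
    have "(x + y) ^ (m' + n) * (x * z) \<in> Q"
    proof (rule Suc.hyps(1))
      show "x ^ m' * (x * z) \<in> Q" using Suc.prems by (simp add: mn algebra_simps)
      have "x * (y ^ n * z) \<in> Q" by (intro QD(4) xy Suc.prems)
      then show "y ^ n * (x * z) \<in> Q" by (simp add: algebra_simps)
    qed (use Suc.hyps(2) zA in \<open>simp_all add: mn\<close>)
    moreover have "(x + y) ^ (m + n') * (y * z) \<in> Q"
    proof (rule Suc.hyps(1))
      show "y ^ n' * (y * z) \<in> Q" using Suc.prems by (simp add: mn algebra_simps)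
      have "y * (x ^ m * z) \<in> Q" by (intro QD(4) xy Suc.prems)
      then show "x ^ m * (y * z) \<in> Q" by (simp add: algebra_simps)
    qed (use Suc.hyps(2) zA in \<open>simp_all add: mn\<close>)
    ultimately have "(x + y) ^ (m' + n) * (x * z) + (x + y) ^ (m + n') * (y * z) \<in> Q" by (rule QD(3))
    then show ?thesis by (simp add: mn algebra_simps)
  qed
qed

lemma ideal_radical_ideal:
  assumes A: "subring_set A" and Q: "ideal Q (ring_on A)"
  shows "ideal (ideal_radical (ring_on A) Q) (ring_on A)"
  unfolding ideal_ring_on_iff[OF A] ideal_radical_ring_on
proof (intro conjI ballI)
  note QD = ideal_ring_onD[OF A Q]
  have "(0::'a) ^ 1 \<in> Q" using QD(2) by simp
  then show "0 \<in> {x \<in> A. \<exists>n. x ^ n \<in> Q}" using subring_setD(1)[OF A] by blast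
  fix x y assume y: "y \<in> {x \<in> A. \<exists>n. x ^ n \<in> Q}"
  then obtain n where n: "y \<in> A" "y ^ n \<in> Q" by blast
  {
    assume "x \<in> {x \<in> A. \<exists>n. x ^ n \<in> Q}"
    then obtain m where m: "x \<in> A" "x ^ m \<in> Q" by blast
    then have "(x + y) ^ (m + n) * 1 \<in> Q"
      using n by (intro power_sum_in_ideal[OF A Q]) (simp_all add: subring_setD(2)[OF A])
    then show "x + y \<in> {x \<in> A. \<exists>n. x ^ n \<in> Q}" using m n subring_setD(4)[OF A] by auto
  next
    assume x: "x \<in> A"
    then have "x ^ n * y ^ n \<in> Q" by (intro QD(4) n subring_setD(7)[OF A])
    then have "(x * y) ^ n \<in> Q" by (simp add: power_mult_distrib)
    then show "x * y \<in> {x \<in> A. \<exists>n. x ^ n \<in> Q}" using x n subring_setD(5)[OF A] by blast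
  }
qed auto

section \<open>The coordinate ring and its ideal transform\<close>

text \<open>The parameter \<open>K\<close> fixes the ground field as a type, so that the rings below are single sets.\<close>

locale monomial_curve_over = monomial_curve +
  fixes K :: "'k::field itself"
begin

definition curve_ring :: "'k poly poly fract set" where
  "curve_ring = to_fraction ` curve_polys"

definition saturated_ring :: "'k poly poly fract set" where
  "saturated_ring = to_fraction ` saturated_polys"

definition u :: "'k poly poly fract" where "u = to_fraction (mon d 0)"

definition v :: "'k poly poly fract" where "v = to_fraction (mon 0 d)"

definition irrelevant_ideal :: "'k poly poly fract set" where
  "irrelevant_ideal = homogeneous_maximal_ideal d p r"

lemma monomial_curve_ring_eq: "monomial_curve_ring d p r = ring_on curve_ring"
  by (simp add: monomial_curve_ring_def curve_ring_def generate_curve_polys)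

lemma subring_curve_ring: "subring_set curve_ring"
  unfolding curve_ring_def by (rule subring_set_to_fraction[OF subalgebra_curve_polys])

lemma subring_saturated_ring: "subring_set saturated_ring"
  unfolding saturated_ring_def by (rule subring_set_to_fraction[OF subalgebra_saturated_polys])

lemma curve_ring_subset: "curve_ring \<subseteq> saturated_ring"
  unfolding curve_ring_def saturated_ring_def using curve_polys_subset by blast

lemma uv_nonzero [simp]: "u \<noteq> 0" "v \<noteq> 0"
  by (simp_all add: u_def v_def)

lemma uv_power: "u ^ n = to_fraction (mon (d * n) 0)" "v ^ n = to_fraction (mon 0 (d * n))"
  by (simp_all add: u_def v_def mon_power mult.commute flip: to_fraction_power)

lemma u_in_curve_ring: "u \<in> curve_ring" and v_in_curve_ring: "v \<in> curve_ring"
  using mon_in_curve_polys[of 1 0] mon_in_curve_polys[of 0 1] by (auto simp: u_def v_def curve_ring_def)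

lemma d_exponents_in_saturation: "(d, 0) \<in> saturation" "(0, d) \<in> saturation"
  using semigroup_generators semigroup_le_saturation by (auto simp: generators_def)

text \<open>A fraction whose products with a power of \<open>s\<close> and with a power of \<open>t\<close> are polynomials is itself a polynomial,
  as \<open>s\<close> and \<open>t\<close> are coprime; the condition then becomes one on its exponents.\<close>

lemma saturated_ring_iff:
  "q \<in> saturated_ring \<longleftrightarrow> (\<exists>n. u ^ n * q \<in> curve_ring \<and> v ^ n * q \<in> curve_ring)"
proof
  assume "q \<in> saturated_ring"
  then obtain f where f: "q = to_fraction f" "f \<in> saturated_polys" by (auto simp: saturated_ring_def)
  obtain n where "mon (d * n) 0 * f \<in> curve_polys" "mon 0 (d * n) * f \<in> curve_polys"
    using power_mult_in_curve_polys[OF f(2)] by blast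
  then show "\<exists>n. u ^ n * q \<in> curve_ring \<and> v ^ n * q \<in> curve_ring"
    by (intro exI[of _ n]) (simp add: f uv_power curve_ring_def flip: to_fraction_hom(2))
next
  assume "\<exists>n. u ^ n * q \<in> curve_ring \<and> v ^ n * q \<in> curve_ring"
  then obtain n f g where fg: "u ^ n * q = to_fraction f" "v ^ n * q = to_fraction g"
    "f \<in> curve_polys" "g \<in> curve_polys" unfolding curve_ring_def by blast
  define l where "l = d * n"
  have "to_fraction (mon 0 l * f) = v ^ n * (u ^ n * q)"
    unfolding fg(1) by (simp add: uv_power l_def)
  also have "\<dots> = u ^ n * (v ^ n * q)" by (simp add: algebra_simps)
  also have "\<dots> = to_fraction (mon l 0 * g)"
    unfolding fg(2) by (simp add: uv_power l_def)
  finally have "mon 0 l * f = mon l 0 * g" by (simp del: to_fraction_hom(2))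
  then have eq: "cf (mon 0 l * f) i j = cf (mon l 0 * g) i j" for i j by simp
  \<comment> \<open>\<open>w = f / s\<^sup>l\<close>, which is a polynomial because \<open>t\<^sup>l f = s\<^sup>l g\<close>.\<close>
  define w where "w = map_poly (poly_shift l) f"
  have w: "cf w i j = cf f (i + l) j" for i j
    by (simp add: w_def coeff_map_poly coeff_poly_shift)
  have f_eq: "f = mon l 0 * w"
  proof (rule bivariate_eqI)
    fix i j show "cf f i j = cf (mon l 0 * w) i j"
    proof (cases "l \<le> i")
      case True
      then show ?thesis by (simp add: cf_mon_mult w)
    next
      case False
      have "cf f i j = cf (mon 0 l * f) i (j + l)" by (simp add: cf_mon_mult)
      also have "\<dots> = 0" unfolding eq using False by (simp add: cf_mon_mult)
      finally show ?thesis using False by (simp add: cf_mon_mult)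
    qed
  qed
  have "(i, j) \<in> saturation" if "(i, j) \<in> exponents w" for i j
  proof -
    have nz: "cf f (i + l) j \<noteq> 0" using that by (simp add: exponents_def w)
    then have "(i + d * n, j) \<in> semigroup" using fg(3) by (auto simp: span_monomials_def exponents_def l_def)
    moreover have "cf g i (j + l) \<noteq> 0" using eq[of "j + l" "i + l"] nz by (simp add: cf_mon_mult)
    then have "(i, j + d * n) \<in> semigroup" using fg(4) by (auto simp: span_monomials_def exponents_def l_def)
    ultimately show ?thesis by (rule saturationI)
  qed
  then have "w \<in> saturated_polys" by (auto simp: span_monomials_def)
  moreover have "to_fraction f = u ^ n * to_fraction w" unfolding uv_power by (subst f_eq) (simp add: l_def)
  then have "u ^ n * q = u ^ n * to_fraction w" using fg(1) by metis
  then have "q = to_fraction w" by simp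
  ultimately show "q \<in> saturated_ring" by (auto simp: saturated_ring_def)
qed

lemma irrelevant_ideal_eq: "irrelevant_ideal = Idl\<^bsub>ring_on curve_ring\<^esub> (to_fraction ` (\<lambda>(i, j). mon i j) ` generators)"
  by (simp add: irrelevant_ideal_def homogeneous_maximal_ideal_def monomial_curve_ring_eq curve_monomials_eq)

lemma generators_in_curve_ring: "to_fraction ` (\<lambda>(i, j). mon i j) ` generators \<subseteq> curve_ring"
  using semigroup_generators by (auto simp: curve_ring_def intro!: imageI)

lemma irrelevant_ideal_ideal: "ideal irrelevant_ideal (ring_on curve_ring)"
  unfolding irrelevant_ideal_eq by (rule Idl_ring_on(1)[OF subring_curve_ring generators_in_curve_ring])

lemma generator_in_irrelevant_ideal: "(i, j) \<in> generators \<Longrightarrow> to_fraction (mon i j) \<in> irrelevant_ideal"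
  using Idl_ring_on(2)[OF subring_curve_ring generators_in_curve_ring] unfolding irrelevant_ideal_eq by blast

lemma uv_in_irrelevant_ideal: "u \<in> irrelevant_ideal" "v \<in> irrelevant_ideal"
  using generator_in_irrelevant_ideal[of d 0] generator_in_irrelevant_ideal[of 0 d] by (simp_all add: generators_def u_def v_def)

text \<open>All generators have degree \<open>d\<close>, so the \<open>n\<close>-th power of the irrelevant ideal lives in degrees at least \<open>d n\<close>.\<close>

definition filtration :: "nat \<Rightarrow> (nat \<times> nat) set" where
  "filtration n = {(i, j) \<in> semigroup. d * n \<le> i + j}"

lemma filtration_ideal:
  "ideal (to_fraction ` (span_monomials (filtration n) :: 'k poly poly set)) (ring_on curve_ring)"
  unfolding ideal_ring_on_iff[OF subring_curve_ring]
proof (intro conjI ballI)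
  show "to_fraction ` (span_monomials (filtration n) :: 'k poly poly set) \<subseteq> curve_ring"
    unfolding curve_ring_def by (intro image_mono span_monomials_mono) (auto simp: filtration_def)
  show "0 \<in> to_fraction ` (span_monomials (filtration n) :: 'k poly poly set)"
    by (rule image_eqI[of _ _ 0]) auto
  fix x y :: "'k poly poly fract" assume "y \<in> to_fraction ` span_monomials (filtration n)"
  then obtain g where g: "y = to_fraction g" "g \<in> span_monomials (filtration n)" by blast
  {
    assume "x \<in> to_fraction ` span_monomials (filtration n)"
    then obtain f where f: "x = to_fraction f" "f \<in> span_monomials (filtration n)" by blast
    show "x + y \<in> to_fraction ` span_monomials (filtration n)"
      using span_monomials_add[OF f(2) g(2)] by (simp add: f g flip: to_fraction_hom(1))
  next
    assume "x \<in> curve_ring"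
    then obtain f where f: "x = to_fraction f" "f \<in> curve_polys" by (auto simp: curve_ring_def)
    have "f * g \<in> span_monomials (filtration n)"
      by (rule span_monomials_mult[OF f(2) g(2)]) (auto simp: filtration_def intro: semigroup_add)
    then show "x * y \<in> to_fraction ` span_monomials (filtration n)" by (simp add: f g flip: to_fraction_hom(2))
  }
qed

lemma irrelevant_ideal_le_filtration: "irrelevant_ideal \<subseteq> to_fraction ` span_monomials (filtration 1)"
  unfolding irrelevant_ideal_eq
proof (rule Idl_ring_on(3)[OF subring_curve_ring generators_in_curve_ring filtration_ideal])
  have "generators \<subseteq> filtration 1"
    using semigroup_generators r_range by (auto simp: filtration_def) (auto simp: generators_def)
  then show "to_fraction ` (\<lambda>(i, j). mon i j) ` generators \<subseteq> to_fraction ` span_monomials (filtration 1)"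
    by (intro image_mono) auto
qed

lemma ideal_pow_le_filtration: "ideal_pow curve_ring irrelevant_ideal n \<subseteq> to_fraction ` span_monomials (filtration n)"
proof (induction n)
  case 0
  have "filtration 0 = semigroup" by (auto simp: filtration_def)
  then show ?case by (simp add: ideal_pow_0 curve_ring_def)
next
  case (Suc n)
  show ?case
  proof
    fix x assume "x \<in> ideal_pow curve_ring irrelevant_ideal (Suc n)"
    then show "x \<in> to_fraction ` span_monomials (filtration (Suc n))"
      unfolding ideal_pow_Suc
    proof (induction rule: ideal_prod.induct)
      case (prod x y)
      obtain f where f: "x = to_fraction f" "f \<in> span_monomials (filtration n)" using prod(1) Suc by blast
      obtain g where g: "y = to_fraction g" "g \<in> span_monomials (filtration 1)"
        using prod(2) irrelevant_ideal_le_filtration by blast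
      have "f * g \<in> span_monomials (filtration (Suc n))"
        by (rule span_monomials_mult[OF f(2) g(2)]) (auto simp: filtration_def intro: semigroup_add)
      then show ?case by (simp add: f g flip: to_fraction_hom(2))
    next
      case (sum x y)
      then show ?case using ideal_ring_onD(3)[OF subring_curve_ring filtration_ideal, of x "Suc n" y] by simp
    qed
  qed
qed

text \<open>The semigroup is a finite union of translates \<open>(a, b) + \<nat>(d, 0) + \<nat>(0, d)\<close>. In large degree one of the two
  multiplicities must be large.\<close>

lemma semigroup_deep:
  obtains N where "\<And>i j. (i, j) \<in> filtration N \<Longrightarrow>
    (\<exists>i' j'. (i', j') \<in> semigroup \<and> ((i, j) = (i' + d * n, j') \<or> (i, j) = (i', j' + d * n)))"
proof -
  obtain F where F: "finite F" "F \<subseteq> semigroup"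
    "\<And>i j. (i, j) \<in> semigroup \<Longrightarrow> \<exists>a b k l. (a, b) \<in> F \<and> i = a + d * k \<and> j = b + d * l"
    using dickson_mod[OF d_pos, of semigroup] by metis
  have "finite ((\<lambda>(a, b). a + b) ` F)" using F(1) by blast
  then obtain D where "\<forall>x\<in>(\<lambda>(a, b). a + b) ` F. x \<le> D" unfolding finite_nat_set_iff_bounded_le by blast
  then have D: "a + b \<le> D" if "(a, b) \<in> F" for a b using that by auto
  show ?thesis
  proof (rule that[of "2 * n + D"])
    fix i j assume ij: "(i, j) \<in> filtration (2 * n + D)"
    then obtain a b k l where ab: "(a, b) \<in> F" "i = a + d * k" "j = b + d * l"
      using F(3)[of i j] unfolding filtration_def by blast
    have "D \<le> d * D" using d_pos by simp
    moreover have "d * (2 * n + D) \<le> (a + b) + d * (k + l)" using ij ab by (simp add: filtration_def algebra_simps)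
    ultimately have "d * (2 * n) \<le> d * (k + l)" using D[OF ab(1)] unfolding distrib_left by linarith
    then have "2 * n \<le> k + l" using d_pos by simp
    then consider "n \<le> k" | "n \<le> l" by linarith
    then show "\<exists>i' j'. (i', j') \<in> semigroup \<and> ((i, j) = (i' + d * n, j') \<or> (i, j) = (i', j' + d * n))"
    proof cases
      case 1
      then obtain e where "k = n + e" by (auto simp: le_iff_add)
      then have "i = a + d * e + d * n" using ab(2) by (simp add: distrib_left)
      moreover have "(a + d * e, b + d * l) \<in> semigroup" using ab(1) F(2) by (intro semigroup_shift) auto
      ultimately show ?thesis using ab(3) by blast
    next
      case 2
      then obtain e where "l = n + e" by (auto simp: le_iff_add)
      then have "j = b + d * e + d * n" using ab(3) by (simp add: distrib_left)
      moreover have "(a + d * k, b + d * e) \<in> semigroup" using ab(1) F(2) by (intro semigroup_shift) auto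
      ultimately show ?thesis using ab(2) by blast
    qed
  qed
qed

text \<open>Powers of the irrelevant ideal and the two elements \<open>u\<close>, \<open>v\<close> define the same ideal transform, because
  a monomial of large degree is divisible by \<open>u\<^sup>n\<close> or by \<open>v\<^sup>n\<close> within the coordinate ring.\<close>

lemma ideal_transform_eq: "ideal_transform curve_ring irrelevant_ideal = saturated_ring"
proof (intro equalityI subsetI)
  fix q assume "q \<in> ideal_transform curve_ring irrelevant_ideal"
  then obtain n where "\<And>m. m \<in> ideal_pow curve_ring irrelevant_ideal n \<Longrightarrow> m * q \<in> curve_ring"
    by (auto simp: ideal_transform_def)
  then show "q \<in> saturated_ring"
    unfolding saturated_ring_iff
    using power_in_ideal_pow[OF subring_curve_ring irrelevant_ideal_ideal uv_in_irrelevant_ideal(1)]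
      power_in_ideal_pow[OF subring_curve_ring irrelevant_ideal_ideal uv_in_irrelevant_ideal(2)] by blast
next
  fix q assume "q \<in> saturated_ring"
  then obtain n where n: "u ^ n * q \<in> curve_ring" "v ^ n * q \<in> curve_ring" using saturated_ring_iff by blast
  obtain N where N: "\<And>i j. (i, j) \<in> filtration N \<Longrightarrow>
    (\<exists>i' j'. (i', j') \<in> semigroup \<and> ((i, j) = (i' + d * n, j') \<or> (i, j) = (i', j' + d * n)))"
    using semigroup_deep by blast
  note RD = subring_setD[OF subring_curve_ring]
  have "m * q \<in> curve_ring" if m: "m \<in> ideal_pow curve_ring irrelevant_ideal N" for m
  proof -
    obtain f where f: "m = to_fraction f" "f \<in> span_monomials (filtration N)"
      using m ideal_pow_le_filtration by blast
    have "to_fraction f * q \<in> curve_ring" using f(2)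
    proof (induction rule: span_monomials_induct)
      case zero
      then show ?case by (simp add: RD)
    next
      case (add f g)
      then show ?case by (simp add: distrib_right RD)
    next
      case (monomial i j c)
      then obtain i' j' where ij: "(i', j') \<in> semigroup" "(i, j) = (i' + d * n, j') \<or> (i, j) = (i', j' + d * n)"
        using N by blast
      have "cst c * mon i' j' \<in> curve_polys" using ij(1) by (intro span_monomials_cst_mult) simp
      then have h: "to_fraction (cst c * mon i' j') \<in> curve_ring" by (simp add: curve_ring_def del: to_fraction_hom(2))
      have "to_fraction (mon i j) = to_fraction (mon i' j') * to_fraction (mon (d * n) 0) \<or>
          to_fraction (mon i j) = to_fraction (mon i' j') * to_fraction (mon 0 (d * n))"
        using ij(2) by (auto simp: mon_mult simp flip: to_fraction_hom(2))
      then have "to_fraction (cst c * mon i j) * q = to_fraction (cst c * mon i' j') * (u ^ n * q) \<or>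
          to_fraction (cst c * mon i j) * q = to_fraction (cst c * mon i' j') * (v ^ n * q)"
        unfolding uv_power by (auto simp: mult.assoc)
      then show ?case using RD(5)[OF h n(1)] RD(5)[OF h n(2)] by metis
    qed
    then show ?thesis by (simp add: f)
  qed
  then show "q \<in> ideal_transform curve_ring irrelevant_ideal" by (auto simp: ideal_transform_def)
qed

section \<open>Primary components\<close>

lemma curve_ring_mod_irrelevant_ideal:
  assumes "x \<in> curve_ring"
  shows "\<exists>c. x - to_fraction (cst c) \<in> irrelevant_ideal"
proof -
  note MD = ideal_ring_onD[OF subring_curve_ring irrelevant_ideal_ideal]
  obtain f where f: "x = to_fraction f" "f \<in> curve_polys" using assms by (auto simp: curve_ring_def)
  have "\<exists>c. to_fraction f - to_fraction (cst c) \<in> irrelevant_ideal" using f(2)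
  proof (induction rule: span_monomials_induct)
    case zero
    then show ?case using MD(2) by (intro exI[of _ 0]) simp
  next
    case (add f g)
    then obtain a b where "to_fraction f - to_fraction (cst a) \<in> irrelevant_ideal"
      "to_fraction g - to_fraction (cst b) \<in> irrelevant_ideal" by blast
    then have "(to_fraction f - to_fraction (cst a)) + (to_fraction g - to_fraction (cst b)) \<in> irrelevant_ideal"
      by (rule MD(3))
    then show ?case by (intro exI[of _ "a + b"]) (simp add: cst_add algebra_simps)
  next
    case (monomial i j c)
    then show ?case
    proof (cases rule: semigroup.cases)
      case zero
      then show ?thesis using MD(2) by (intro exI[of _ c]) (simp add: mon_0_0)
    next
      case (add i' j' a b)
      have "cst c * mon i' j' \<in> curve_polys" using add(3) by (intro span_monomials_cst_mult) simp
      then have "to_fraction (cst c * mon i' j') \<in> curve_ring"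
        by (simp add: curve_ring_def del: to_fraction_hom(2))
      then have "to_fraction (cst c * mon i' j') * to_fraction (mon a b) \<in> irrelevant_ideal"
        by (rule MD(4)) (rule generator_in_irrelevant_ideal[OF add(4)])
      moreover have "cst c * mon i' j' * mon a b = cst c * mon i j"
        using add(1,2) by (simp add: mult.assoc mon_mult add.commute)
      ultimately have "to_fraction (cst c * mon i j) \<in> irrelevant_ideal" by (metis to_fraction_hom(2))
      then show ?thesis by (intro exI[of _ 0]) simp
    qed
  qed
  then show ?thesis by (simp add: f)
qed

text \<open>The \<open>d\<close>-th power of the generator \<open>s\<^sup>i t\<^sup>j\<close> is \<open>u\<^sup>i v\<^sup>j\<close>, so a radical containing \<open>u\<close> and \<open>v\<close> contains the
  irrelevant ideal; and the latter is maximal.\<close>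

lemma radical_eq_irrelevant_ideal:
  assumes Q: "ideal Q (ring_on curve_ring)" "Q \<noteq> curve_ring"
    and uv: "u \<in> ideal_radical (ring_on curve_ring) Q" "v \<in> ideal_radical (ring_on curve_ring) Q"
  shows "ideal_radical (ring_on curve_ring) Q = irrelevant_ideal"
proof
  define P where "P = ideal_radical (ring_on curve_ring) Q"
  have P: "ideal P (ring_on curve_ring)" unfolding P_def by (rule ideal_radical_ideal[OF subring_curve_ring Q(1)])
  note PD = ideal_ring_onD[OF subring_curve_ring P] and RD = subring_setD[OF subring_curve_ring]
  have radical: "x \<in> P" if "x \<in> curve_ring" "x ^ n \<in> P" for x n
  proof -
    from that(2) obtain k where "(x ^ n) ^ k \<in> Q" by (auto simp: P_def ideal_radical_ring_on)
    then have "x ^ (n * k) \<in> Q" by (simp add: power_mult)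
    then show ?thesis using that(1) by (auto simp: P_def ideal_radical_ring_on)
  qed
  have "to_fraction (mon i j) \<in> P" if ij: "(i, j) \<in> generators" for i j
  proof (rule radical)
    show R: "to_fraction (mon i j) \<in> curve_ring" using generators_in_curve_ring ij by blast
    have "mon i j ^ d = mon (d * i) 0 * mon 0 (d * j)" by (simp add: mon_power mon_mult)
    then have eq: "to_fraction (mon i j) ^ d = u ^ i * v ^ j"
      by (simp add: uv_power flip: to_fraction_hom(2) to_fraction_power)
    have "0 < i \<or> 0 < j" using ij d_pos r_range by (auto simp: generators_def)
    then obtain k where "i = Suc k \<or> j = Suc k" by (metis gr0_conv_Suc)
    then have "u ^ i * v ^ j = (u ^ k * v ^ j) * u \<or> u ^ i * v ^ j = (u ^ i * v ^ k) * v" by auto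
    then show "to_fraction (mon i j) ^ d \<in> P"
      unfolding eq using PD(4) uv RD(5,7) u_in_curve_ring v_in_curve_ring unfolding P_def by metis
  qed
  then show sub: "irrelevant_ideal \<subseteq> ideal_radical (ring_on curve_ring) Q"
    unfolding irrelevant_ideal_eq P_def[symmetric]
    by (intro Idl_ring_on(3)[OF subring_curve_ring generators_in_curve_ring P]) auto
  show "ideal_radical (ring_on curve_ring) Q \<subseteq> irrelevant_ideal"
    unfolding P_def[symmetric]
  proof
    fix x assume x: "x \<in> P"
    then obtain c where c: "x - to_fraction (cst c) \<in> irrelevant_ideal"
      using curve_ring_mod_irrelevant_ideal PD(1) by blast
    have "x - (x - to_fraction (cst c)) \<in> P"
      by (rule PD(5)[OF x]) (use c sub in \<open>auto simp: P_def\<close>)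
    then have cP: "to_fraction (cst c) \<in> P" by simp
    have "c = 0"
    proof (rule ccontr)
      assume "c \<noteq> 0"
      then have "cst (inverse c) * cst c = 1" by (simp flip: cst_mult)
      then have "to_fraction (cst (inverse c)) * to_fraction (cst c) = 1"
        by (metis to_fraction_hom(2,5))
      moreover have "to_fraction (cst (inverse c)) \<in> curve_ring"
        using subalgebraD(1)[OF subalgebra_curve_polys] by (simp add: curve_ring_def)
      ultimately have "1 \<in> P" using PD(4)[OF _ cP] by metis
      then have "1 \<in> Q" by (simp add: P_def ideal_radical_ring_on)
      then have "Q = curve_ring" using ideal.one_imp_carrier[OF Q(1)] by simp
      then show False using Q(2) by blast
    qed
    then show "x \<in> irrelevant_ideal" using c by simp
  qed
qed

text \<open>A component whose radical is not the irrelevant ideal misses \<open>u\<close> or \<open>v\<close> in its radical, and therefore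
  allows cancelling powers of that element. The other components contain powers of both \<open>u\<close> and \<open>v\<close> and
  impose no condition after multiplication by these.\<close>

lemma components_away_eq:
  assumes a: "a \<in> curve_ring" and dec: "primary_decomposition (ring_on curve_ring) (PIdl\<^bsub>ring_on curve_ring\<^esub> a) Qs"
  shows "components_away (ring_on curve_ring) irrelevant_ideal Qs =
    {x \<in> curve_ring. \<exists>n. u ^ n * x \<in> PIdl\<^bsub>ring_on curve_ring\<^esub> a \<and> v ^ n * x \<in> PIdl\<^bsub>ring_on curve_ring\<^esub> a}"
proof -
  define I where "I = PIdl\<^bsub>ring_on curve_ring\<^esub> a"
  have Qs: "finite Qs" "\<And>Q. Q \<in> Qs \<Longrightarrow> primary_ideal (ring_on curve_ring) Q" "I = curve_ring \<inter> \<Inter>Qs"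
    using dec by (auto simp: primary_decomposition_def I_def)
  have Qideal: "ideal Q (ring_on curve_ring)" "Q \<noteq> curve_ring"
    and primary: "\<And>x y. x \<in> curve_ring \<Longrightarrow> y \<in> curve_ring \<Longrightarrow> x * y \<in> Q \<Longrightarrow>
      x \<in> Q \<or> y \<in> ideal_radical (ring_on curve_ring) Q" if "Q \<in> Qs" for Q
    using Qs(2)[OF that] by (auto simp: primary_ideal_def)
  note RD = subring_setD[OF subring_curve_ring]
  have away: "x \<in> Q" if x: "x \<in> curve_ring" and n: "u ^ n * x \<in> I" "v ^ n * x \<in> I"
    and Q: "Q \<in> Qs" "ideal_radical (ring_on curve_ring) Q \<noteq> irrelevant_ideal" for x n Q
  proof -
    have "\<exists>w\<in>{u, v}. w \<notin> ideal_radical (ring_on curve_ring) Q"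
      using radical_eq_irrelevant_ideal[OF Qideal[OF Q(1)]] Q(2) by blast
    then obtain w where w: "w \<in> {u, v}" "w \<notin> ideal_radical (ring_on curve_ring) Q" by blast
    have wR: "w \<in> curve_ring" using w u_in_curve_ring v_in_curve_ring by blast
    have "x * w ^ n \<in> Q" using w(1) n Q(1) Qs(3) by (auto simp: mult.commute)
    then have "x \<in> Q \<or> w ^ n \<in> ideal_radical (ring_on curve_ring) Q"
      using primary[OF Q(1) x] RD(7)[OF wR] by blast
    moreover have "w \<in> ideal_radical (ring_on curve_ring) Q" if "w ^ n \<in> ideal_radical (ring_on curve_ring) Q"
    proof -
      from that obtain k where "(w ^ n) ^ k \<in> Q" by (auto simp: ideal_radical_ring_on)
      then have "w ^ (n * k) \<in> Q" by (simp add: power_mult)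
      then show ?thesis using wR by (auto simp: ideal_radical_ring_on)
    qed
    ultimately show ?thesis using w(2) by blast
  qed
  have powers: "\<exists>n. u ^ n * x \<in> I \<and> v ^ n * x \<in> I"
    if x: "x \<in> curve_ring" "\<And>Q. Q \<in> Qs \<Longrightarrow> ideal_radical (ring_on curve_ring) Q \<noteq> irrelevant_ideal \<Longrightarrow> x \<in> Q" for x
  proof -
    have *: "\<exists>n. \<forall>k\<ge>n. u ^ k * x \<in> Q \<and> v ^ k * x \<in> Q" if Q: "Q \<in> Qs" for Q
    proof -
      note QD = ideal_ring_onD[OF subring_curve_ring Qideal(1)[OF Q]]
      show ?thesis
      proof (cases "ideal_radical (ring_on curve_ring) Q = irrelevant_ideal")
        case False
        then show ?thesis using x Q QD(4) RD(7)[OF u_in_curve_ring] RD(7)[OF v_in_curve_ring] by blast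
      next
        case True
        then have "u \<in> ideal_radical (ring_on curve_ring) Q" "v \<in> ideal_radical (ring_on curve_ring) Q"
          using uv_in_irrelevant_ideal by simp_all
        then obtain m n where mn: "u ^ m \<in> Q" "v ^ n \<in> Q"
          by (auto simp: ideal_radical_ring_on)
        have "w ^ k * x \<in> Q" if "w ^ l \<in> Q" "l \<le> k" "w \<in> curve_ring" for w k l
        proof -
          have "w ^ k * x = (w ^ (k - l) * x) * w ^ l"
            using that(2) by (simp add: power_add[symmetric] mult.commute mult.left_commute)
          then show ?thesis using QD(4)[OF _ that(1)] RD(5,7) that(3) x(1) by metis
        qed
        then show ?thesis using mn u_in_curve_ring v_in_curve_ring
          by (intro exI[of _ "max m n"]) auto
      qed
    qed
    have "\<exists>n. \<forall>Q\<in>Qs. \<forall>k\<ge>n. u ^ k * x \<in> Q \<and> v ^ k * x \<in> Q"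
      using Qs(1) *
    proof (induction Qs)
      case (insert Q Qs)
      obtain m where "\<forall>k\<ge>m. u ^ k * x \<in> Q \<and> v ^ k * x \<in> Q" using insert.prems by blast
      moreover obtain n where "\<forall>Q\<in>Qs. \<forall>k\<ge>n. u ^ k * x \<in> Q \<and> v ^ k * x \<in> Q" using insert by blast
      ultimately show ?case by (intro exI[of _ "max m n"]) auto
    qed simp
    then obtain n where "\<forall>Q\<in>Qs. u ^ n * x \<in> Q \<and> v ^ n * x \<in> Q" by blast
    then have "u ^ n * x \<in> I \<and> v ^ n * x \<in> I"
      unfolding Qs(3) using RD(5)[OF RD(7)[OF u_in_curve_ring] x(1)] RD(5)[OF RD(7)[OF v_in_curve_ring] x(1)]
      by auto
    then show ?thesis by blast
  qed
  show ?thesis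
    unfolding components_away_def I_def[symmetric] using away powers by auto
qed

lemma transform_by_components:
  assumes a: "a \<in> curve_ring" "a \<noteq> 0" and ann: "\<And>q. q \<in> saturated_ring \<Longrightarrow> a * q \<in> curve_ring"
    and dec: "primary_decomposition (ring_on curve_ring) (PIdl\<^bsub>ring_on curve_ring\<^esub> a) Qs"
  shows "{q \<in> total_quotients curve_ring. \<exists>x\<in>components_away (ring_on curve_ring) irrelevant_ideal Qs. q = x / a} = saturated_ring"
  unfolding components_away_eq[OF a(1) dec] PIdl_ring_on
proof (intro equalityI subsetI)
  fix q assume "q \<in> {q \<in> total_quotients curve_ring. \<exists>x\<in>{x \<in> curve_ring. \<exists>n.
      u ^ n * x \<in> {y * a | y. y \<in> curve_ring} \<and> v ^ n * x \<in> {y * a | y. y \<in> curve_ring}}. q = x / a}"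
  then obtain x n y z where q: "q = x / a" "u ^ n * x = y * a" "v ^ n * x = z * a" "y \<in> curve_ring" "z \<in> curve_ring"
    by blast
  have "u ^ n * q = (u ^ n * x) / a" "v ^ n * q = (v ^ n * x) / a" by (simp_all add: q(1))
  then have "u ^ n * q = y" "v ^ n * q = z" unfolding q(2,3) using a(2) by simp_all
  then show "q \<in> saturated_ring" unfolding saturated_ring_iff
    using \<open>y \<in> curve_ring\<close> \<open>z \<in> curve_ring\<close> by blast
next
  fix q assume q: "q \<in> saturated_ring"
  then obtain n where n: "u ^ n * q \<in> curve_ring" "v ^ n * q \<in> curve_ring" using saturated_ring_iff by blast
  have aq: "a * q \<in> curve_ring" by (rule ann[OF q])
  have "q = (a * q) / a" using a(2) by simp
  moreover have "u ^ n * (a * q) = (u ^ n * q) * a" "v ^ n * (a * q) = (v ^ n * q) * a"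
    by (simp_all add: algebra_simps)
  ultimately show "q \<in> {q \<in> total_quotients curve_ring. \<exists>x\<in>{x \<in> curve_ring. \<exists>n.
      u ^ n * x \<in> {y * a | y. y \<in> curve_ring} \<and> v ^ n * x \<in> {y * a | y. y \<in> curve_ring}}. q = x / a}"
    using aq a n unfolding total_quotients_def by blast
qed

section \<open>The saturated ring is the Macaulayfication\<close>

text \<open>Ideals of the saturated ring are submodules over \<open>K[s\<^sup>d, t\<^sup>d]\<close>.\<close>

lemma noetherian_saturated_ring: "noetherian_ring (ring_on (saturated_ring :: 'k poly poly fract set))"
proof (rule ring.noetherian_ringI)
  let ?S = "saturated_ring :: 'k poly poly fract set"
  note S = subring_saturated_ring
  show "ring (ring_on ?S)" using cring_ring_on[OF S] by (simp add: cring_def)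
  have pre: "power_submodule d {f \<in> saturated_polys. to_fraction f \<in> I}" if I: "ideal I (ring_on ?S)" for I
  proof -
    note ID = ideal_ring_onD[OF S I]
    note SD = subalgebraD[OF subalgebra_saturated_polys] subalgebra_0[OF subalgebra_saturated_polys]
    have mult: "h * f \<in> {f \<in> saturated_polys. to_fraction f \<in> I}"
      if "h \<in> saturated_polys" "f \<in> {f \<in> saturated_polys. to_fraction f \<in> I}" for h f
      using that SD(3) ID(4)[of "to_fraction h" "to_fraction f"] by (auto simp: saturated_ring_def)
    show ?thesis
      unfolding power_submodule_def
    proof (intro conjI ballI allI)
      show "mon d 0 * f \<in> {f \<in> saturated_polys. to_fraction f \<in> I}"
        "mon 0 d * f \<in> {f \<in> saturated_polys. to_fraction f \<in> I}"
        if "f \<in> {f \<in> saturated_polys. to_fraction f \<in> I}" for f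
        using that d_exponents_in_saturation by (intro mult; simp)+
    next
      show "cst c * f \<in> {f \<in> saturated_polys. to_fraction f \<in> I}"
        if "f \<in> {f \<in> saturated_polys. to_fraction f \<in> I}" for c f
        using that SD(1) by (intro mult)
    next
      show "f + g \<in> {f \<in> saturated_polys. to_fraction f \<in> I}"
        if "f \<in> {f \<in> saturated_polys. to_fraction f \<in> I}" "g \<in> {f \<in> saturated_polys. to_fraction f \<in> I}"
        for f g
        using that SD(2)[of f g] ID(3)[of "to_fraction f" "to_fraction g"] by simp
    qed (use SD ID in simp)
  qed
  fix I assume I: "ideal I (ring_on ?S)"
  define I' where "I' = {f \<in> saturated_polys. to_fraction f \<in> I}"
  have "power_submodule d I'" unfolding I'_def by (rule pre[OF I])
  then obtain G where G: "finite G" "G \<subseteq> I'" "\<And>J. power_submodule d J \<Longrightarrow> G \<subseteq> J \<Longrightarrow> I' \<subseteq> J"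
    using power_submodule_fg[OF d_pos, of I'] by metis
  have GS: "to_fraction ` G \<subseteq> ?S" using G(2) by (auto simp: saturated_ring_def I'_def)
  note Idl = Idl_ring_on[OF S GS]
  have "G \<subseteq> {f \<in> saturated_polys. to_fraction f \<in> Idl\<^bsub>ring_on ?S\<^esub> (to_fraction ` G)}"
    using G(2) Idl(2) by (auto simp: I'_def)
  then have "I' \<subseteq>
      {f \<in> saturated_polys. to_fraction f \<in> Idl\<^bsub>ring_on ?S\<^esub> (to_fraction ` G)}"
    by (rule G(3)[OF pre[OF Idl(1)]])
  then have "I \<subseteq> Idl\<^bsub>ring_on ?S\<^esub> (to_fraction ` G)"
    using ideal_ring_onD(1)[OF S I] by (auto simp: saturated_ring_def I'_def)
  moreover have "Idl\<^bsub>ring_on ?S\<^esub> (to_fraction ` G) \<subseteq> I" using G(2) by (intro Idl(3)[OF I]) (auto simp: I'_def)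
  ultimately show "\<exists>A\<subseteq>carrier (ring_on ?S). finite A \<and> I = Idl\<^bsub>ring_on ?S\<^esub> A"
    using G(1) GS by (intro exI[of _ "to_fraction ` G"]) auto
qed

text \<open>The maximal ideal contains a nonzero \<open>f(s\<^sup>d)\<close> and a nonzero \<open>g(t\<^sup>d)\<close>, which form a regular sequence.\<close>

lemma depth_eq_height_saturated_ring:
  fixes P :: "'k poly poly fract set"
  assumes P: "maximalideal P (ring_on saturated_ring)"
  shows "ideal_depth (ring_on saturated_ring) P = prime_height (ring_on saturated_ring) P"
proof -
  let ?S = "saturated_ring :: 'k poly poly fract set"
  note S = subring_saturated_ring
  note PD = maximalideal_ring_onD[OF S P]
  note ID = ideal_ring_onD[OF S PD(1)]
  define P' where "P' = {f \<in> saturated_polys. to_fraction f \<in> P}"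
  have max: "max_ideal saturated_polys P'"
    unfolding max_ideal_def
  proof (intro conjI ballI)
    show "P' \<subseteq> saturated_polys" "1 \<notin> P'" using PD(2) by (auto simp: P'_def)
  next
    fix f g assume f: "f \<in> P'" and g: "g \<in> P'"
    then show "f + g \<in> P'" using ID(3) by (auto simp: P'_def intro: span_monomials_add)
  next
    fix f g :: "'k poly poly" assume f: "f \<in> P'" and g: "g \<in> saturated_polys"
    then have "to_fraction g * to_fraction f \<in> P" by (intro ID(4)) (auto simp: P'_def saturated_ring_def)
    then show "g * f \<in> P'" using f g subalgebraD(3)[OF subalgebra_saturated_polys] by (auto simp: P'_def)
  next
    fix f assume f: "f \<in> saturated_polys - P'"
    then have "to_fraction f \<in> ?S" "to_fraction f \<notin> P" by (auto simp: P'_def saturated_ring_def)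
    then obtain g where g: "g \<in> saturated_polys" "1 - to_fraction f * to_fraction g \<in> P"
      using PD(4) by (auto simp: saturated_ring_def)
    have "1 + - (f * g) \<in> saturated_polys"
      using f g(1) subalgebra_saturated_polys
      by (intro subalgebraD(2) subalgebra_1 subalgebra_uminus subalgebraD(3)) auto
    moreover have "to_fraction (1 + - (f * g)) \<in> P" using g(2) by (simp del: add_uminus_conv_diff) (simp)
    ultimately have "1 + - (f * g) \<in> P'" by (simp only: P'_def mem_Collect_eq)
    then show "\<exists>g\<in>saturated_polys. 1 - f * g \<in> P'" using g(1) by (intro bexI[of _ g]) simp_all
  qed
  have uv: "mon d 0 \<in> saturated_polys" "mon 0 d \<in> saturated_polys"
    using d_exponents_in_saturation by simp_all
  obtain f where f: "f \<noteq> 0" "eval1 (mon d 0) f \<in> P'"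
    using max_ideal_contains_eval1[OF d_pos subalgebra_saturated_polys max uv] by blast
  obtain g where g: "g \<noteq> 0" "eval1 (mon 0 d) g \<in> P'"
    using max_ideal_contains_eval1[OF d_pos subalgebra_saturated_polys max uv(2,1)] by blast
  have reg: "\<exists>w\<in>?S. y = w * to_fraction (eval1 (mon d 0) f)"
    if "y \<in> ?S" "z \<in> ?S" "to_fraction (eval1 (mon 0 d) g) * y = z * to_fraction (eval1 (mon d 0) f)" for y z
  proof -
    obtain y' z' where yz: "y = to_fraction y'" "z = to_fraction z'" "y' \<in> saturated_polys" "z' \<in> saturated_polys"
      using \<open>y \<in> ?S\<close> \<open>z \<in> ?S\<close> by (auto simp: saturated_ring_def)
    then have "to_fraction (eval1 (mon 0 d) g * y') = to_fraction (z' * eval1 (mon d 0) f)" using that(3) by simp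
    then have "eval1 (mon 0 d) g * y' = z' * eval1 (mon d 0) f" by (simp only: to_fraction_hom(6))
    then obtain w where "w \<in> saturated_polys" "y' = w * eval1 (mon d 0) f"
      using saturated_polys_regular[OF f(1) g(1) yz(3,4)] by blast
    then show ?thesis by (intro bexI[of _ "to_fraction w"]) (auto simp: yz saturated_ring_def)
  qed
  have "krull_dim_le_2 ?S"
    unfolding saturated_ring_def by (rule krull_dim_to_fraction[OF subalgebra_saturated_polys])
  moreover have "to_fraction (eval1 (mon d 0) f) \<in> P" "to_fraction (eval1 (mon 0 d) g) \<in> P"
    using f g by (auto simp: P'_def)
  moreover have "to_fraction (eval1 (mon d 0) f) \<noteq> 0" using eval1_nonzero[OF f(1), of d 0] d_pos by simp
  ultimately show ?thesis
    using depth_and_height_eq_2[OF S _ PD(3), of "to_fraction (eval1 (mon d 0) f)" "to_fraction (eval1 (mon 0 d) g)"]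
      reg by metis
qed

lemma cohen_macaulay_saturated_ring: "cohen_macaulay (ring_on saturated_ring)"
  unfolding cohen_macaulay_def
  using cring_ring_on[OF subring_saturated_ring] noetherian_saturated_ring depth_eq_height_saturated_ring by blast

text \<open>A strict chain of \<open>n\<close> submodules of the quotient yields \<open>n\<close> linearly independent vectors in the
  finite-dimensional space that complements the coordinate ring: one new vector for each step, chosen modulo the
  coordinate ring.\<close>

lemma finite_length:
  "module_length (ring_on (curve_ring :: 'k poly poly fract set))
    (quotient_module (ring_module (ring_on saturated_ring)) curve_ring) \<noteq> \<infinity>"
proof -
  let ?R = "curve_ring :: 'k poly poly fract set" and ?S = "saturated_ring :: 'k poly poly fract set"
  let ?M = "ring_module (ring_on ?S)"
  let ?Q = "quotient_module ?M ?R"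
  have M: "module (ring_on ?R) ?M"
    by (rule ring_module_is_module[OF subring_curve_ring subring_saturated_ring curve_ring_subset])
  have N: "submodule ?R (ring_on ?R) ?M"
    by (rule ring_module_submoduleI[OF subring_curve_ring subring_saturated_ring curve_ring_subset curve_ring_subset])
      (rule subring_setD[OF subring_curve_ring]; assumption)+
  obtain B :: "'k poly poly set" where B: "finite B"
    "\<And>f. f \<in> saturated_polys \<Longrightarrow> \<exists>h\<in>curve_polys. \<exists>v\<in>poly_space.span B. f = h + v"
    using saturated_polys_mod_curve_polys by blast
  define coset where "coset f = ?R +>\<^bsub>?M\<^esub> to_fraction f" for f
  have inS: "to_fraction f \<in> carrier ?M" if "f \<in> saturated_polys" for f
    using that by (simp add: saturated_ring_def)
  have "module_length (ring_on ?R) ?Q \<le> enat (card B)"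
    unfolding module_length_def
  proof (rule Sup_least, clarify)
    fix n and c :: "nat \<Rightarrow> 'k poly poly fract set set"
    assume sub: "\<forall>i\<le>n. submodule (c i) (ring_on ?R) ?Q" and chain: "\<forall>i<n. c i \<subset> c (Suc i)"
    define D where "D i = {f \<in> saturated_polys. coset f \<in> c i}" for i
    have Dcurve: "curve_polys \<subseteq> D i" if "i \<le> n" for i
    proof
      fix f :: "'k poly poly" assume f: "f \<in> curve_polys"
      have "\<zero>\<^bsub>?Q\<^esub> \<in> c i"
        using subgroup.one_closed[OF submodule.axioms(1)] sub that by fastforce
      moreover have "coset f = ?R"
        unfolding coset_def using coset_eq_zero_iff[OF M N inS, of f] f curve_polys_subset
        by (auto simp: curve_ring_def)
      ultimately show "f \<in> D i" using f curve_polys_subset by (auto simp: D_def)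
    qed
    have Dadd: "f + g \<in> D i" if "i \<le> n" "f \<in> D i" "g \<in> D i" for i f g
    proof -
      have "coset f \<oplus>\<^bsub>?Q\<^esub> coset g \<in> c i"
        using subgroup.m_closed[OF submodule.axioms(1), of "c i" "ring_on ?R" ?Q] sub that by (auto simp: D_def)
      moreover have "coset f \<oplus>\<^bsub>?Q\<^esub> coset g = coset (f + g)"
        unfolding coset_def using quotient_module_add[OF M N inS inS, of f g] that by (auto simp: D_def)
      ultimately show ?thesis using that by (auto simp: D_def intro: span_monomials_add)
    qed
    have Dscale: "cst k * f \<in> D i" if "i \<le> n" "f \<in> D i" for i f k
    proof -
      have k: "to_fraction (cst k) \<in> ?R" using subalgebraD(1)[OF subalgebra_curve_polys] by (simp add: curve_ring_def)
      have "to_fraction (cst k) \<odot>\<^bsub>?Q\<^esub> coset f \<in> c i"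
        using submodule.smult_closed[of "c i" "ring_on ?R" ?Q "to_fraction (cst k)" "coset f"] sub that k
        by (auto simp: D_def)
      moreover have "to_fraction (cst k) \<odot>\<^bsub>?Q\<^esub> coset f = coset (cst k * f)"
        unfolding coset_def using quotient_module_smult[OF M N inS, of f "to_fraction (cst k)"] that k by (auto simp: D_def)
      ultimately show ?thesis using that by (auto simp: D_def intro: span_monomials_cst_mult)
    qed
    have Dsub: "poly_space.subspace (D i)" if "i \<le> n" for i
      unfolding poly_space.subspace_def using Dcurve[OF that] Dadd[OF that] Dscale[OF that] by auto
    \<comment> \<open>A witness of \<open>c i \<subset> c (Suc i)\<close>, corrected by an element of the coordinate ring, lies in the span of \<open>B\<close>.\<close>
    have "\<exists>v. v \<in> poly_space.span B \<and> v \<in> D (Suc i) \<and> v \<notin> D i" if i: "i < n" for i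
    proof -
      obtain X where X: "X \<in> c (Suc i)" "X \<notin> c i" using chain i by blast
      have "X \<in> carrier ?Q"
        using X(1) subgroup.subset[OF submodule.axioms(1), of "c (Suc i)" "ring_on ?R" ?Q] sub i by auto
      then obtain f where f: "f \<in> saturated_polys" "X = coset f"
        unfolding quotient_module_carrier by (auto simp: saturated_ring_def coset_def)
      obtain h v where hv: "h \<in> curve_polys" "v \<in> poly_space.span B" "f = h + v" using B(2)[OF f(1)] by blast
      have fD: "f \<in> D (Suc i)" "f \<notin> D i" using X f by (auto simp: D_def)
      have "h \<in> D (Suc i)" "h \<in> D i" using Dcurve[of i] Dcurve[of "Suc i"] i hv(1) by auto
      then have "f - h \<in> D (Suc i)" using Dsub[of "Suc i"] i fD by (intro poly_space.subspace_diff) auto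
      moreover have "v \<notin> D i" using Dadd[of i h v] \<open>h \<in> D i\<close> i fD hv(3) by auto
      ultimately show ?thesis using hv by auto
    qed
    then obtain v where v: "\<And>i. i < n \<Longrightarrow> v i \<in> poly_space.span B" "\<And>i. i < n \<Longrightarrow> v i \<in> D (Suc i)"
      "\<And>i. i < n \<Longrightarrow> v i \<notin> D i" by metis
    have mono: "D i \<subseteq> D j" if "i \<le> j" "j \<le> n" for i j
    proof -
      have "c i \<subseteq> c j" using that
      proof (induction rule: dec_induct)
        case (step k)
        then have "c k \<subset> c (Suc k)" using chain by simp
        then show ?case using step by auto
      qed simp
      then show ?thesis by (auto simp: D_def)
    qed
    have "k \<le> n \<Longrightarrow> poly_space.independent (v ` {..<k}) \<and> card (v ` {..<k}) = k" for k
    proof (induction k)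
      case (Suc k)
      have "v ` {..<k} \<subseteq> D k" using v(2) mono[of _ k] Suc.prems by (fastforce simp: less_eq_Suc_le)
      then have "poly_space.span (v ` {..<k}) \<subseteq> D k"
        using Dsub[of k] Suc.prems by (intro poly_space.span_minimal) auto
      then have notin: "v k \<notin> poly_space.span (v ` {..<k})" using v(3)[of k] Suc.prems by auto
      then have "v k \<notin> v ` {..<k}" using poly_space.span_base[of "v k" "v ` {..<k}"] by argo
      then show ?case using Suc notin by (simp add: lessThan_Suc poly_space.independent_insertI)
    qed (simp add: poly_space.independent_empty)
    from this[of n] have "poly_space.independent (v ` {..<n})" "card (v ` {..<n}) = n" by auto
    then show "enat n \<le> enat (card B)"
      using poly_space.independent_span_bound[OF B(1), of "v ` {..<n}"] v(1) by auto
  qed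
  then show ?thesis by (metis enat_ord_code(5) infinity_ileE)
qed

end

section \<open>The Macaulayfication computes local cohomology\<close>

theorem theorem4p4:
  fixes d p :: nat and r :: "nat \<Rightarrow> nat"
    and R Rt :: "'k::field poly poly fract ring"
    and MM C :: "'k poly poly fract set"
    and a :: "'k poly poly fract"
    and Qs :: "'k poly poly fract set set"
    and \<epsilon> :: "'k poly poly fract \<Rightarrow> 'e"
    and E :: "nat \<Rightarrow> ('k poly poly fract, 'e) module"
    and \<delta> :: "nat \<Rightarrow> 'e \<Rightarrow> 'e"
    and H1 :: "('k poly poly fract, 'e set) module"
  assumes r_range: "\<forall>i\<in>{1..p}. 0 < r i \<and> r i < d"
    and r_mono: "strict_mono_on {1..p} r"
    and gcd_one: "Gcd (insert d (r ` {1..p})) = 1"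
    and R: "R = monomial_curve_ring d p r"
    and MM: "MM = homogeneous_maximal_ideal d p r"
    and resolution: "injective_resolution R (ring_module R) \<epsilon> E \<delta>"
    and H1: "H1 = local_cohomology R MM E \<delta> 1"
    and a: "a \<in> carrier R" "a \<noteq> 0"
    and a_annihilates: "\<forall>h\<in>carrier H1. a \<odot>\<^bsub>H1\<^esub> h = \<zero>\<^bsub>H1\<^esub>"
    and decomposition: "primary_decomposition R (PIdl\<^bsub>R\<^esub> a) Qs"
    and C: "C = components_away R MM Qs"
    and Rt: "Rt = ring_on {q \<in> total_quotients (carrier R). \<exists>x\<in>C. q = x / a}"
  shows "module_iso R H1 (quotient_module (ring_module Rt) (carrier R)) \<and> macaulayfication R Rt"
proof -
  \<comment> \<open>For \<open>d = 0\<close> there is no room for any \<open>r i\<close>, and the gcd would be \<open>0\<close>.\<close>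
  have "d \<noteq> 0"
  proof
    assume "d = 0"
    then have "{1..p} = {}" using r_range by fastforce
    then show False using gcd_one \<open>d = 0\<close> by simp
  qed
  then interpret monomial_curve_over d p r "TYPE('k)" by unfold_locales (use r_range in auto)
  have R': "R = ring_on curve_ring" by (simp add: R monomial_curve_ring_eq)
  have MM': "MM = irrelevant_ideal" by (simp add: MM irrelevant_ideal_def)
  interpret ring_resolution "curve_ring :: 'k poly poly fract set" irrelevant_ideal \<epsilon> E \<delta> u
    by (rule ring_resolution.intro)
      (use subring_curve_ring irrelevant_ideal_ideal uv_in_irrelevant_ideal resolution subring_saturated_ring
       in \<open>simp_all add: R' ideal_transform_eq\<close>)
  have aR: "a \<in> curve_ring" using a(1) by (simp add: R')
  have ann: "a * q \<in> curve_ring" if "q \<in> saturated_ring" for q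
    using annihilator_local_cohomology_1[OF aR, of q] a_annihilates that by (simp add: H1 R' MM' ideal_transform_eq)
  have Rt': "Rt = ring_on saturated_ring"
    using transform_by_components[OF aR a(2) ann] decomposition by (simp add: Rt C R' MM')
  have "module_iso R H1 (quotient_module (ring_module Rt) (carrier R))"
    using local_cohomology_1_iso by (simp add: H1 Rt' R' MM' ideal_transform_eq)
  moreover have "macaulayfication R Rt"
    unfolding macaulayfication_def Rt' R'
    using curve_ring_subset cohen_macaulay_saturated_ring finite_length
    by (auto simp: ring_hom_def)
  ultimately show ?thesis ..
qed

end
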